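(* Let $F(w)=w+cw^2+O(w^3)\in w\mathbb{C}\{w\}$ with $c\in\mathbb{C}^*$, and let $f,\rho,\tilde\varphi,\hat\varphi,U^\pm,\mathcal L^\pm\hat\varphi,\operatorname{Log}^\pm,\mathscr P^\pm_{R,\delta}$ be as in the context. The formulas $$v_*^\pm(z)=z+\rho\operatorname{Log}^\pm z+\mathcal{L}^\pm\hat\varphi(z),\qquad z\in U^\pm,$$ define a pair $(v_*^+,v_*^-)$ of Fatou coordinates at $\infty$ for the simple parabolic germ $f$. For any $0<\delta'<\delta<\pi/2$, provided that $R$ is large enough, the function $\mathcal L^\pm\hat\varphi$ has uniform $1$-Gevrey asymptotic expansion $\tilde\varphi$ in $\mathscr P^\pm_{R,\delta}$, and the function $v_*^\pm$ is univalent in $\mathscr P^\pm_{R,\delta}$ with its image containing a set of the form $\mathscr P^\pm_{R',\delta'}$. Any other pair of Fatou coordinates at $\infty$ for $f$ is of the form $(v_*^++c^+,\,v_*^-+c^-)$ with arbitrary complex constants $c^+,c^-$.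
   Context: Setting. Given $F(w)=w+cw^2+O(w^3)\in w\mathbb{C}\{w\}$ with $c\in\mathbb{C}^*$ (a simple parabolic germ at $0$), rewrite it at $\infty$ via $z=-1/(cw)$: $$f(z)=-\frac{1}{c\,F\big(-\frac{1}{cz}\big)}=z+1+a(z),\qquad a(z)=-\rho z^{-1}+O(z^{-2})\in z^{-1}\mathbb{C}\{z^{-1}\},$$ which defines $\rho\in\mathbb{C}$. Set $b(z)=a(z-1)\in z^{-1}\mathbb{C}\{z^{-1}\}$ and $b_1(z)=b(z)+\rho\log\frac{1+z^{-1}b(z)}{1-z^{-1}}\in z^{-2}\mathbb{C}\{z^{-1}\}$ (principal branch of $\log$). Sectors. For $R>0$ and $\delta\in(0,\pi/2)$, $$\mathscr P^+_{R,\delta}=\{r\mathrm e^{\mathrm i\theta}\mid r>R,\ -\tfrac\pi2-\delta<\theta<\tfrac\pi2+\delta\},\qquad \mathscr P^-_{R,\delta}=\{r\mathrm e^{\mathrm i\theta}\mid r>R,\ \tfrac\pi2-\delta<\theta<\tfrac{3\pi}2+\delta\}.$$ Fatou coordinates. A pair of Fatou coordinates at $\infty$ (for $f$) is a pair $(v^+,v^-)$ of univalent (injective holomorphic) maps $v^+:\mathscr P^+_{R,\delta}\to\mathbb{C}$, $v^-:\mathscr P^-_{R,\delta}\to\mathbb{C}$, for some $R$ and $\delta$, such that $v^+\circ f=v^++1$ and $v^-\circ f=v^-+1$. These equations are understood at points $z$ of the domain, with $|z|$ large enough for $f$ to be defined and holomorphic, such that $f(z)$ is also in the domain. Saying that $v_*^\pm$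 (defined on $U^\pm$) form such a pair, or that two pairs are equal up to constants, is understood after restriction to $\mathscr P^\pm_{R,\delta}$ with $R$ large enough. Formal solution and its Borel transform. $\tilde\varphi(z)=\sum_{n\ge0}c_nz^{-n-1}\in z^{-1}\mathbb{C}[[z^{-1}]]$ is the unique formal series without constant term solving $\varphi(z-1)=\varphi(z+b(z))+b_1(z)$ (formal Taylor composition), and $\hat\varphi(\zeta)=\sum_{n\ge0}c_n\frac{\zeta^n}{n!}$ is its formal Borel transform. The series $\hat\varphi$ converges near $0$, and, with $I^+_{\delta_0}=[-\delta_0,\delta_0]$, $I^-_{\delta_0}=[\pi-\delta_0,\pi+\delta_0]$, for every $\delta_0\in(0,\pi/2)$ it extends analytically along all rays from $0$ with direction $\theta\in I^+_{\delta_0}\cup I^-_{\delta_0}$, and there exist $C_0,R_0>0$ with $|\hat\varphi(t\mathrm e^{\mathrm i\theta})|\le C_0\mathrm e^{R_0t}$ for all $t\ge0$, $\theta\in I^+_{\delta_0}\cup I^-_{\delta_0}$; for each $\delta_0$ fix such an $R_0=R_0(\delta_0)$. Borel–Laplace sums. For $\theta\in I^+_{\delta_0}\cup I^-_{\delta_0}$, $\mathcal L^\theta\hat\varphi(z)=\int_0^{\mathrm e^{\mathrm i\theta}\infty}\mathrm e^{-z\zeta}\hat\varphi(\zeta)\,\mathrm d\zeta$ is holomorphic in the half-plane $\Pi^\theta_{R_0(\delta_0)}=\{z\in\mathbb{C}\mid \operatorname{Re}(z\,\mathrm e^{\mathrm i\theta})>R_0(\delta_0)\}$. Set $$U^\pm=\bigcup_{\delta_0\in(0,\pi/2)}\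 \bigcup_{\theta\in I^\pm_{\delta_0}}\Pi^\theta_{R_0(\delta_0)}.$$ The functions $\mathcal L^\theta\hat\varphi$ with $\theta\in I^+_{\delta_0}$ (respectively $I^-_{\delta_0}$), $\delta_0\in(0,\pi/2)$, extend one another, and $\mathcal L^+\hat\varphi$ on $U^+$ (respectively $\mathcal L^-\hat\varphi$ on $U^-$) denotes the resulting holomorphic function. Logarithms. $U^\pm\subset\mathbb{C}\setminus\mathbb{R}^\mp$ where $\mathbb{R}^-=(-\infty,0]$, $\mathbb{R}^+=[0,+\infty)$; $\operatorname{Log}^+z=\int_1^z\frac{\mathrm du}{u}$ for $z\in\mathbb{C}\setminus\mathbb{R}^-$ and $\operatorname{Log}^-z=\mathrm i\pi+\int_{-1}^z\frac{\mathrm du}{u}$ for $z\in\mathbb{C}\setminus\mathbb{R}^+$ (paths of integration in the respective slit planes). Gevrey asymptotics. A holomorphic function $\psi$ has uniform $1$-Gevrey asymptotic expansion $\sum_{n\ge0}c_nz^{-n-1}$ in $\mathscr P^\pm_{R,\delta}$ if there are $L,M>0$ such that $\big|\psi(z)-\sum_{n=0}^{N-1}c_nz^{-n-1}\big|\le L\,M^N\,N!\,|z|^{-N-1}$ for all integers $N\ge0$ and all $z\in\mathscr P^\pm_{R,\delta}$. *)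

theory Defs
  imports "HOL-Complex_Analysis.Complex_Analysis" "HOL-Library.Landau_Symbols"
begin

subsection \<open>The germ at infinity\<close>

definition germ_at_infinity :: "(complex \<Rightarrow> complex) \<Rightarrow> complex \<Rightarrow> complex \<Rightarrow> complex" where
  "germ_at_infinity F c z = - 1 / (c * F (- 1 / (c * z)))"

definition germ_a :: "(complex \<Rightarrow> complex) \<Rightarrow> complex \<Rightarrow> complex \<Rightarrow> complex" where
  "germ_a F c z = germ_at_infinity F c z - z - 1"

definition germ_b :: "(complex \<Rightarrow> complex) \<Rightarrow> complex \<Rightarrow> complex \<Rightarrow> complex" where
  "germ_b F c z = germ_a F c (z - 1)"

definition germ_b1 :: "(complex \<Rightarrow> complex) \<Rightarrow> complex \<Rightarrow> complex \<Rightarrow> complex \<Rightarrow> complex" where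
  "germ_b1 F c \<rho> z =
     germ_b F c z + \<rho> * Ln ((1 + inverse z * germ_b F c z) / (1 - inverse z))"

subsection \<open>Formal series in the inverse variable\<close>

text \<open>A formal series \<open>\<Sum>n. p\<^sub>n z\<^sup>-\<^sup>n\<close> is represented by the formal power series with
  coefficients \<open>p\<^sub>n\<close>, that is, as a series in the indeterminate \<open>u = z\<^sup>-\<^sup>1\<close>.\<close>

definition expands_at_infinity :: "(complex \<Rightarrow> complex) \<Rightarrow> complex fps \<Rightarrow> bool" where
  "expands_at_infinity g P \<longleftrightarrow>
     fps_conv_radius P > 0 \<and> (\<forall>\<^sub>F z in at_infinity. g z = eval_fps P (inverse z))"

text \<open>\<open>d/dz\<close> in the indeterminate \<open>u = z\<^sup>-\<^sup>1\<close> is \<open>- u\<^sup>2 d/du\<close>.\<close>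

definition deriv_z :: "complex fps \<Rightarrow> complex fps" where
  "deriv_z P = - (fps_X ^ 2 * fps_deriv P)"

text \<open>The formal Taylor composition
  \<open>P (z + h(z)) = \<Sum>k. h(z)\<^sup>k / k! * (d/dz)\<^sup>k P (z)\<close>, as a series converging in the
  formal (Krull) topology of the type \<open>fps\<close>. It converges for every \<open>h\<close>, because
  the \<open>k\<close>-th summand has order greater than \<open>k\<close> for \<open>k \<ge> 1\<close>.\<close>

definition formal_shift :: "complex fps \<Rightarrow> complex fps \<Rightarrow> complex fps" where
  "formal_shift P h = (\<Sum>k. fps_const (1 / fact k) * h ^ k * (deriv_z ^^ k) P)"

definition formal_solution ::
  "(complex \<Rightarrow> complex) \<Rightarrow> (complex \<Rightarrow> complex) \<Rightarrow> complex fps \<Rightarrow> bool" where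
  "formal_solution b b1 \<phi> \<longleftrightarrow> fps_nth \<phi> 0 = 0 \<and>
     (\<exists>B B1. expands_at_infinity b B \<and> expands_at_infinity b1 B1 \<and>
        formal_shift \<phi> (- 1) = formal_shift \<phi> B + B1)"

text \<open>For \<open>\<phi> = \<Sum>n. c\<^sub>n z\<^sup>-\<^sup>n\<^sup>-\<^sup>1\<close> the coefficient \<open>c\<^sub>n\<close> is \<open>fps_nth \<phi> (Suc n)\<close>.\<close>

definition borel_transform :: "complex fps \<Rightarrow> complex fps" where
  "borel_transform \<phi> = Abs_fps (\<lambda>n. fps_nth \<phi> (Suc n) / fact n)"

subsection \<open>Sectors, rays and half-planes\<close>

definition P_plus :: "real \<Rightarrow> real \<Rightarrow> complex set" where
  "P_plus R \<delta> = {of_real r * cis \<theta> | r \<theta>. r > R \<and> - pi/2 - \<delta> < \<theta> \<and> \<theta> < pi/2 + \<delta>}"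

definition P_minus :: "real \<Rightarrow> real \<Rightarrow> complex set" where
  "P_minus R \<delta> = {of_real r * cis \<theta> | r \<theta>. r > R \<and> pi/2 - \<delta> < \<theta> \<and> \<theta> < 3*pi/2 + \<delta>}"

definition I_plus :: "real \<Rightarrow> real set" where
  "I_plus \<delta>0 = {- \<delta>0..\<delta>0}"

definition I_minus :: "real \<Rightarrow> real set" where
  "I_minus \<delta>0 = {pi - \<delta>0..pi + \<delta>0}"

definition ray :: "real \<Rightarrow> complex set" where
  "ray \<theta> = {of_real t * cis \<theta> | t. t \<ge> 0}"

definition half_plane :: "real \<Rightarrow> real \<Rightarrow> complex set" where
  "half_plane \<theta> R = {z. Re (z * cis \<theta>) > R}"

subsection \<open>Borel--Laplace sums\<close>

definition laplace :: "real \<Rightarrow> (complex \<Rightarrow> complex) \<Rightarrow> complex \<Rightarrow> complex" where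
  "laplace \<theta> g z =
     (LBINT t:{0..}. exp (- z * (of_real t * cis \<theta>)) * g (of_real t * cis \<theta>) * cis \<theta>)"

definition sum_domain :: "(real \<Rightarrow> real set) \<Rightarrow> (real \<Rightarrow> real) \<Rightarrow> complex set" where
  "sum_domain I R0 = (\<Union>\<delta>0\<in>{0<..<pi/2}. \<Union>\<theta>\<in>I \<delta>0. half_plane \<theta> (R0 \<delta>0))"

text \<open>The common value at \<open>z\<close> of all Laplace transforms whose half-plane contains \<open>z\<close>.\<close>

definition laplace_sum ::
  "(real \<Rightarrow> real set) \<Rightarrow> (real \<Rightarrow> real) \<Rightarrow> (complex \<Rightarrow> complex) \<Rightarrow> complex \<Rightarrow> complex" where
  "laplace_sum I R0 g z =
     (THE w. \<exists>\<delta>0\<in>{0<..<pi/2}. \<exists>\<theta>\<in>I \<delta>0. z \<in> half_plane \<theta> (R0 \<delta>0) \<and> w = laplace \<theta> g z)"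

abbreviation "U_plus \<equiv> sum_domain I_plus"
abbreviation "U_minus \<equiv> sum_domain I_minus"
abbreviation "L_plus \<equiv> laplace_sum I_plus"
abbreviation "L_minus \<equiv> laplace_sum I_minus"

text \<open>Each slit plane is star-shaped about the base point, so the segment is a valid path of
  integration.\<close>

definition Log_plus :: "complex \<Rightarrow> complex" where
  "Log_plus z = contour_integral (linepath 1 z) (\<lambda>u. 1 / u)"

definition Log_minus :: "complex \<Rightarrow> complex" where
  "Log_minus z = \<i> * pi + contour_integral (linepath (- 1) z) (\<lambda>u. 1 / u)"

lemma Log_plus_eq_Ln:
  assumes "z \<notin> \<real>\<^sub>\<le>\<^sub>0"
  shows "Log_plus z = Ln z"
proof -
  have slit: "u \<notin> \<real>\<^sub>\<le>\<^sub>0" if seg: "u \<in> closed_segment 1 z" for u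
  proof
    assume u: "u \<in> \<real>\<^sub>\<le>\<^sub>0"
    obtain t where t: "0 \<le> t" "t \<le> 1" "u = (1 - t) *\<^sub>R 1 + t *\<^sub>R z"
      using seg by (auto simp only: in_segment)
    have "Im (u) = t * Im (z)" "Re (u) = (1 - t) + t * Re (z)"
      unfolding t(3) by simp_all
    with u have *: "t * Im (z) = 0" "(1 - t) + t * Re (z) \<le> 0"
      by (simp_all add: complex_nonpos_Reals_iff)
    hence "t \<noteq> 0" by auto
    with *(1) have "Im (z) = 0" by simp
    with assms have "Re (z) > 0" by (auto simp: complex_nonpos_Reals_iff)
    with t(1) \<open>t \<noteq> 0\<close> have "t * Re (z) > 0" by (simp add: mult_pos_neg)
    with *(2) t(2) show False by linarith
  qed
  have "(Ln has_field_derivative 1 / u) (at u within closed_segment 1 z)"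
    if "u \<in> closed_segment 1 z" for u
    using has_field_derivative_Ln[OF slit[OF that]]
    by (simp add: inverse_eq_divide has_field_derivative_at_within)
  from contour_integral_primitive[OF this, of "linepath 1 z"]
  have "((\<lambda>u. 1 / u) has_contour_integral (Ln z)) (linepath 1 z)"
    by simp
  thus ?thesis by (simp add: Log_plus_def contour_integral_unique)
qed

lemma Log_minus_eq_Ln:
  assumes "- z \<notin> \<real>\<^sub>\<le>\<^sub>0"
  shows "Log_minus z = \<i> * pi + Ln (- z)"
proof -
  have slit: "- u \<notin> \<real>\<^sub>\<le>\<^sub>0" if seg: "u \<in> closed_segment (- 1) z" for u
  proof
    assume u: "- u \<in> \<real>\<^sub>\<le>\<^sub>0"
    obtain t where t: "0 \<le> t" "t \<le> 1" "u = (1 - t) *\<^sub>R (- 1) + t *\<^sub>R z"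
      using seg by (auto simp only: in_segment)
    have "Im (- u) = t * Im (- z)" "Re (- u) = (1 - t) + t * Re (- z)"
      unfolding t(3) by simp_all
    with u have *: "t * Im (- z) = 0" "(1 - t) + t * Re (- z) \<le> 0"
      by (simp_all add: complex_nonpos_Reals_iff)
    hence "t \<noteq> 0" by auto
    with *(1) have "Im (- z) = 0" by simp
    with assms have "Re (- z) > 0" by (auto simp: complex_nonpos_Reals_iff)
    with t(1) \<open>t \<noteq> 0\<close> have "t * Re (- z) > 0" by (simp add: mult_pos_neg)
    with *(2) t(2) show False by linarith
  qed
  have "((\<lambda>u. Ln (- u)) has_field_derivative 1 / u) (at u within closed_segment (- 1) z)"
    if "u \<in> closed_segment (- 1) z" for u
    using DERIV_chain2[OF has_field_derivative_Ln[OF slit[OF that]]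
        DERIV_minus[OF DERIV_ident]]
    by (simp add: inverse_eq_divide has_field_derivative_at_within)
  from contour_integral_primitive[OF this, of "linepath (- 1) z"]
  have "((\<lambda>u. 1 / u) has_contour_integral (Ln (- z))) (linepath (- 1) z)"
    by simp
  thus ?thesis by (simp add: Log_minus_def contour_integral_unique)
qed

definition v_plus :: "complex \<Rightarrow> (real \<Rightarrow> real) \<Rightarrow> (complex \<Rightarrow> complex) \<Rightarrow> complex \<Rightarrow> complex" where
  "v_plus \<rho> R0 g z = z + \<rho> * Log_plus z + L_plus R0 g z"

definition v_minus :: "complex \<Rightarrow> (real \<Rightarrow> real) \<Rightarrow> (complex \<Rightarrow> complex) \<Rightarrow> complex \<Rightarrow> complex" where
  "v_minus \<rho> R0 g z = z + \<rho> * Log_minus z + L_minus R0 g z"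

subsection \<open>Fatou coordinates and Gevrey asymptotics\<close>

text \<open>The germ \<open>f\<close> at infinity is a total function with arbitrary values near the origin; the
  functional equation is required only where \<open>f\<close> is analytic on the whole neighbourhood
  \<open>{w. norm w \<ge> norm z}\<close> of infinity.\<close>

definition fatou_coordinate_on ::
  "(complex \<Rightarrow> complex) \<Rightarrow> complex set \<Rightarrow> (complex \<Rightarrow> complex) \<Rightarrow> bool" where
  "fatou_coordinate_on f D v \<longleftrightarrow> v holomorphic_on D \<and> inj_on v D \<and>
     (\<forall>z\<in>D. f analytic_on {w. norm w \<ge> norm z} \<longrightarrow> f z \<in> D \<longrightarrow> v (f z) = v z + 1)"

definition fatou_pair ::
  "(complex \<Rightarrow> complex) \<Rightarrow> real \<Rightarrow> real \<Rightarrow> (complex \<Rightarrow> complex) \<Rightarrow> (complex \<Rightarrow> complex) \<Rightarrow> bool" where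
  "fatou_pair f R \<delta> vp vm \<longleftrightarrow> 0 < R \<and> 0 < \<delta> \<and> \<delta> < pi/2 \<and>
     fatou_coordinate_on f (P_plus R \<delta>) vp \<and> fatou_coordinate_on f (P_minus R \<delta>) vm"

definition gevrey_asymptotic :: "(complex \<Rightarrow> complex) \<Rightarrow> complex fps \<Rightarrow> complex set \<Rightarrow> bool" where
  "gevrey_asymptotic \<psi> \<phi> D \<longleftrightarrow> \<psi> holomorphic_on D \<and>
     (\<exists>L>0. \<exists>M>0. \<forall>N. \<forall>z\<in>D.
        norm (\<psi> z - (\<Sum>n<N. fps_nth \<phi> (Suc n) / z ^ (n + 1)))
          \<le> L * M ^ N * fact N / norm z ^ (N + 1))"

end

theory Submission
  imports Defs "HOL-Real_Asymp.Real_Asymp"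
begin

text \<open>
  The function \<open>v = z + \<rho> Log z + \<psi>\<close>, with \<open>\<psi>\<close> the Borel--Laplace sum of the formal solution, satisfies
  \<open>v \<circ> f = v + 1\<close> exactly when \<open>\<psi>\<close> satisfies the difference equation \<open>\<psi>(z - 1) = \<psi>(z + b(z)) + b1(z)\<close>
  that the formal series satisfies. That \<open>\<psi>\<close> does so is the main point; it is proved
  by comparing asymptotic expansions, instead of following the composition \<open>\<psi>(z + b(z))\<close> through the Borel plane.

  By rotating the ray of integration, \<open>\<psi>\<close> is defined on a sector of opening greater than \<open>\<pi>\<close>, and
  Taylor's formula for the Borel transform gives the Gevrey expansion of \<open>\<psi>\<close> there
  (\<open>laplace_rotate\<close>, \<open>L_plus_gevrey\<close>). The formal Taylor shift is a substitution
  of power series (\<open>formal_shift_eq_compose\<close>), so the truncations of the formal solution satisfy the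
  equation up to an error which a Cauchy estimate bounds by \<open>L M\<^sup>N N! / norm z ^ N\<close>
  (\<open>truncation_error_of_formal_solution\<close>). Hence the defect of the equation for \<open>\<psi>\<close> has the same bounds, is
  exponentially small, and vanishes by Watson's uniqueness theorem, since the opening is greater than \<open>\<pi>\<close>
  (\<open>exponentially_flat_on_wide_sector_eq_0\<close>, \<open>sum_of_formal_solution_solves_equation\<close>).

  The remaining properties follow from \<open>v(z) - z\<close> being of smaller order than \<open>z\<close> on every sector: such a
  holomorphic map is injective on narrower sectors far from the origin, and its image contains sectors
  (\<open>inj_on_near_identity\<close>, \<open>sector_subset_image_near_identity\<close>). In particular the image of \<open>v\<close> contains a
  half-plane, and another Fatou coordinate composed with the inverse of \<open>v\<close> is injective there and commutes
  with the unit translation. It extends to an injective entire function, which little Picard shows to be a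
  translation (\<open>injective_map_commuting_with_unit_translation\<close>, \<open>fatou_coordinate_unique\<close>).

  The sectors around the negative real axis are obtained from those around the positive one by reflection.
\<close>

section \<open>Sectors\<close>

text \<open>Since \<open>cos (\<pi>/2 + \<delta>) = - sin \<delta>\<close>, the second condition says that \<open>\<sigma> z\<close> has
  argument less than \<open>\<pi>/2 + \<delta>\<close> in absolute value. In this form no choice of argument is involved
  and perturbation estimates become linear inequalities. The values \<open>\<sigma> = 1\<close> and \<open>\<sigma> = -1\<close> give, for
  \<open>0 < \<delta> < \<pi>/2\<close>, the sets \<^const>\<open>P_plus\<close> and \<^const>\<open>P_minus\<close>, so that both sides can be treated at once.\<close>

definition sector :: "complex \<Rightarrow> real \<Rightarrow> real \<Rightarrow> complex set" where
  "sector \<sigma> R \<delta> = {z. R < norm z \<and> - sin \<delta> * norm z < Re (\<sigma> * z)}"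

lemma sin_strict_mono_quarter:
  assumes "0 < \<delta>" "\<delta> < \<delta>'" "\<delta>' < pi/2"
  shows "0 < sin \<delta>" "sin \<delta> < sin \<delta>'" "sin \<delta>' < 1"
proof -
  show "0 < sin \<delta>" using assms by (intro sin_gt_zero) auto
  show "sin \<delta> < sin \<delta>'" using assms by (intro sin_monotone_2pi) auto
  have "sin \<delta>' < sin (pi/2)" using assms by (intro sin_monotone_2pi) auto
  then show "sin \<delta>' < 1" by simp
qed

lemma Re_eq_norm_mult_cos_Arg: "Re z = norm z * cos (Arg z)"
proof -
  have "Re (rcis (norm z) (Arg z)) = norm z * cos (Arg z)" by simp
  then show ?thesis by (simp only: rcis_cmod_Arg)
qed

lemma abs_Arg_less_of_sector:
  assumes "0 \<le> R" "0 < \<delta>" "\<delta> < pi/2" and z: "z \<in> sector 1 R \<delta>"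
  shows "\<bar>Arg z\<bar> < pi/2 + \<delta>"
proof -
  have nz: "norm z > 0" using assms by (auto simp: sector_def)
  have "- sin \<delta> * norm z < cos (Arg z) * norm z"
    using z by (simp add: sector_def Re_eq_norm_mult_cos_Arg mult.commute)
  then have "- sin \<delta> < cos (Arg z)" using nz by (rule mult_right_less_imp_less[OF _ less_imp_le])
  then have *: "cos (pi/2 + \<delta>) < cos \<bar>Arg z\<bar>" by (simp add: cos_add)
  show ?thesis
  proof (rule ccontr)
    assume "\<not> \<bar>Arg z\<bar> < pi/2 + \<delta>"
    then have "cos \<bar>Arg z\<bar> \<le> cos (pi/2 + \<delta>)"
      using Arg_bounded[of z] assms by (intro cos_monotone_0_pi_le) auto
    with * show False by simp
  qed
qed

lemma P_plus_eq_sector: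
  assumes "0 \<le> R" "0 < \<delta>" "\<delta> < pi/2"
  shows "P_plus R \<delta> = sector 1 R \<delta>"
proof (intro equalityI subsetI)
  fix z assume "z \<in> P_plus R \<delta>"
  then obtain r \<theta> where z: "z = of_real r * cis \<theta>" "r > R" "- pi/2 - \<delta> < \<theta>" "\<theta> < pi/2 + \<delta>"
    by (auto simp: P_plus_def)
  have r: "r > 0" using z assms by simp
  have "cos (pi/2 + \<delta>) < cos \<bar>\<theta>\<bar>"
    using z assms by (intro cos_monotone_0_pi) auto
  then have "- sin \<delta> < cos \<theta>" by (simp add: cos_add)
  then have "r * - sin \<delta> < r * cos \<theta>" using r by (intro mult_strict_left_mono)
  then show "z \<in> sector 1 R \<delta>" using z r by (simp add: sector_def norm_mult mult.commute)
next
  fix z assume z: "z \<in> sector 1 R \<delta>"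
  have zp: "z = of_real (norm z) * cis (Arg z)"
    using rcis_cmod_Arg[of z] by (simp add: rcis_def)
  then show "z \<in> P_plus R \<delta>" unfolding P_plus_def
    using abs_Arg_less_of_sector[OF assms z] z
    by (intro CollectI exI[of _ "norm z"] exI[of _ "Arg z"]) (auto simp: sector_def)
qed

lemma P_minus_eq_uminus_P_plus: "z \<in> P_minus R \<delta> \<longleftrightarrow> - z \<in> P_plus R \<delta>"
proof
  assume "z \<in> P_minus R \<delta>"
  then obtain r \<theta> where z: "z = of_real r * cis \<theta>" "r > R" "pi/2 - \<delta> < \<theta>" "\<theta> < 3*pi/2 + \<delta>"
    by (auto simp: P_minus_def)
  then show "- z \<in> P_plus R \<delta>" unfolding P_plus_def
    by (intro CollectI exI[of _ r] exI[of _ "\<theta> - pi"]) (auto simp: complex_eq_iff cos_diff sin_diff)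
next
  assume "- z \<in> P_plus R \<delta>"
  then obtain r \<theta> where z: "- z = of_real r * cis \<theta>" "r > R" "- pi/2 - \<delta> < \<theta>" "\<theta> < pi/2 + \<delta>"
    by (auto simp: P_plus_def)
  have "z = of_real r * cis (\<theta> + pi)"
    using z(1) by (metis add.inverse_inverse cis_mult cis_pi mult_minus_right mult.right_neutral)
  then show "z \<in> P_minus R \<delta>" unfolding P_minus_def
    using z by (intro CollectI exI[of _ r] exI[of _ "\<theta> + pi"]) auto
qed

lemma P_minus_eq_sector:
  assumes "0 \<le> R" "0 < \<delta>" "\<delta> < pi/2"
  shows "P_minus R \<delta> = sector (-1) R \<delta>"
  using P_plus_eq_sector[OF assms] by (auto simp: P_minus_eq_uminus_P_plus sector_def)

lemma open_sector [simp]: "open (sector \<sigma> R \<delta>)"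
  unfolding sector_def by (intro open_Collect_conj open_Collect_less continuous_intros)

lemma connected_sector:
  assumes "norm \<sigma> = 1" "0 \<le> R" "0 < \<delta>" "\<delta> < pi/2"
  shows "connected (sector \<sigma> R \<delta>)"
proof -
  have "P_plus R \<delta> = (\<lambda>(r, \<theta>). of_real r * cis \<theta>) ` ({R<..} \<times> {- pi/2 - \<delta> <..< pi/2 + \<delta>})"
    unfolding P_plus_def by force
  moreover have "connected ((\<lambda>(r, \<theta>). of_real r * cis \<theta>) ` ({R<..} \<times> {- pi/2 - \<delta> <..< pi/2 + \<delta>}))"
    by (intro connected_continuous_image connected_Times)
       (auto simp: case_prod_unfold intro!: continuous_intros)
  ultimately have 1: "connected (sector 1 R \<delta>)"
    using P_plus_eq_sector assms by simp
  have [simp]: "cnj \<sigma> * \<sigma> = 1" "\<sigma> * cnj \<sigma> = 1"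
    using assms(1) by (simp_all add: mult.commute complex_norm_square[symmetric])
  have [simp]: "\<sigma> * (cnj \<sigma> * z) = z" "cnj \<sigma> * (\<sigma> * z) = z" for z
    by (simp_all flip: mult.assoc)
  have "sector \<sigma> R \<delta> = (\<lambda>z. cnj \<sigma> * z) ` sector 1 R \<delta>"
  proof (intro equalityI subsetI)
    fix z assume "z \<in> sector \<sigma> R \<delta>"
    then have "\<sigma> * z \<in> sector 1 R \<delta>" using assms(1) by (simp add: sector_def norm_mult)
    then show "z \<in> (\<lambda>z. cnj \<sigma> * z) ` sector 1 R \<delta>" by (rule rev_image_eqI) simp
  next
    fix z assume "z \<in> (\<lambda>z. cnj \<sigma> * z) ` sector 1 R \<delta>"
    then obtain y where y: "y \<in> sector 1 R \<delta>" "z = cnj \<sigma> * y" by blast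
    then have "\<sigma> * z = y" "norm z = norm y" using assms(1) by (simp_all add: norm_mult)
    with y show "z \<in> sector \<sigma> R \<delta>" unfolding sector_def by force
  qed
  moreover have "connected ((\<lambda>z. cnj \<sigma> * z) ` sector 1 R \<delta>)"
    by (intro connected_continuous_image 1 continuous_intros)
  ultimately show ?thesis by simp
qed

lemma sector_mono: "R' \<le> R \<Longrightarrow> sector \<sigma> R \<delta> \<subseteq> sector \<sigma> R' \<delta>"
  by (auto simp: sector_def)

lemma sector_widen:
  assumes "0 < \<delta>" "\<delta> < \<delta>'" "\<delta>' < pi/2" "R' \<le> R"
  shows "sector \<sigma> R \<delta> \<subseteq> sector \<sigma> R' \<delta>'"
proof
  fix z assume z: "z \<in> sector \<sigma> R \<delta>"
  have "- sin \<delta>' * norm z \<le> - sin \<delta> * norm z"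
    using sin_strict_mono_quarter[OF assms(1-3)] by (intro mult_right_mono) auto
  then show "z \<in> sector \<sigma> R' \<delta>'" using z assms(4) by (auto simp: sector_def)
qed

lemma real_in_sector:
  assumes "\<sigma> = 1 \<or> \<sigma> = -1" "R < x" "0 < x" "0 < \<delta>" "\<delta> < pi/2"
  shows "\<sigma> * of_real x \<in> sector \<sigma> R \<delta>"
proof -
  have "0 < sin \<delta>" using assms by (intro sin_gt_zero) auto
  then have "- sin \<delta> * x < 0" using assms by simp
  also note \<open>0 < x\<close>
  finally show ?thesis using assms by (auto simp: sector_def norm_mult)
qed

text \<open>A sector has room inside any wider one proportionally to \<open>norm z\<close>: a displacement of relative size
  \<open>\<eta>\<close> costs at most \<open>\<eta> (1 + sin \<delta>')\<close> in the angular inequality, whence the choice of \<open>\<eta>\<close> as half of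
  the gap \<open>sin \<delta>' - sin \<delta>\<close>.\<close>

lemma sector_perturb:
  assumes "0 < \<delta>" "\<delta> < \<delta>'" "\<delta>' < pi/2" "norm \<sigma> = 1"
  obtains \<eta> where "0 < \<eta>" "\<eta> \<le> 1/2"
    "\<And>R z w. 0 \<le> R \<Longrightarrow> z \<in> sector \<sigma> R \<delta> \<Longrightarrow> norm (w - z) \<le> \<eta> * norm z \<Longrightarrow> w \<in> sector \<sigma> (R/2) \<delta>'"
proof
  note s = sin_strict_mono_quarter[OF assms(1-3)]
  define \<eta> where "\<eta> = (sin \<delta>' - sin \<delta>) / 2"
  show \<eta>: "0 < \<eta>" "\<eta> \<le> 1/2" using s by (auto simp: \<eta>_def)
  fix R z w assume R: "0 \<le> (R::real)" and z: "z \<in> sector \<sigma> R \<delta>" and w: "norm (w - z) \<le> \<eta> * norm z"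
  have z': "norm z > R" "- sin \<delta> * norm z < Re (\<sigma> * z)" using z by (auto simp: sector_def)
  have lo: "norm w \<ge> norm z - \<eta> * norm z"
    using norm_triangle_ineq2[of z "z - w"] w by (simp add: norm_minus_commute)
  have "\<eta> * norm z \<le> 1/2 * norm z" using \<eta> by (intro mult_right_mono) auto
  then have "norm w > R/2" using lo z' by linarith
  moreover have "\<bar>Re (\<sigma> * (w - z))\<bar> \<le> \<eta> * norm z"
    using abs_Re_le_cmod[of "\<sigma> * (w - z)"] w assms(4) by (simp add: norm_mult)
  then have "Re (\<sigma> * w) > - sin \<delta> * norm z - \<eta> * norm z"
    using z' by (simp add: algebra_simps)
  moreover have "- sin \<delta>' * norm w \<le> - sin \<delta>' * (norm z - \<eta> * norm z)"
    using lo s by (intro mult_left_mono_neg) auto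
  moreover have "- sin \<delta>' * (norm z - \<eta> * norm z) \<le> - sin \<delta> * norm z - \<eta> * norm z"
  proof -
    have e: "sin \<delta>' = sin \<delta> + 2 * \<eta>" by (simp add: \<eta>_def field_simps)
    have "sin \<delta>' * (1 - \<eta>) - sin \<delta> - \<eta> = 2 * \<eta> - \<eta> * (1 + sin \<delta>')"
      using e by (simp add: algebra_simps)
    also have "\<eta> * (1 + sin \<delta>') \<le> \<eta> * 2" using \<eta> s by (intro mult_left_mono) auto
    then have "0 \<le> 2 * \<eta> - \<eta> * (1 + sin \<delta>')" by simp
    finally have "0 \<le> (sin \<delta>' * (1 - \<eta>) - sin \<delta> - \<eta>) * norm z" by simp
    then show ?thesis by (simp add: algebra_simps)
  qed
  ultimately show "w \<in> sector \<sigma> (R/2) \<delta>'" by (auto simp: sector_def)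
qed

section \<open>Exponentially flat functions on wide sectors vanish\<close>

text \<open>This is the uniqueness half of Watson's lemma. With \<open>p < 1\<close> such that \<open>z\<^sup>p\<close> maps a slightly
  smaller sector, still of opening greater than \<open>\<pi>\<close>, onto the right half-plane, the function
  \<open>G(z) exp (\<mu> z\<^sup>p)\<close> is bounded by a constant on the two sides of that sector and tends to \<open>0\<close> at infinity for
  every \<open>\<mu>\<close>, because \<open>p < 1\<close>. The maximum principle
  bounds \<open>G\<close> on the axis by a multiple of \<open>exp (- \<mu> (x\<^sup>p - R\<^sup>p))\<close>; then \<open>\<mu>\<close> tends to infinity.\<close>

lemma exponentially_flat_on_wide_sector_eq_0:
  assumes \<sigma>: "\<sigma> = 1 \<or> \<sigma> = -1" and R: "0 \<le> R" and \<delta>: "0 < \<delta>" "\<delta> < pi/2"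
    and hol: "G holomorphic_on sector \<sigma> R \<delta>"
    and bd: "\<And>z. z \<in> sector \<sigma> R \<delta> \<Longrightarrow> norm (G z) \<le> C * exp (- \<kappa> * norm z)" and \<kappa>: "\<kappa> > 0"
    and z: "z \<in> sector \<sigma> R \<delta>"
  shows "G z = 0"
proof -
  define \<delta>1 where "\<delta>1 = \<delta>/2"
  have \<delta>1: "0 < \<delta>1" "\<delta>1 < \<delta>" "\<delta>1 < pi/2" using \<delta> by (auto simp: \<delta>1_def)
  note s = sin_strict_mono_quarter[OF \<delta>1(1,2) \<delta>(2)]
  \<comment> \<open>The power \<open>p\<close> takes the sides of the sector, of argument \<open>\<pi>/2 + \<delta>1\<close>, to the imaginary axis.\<close>
  define p where "p = (pi/2) / (pi/2 + \<delta>1)"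
  have p: "0 < p" "p < 1" using \<delta>1 pi_gt_zero by (auto simp: p_def field_simps add_pos_pos)
  define R1 where "R1 = R + 1"
  have \<sigma>\<sigma>: "\<sigma> * (\<sigma> * w) = w" and n\<sigma>: "norm (\<sigma> * w) = norm w" for w using \<sigma> by auto
  define H where "H w = G (\<sigma> * w)" for w
  have in_sec: "\<sigma> * w \<in> sector \<sigma> R \<delta>" if "R1 \<le> norm w" "- sin \<delta>1 * norm w \<le> Re w" for w
  proof -
    have "sin \<delta>1 * norm w < sin \<delta> * norm w"
      using s that R by (intro mult_strict_right_mono) (auto simp: R1_def)
    with that show ?thesis unfolding sector_def mem_Collect_eq n\<sigma> \<sigma>\<sigma> R1_def by linarith
  qed
  have slit: "w \<notin> \<real>\<^sub>\<le>\<^sub>0" if "R1 \<le> norm w" "- sin \<delta>1 * norm w \<le> Re w" for w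
  proof
    assume "w \<in> \<real>\<^sub>\<le>\<^sub>0"
    then have "Im w = 0" "Re w \<le> 0" by (auto simp: complex_nonpos_Reals_iff)
    then have "Re w = - norm w" by (simp add: cmod_def)
    then have "norm w \<le> sin \<delta>1 * norm w" using that by simp
    moreover have "sin \<delta>1 * norm w < 1 * norm w"
      using s that R by (intro mult_strict_right_mono) (auto simp: R1_def)
    ultimately show False by simp
  qed
  have C: "C \<ge> 0"
  proof -
    have "0 \<le> C * exp (- \<kappa> * norm z)" using bd[OF z] norm_ge_zero order_trans by blast
    then show ?thesis by (simp add: zero_le_mult_iff)
  qed
  have Rez: "Re (w powr of_real p) = norm w powr p * cos (p * Arg w)" if "w \<noteq> 0" for w
  proof -
    have "w powr of_real p = exp (of_real p * Ln w)" using that by (simp add: powr_def)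
    also have "of_real p * Ln w = Complex (p * ln (norm w)) (p * Arg w)"
      using that by (simp add: complex_eq_iff Arg_eq_Im_Ln)
    finally show ?thesis using that by (simp add: Re_exp powr_def)
  qed
  have key: "norm (G (\<sigma> * of_real x)) \<le> C * exp (- \<mu> * (x powr p - R1 powr p))"
    if x: "x > R1" and \<mu>: "\<mu> \<ge> 0" for x \<mu>
  proof -
    have "eventually (\<lambda>K. \<mu> * K powr p - \<kappa> * K \<le> 0) at_top"
      using p \<kappa> by real_asymp
    moreover have "eventually (\<lambda>K. K > x) at_top" by (rule eventually_gt_at_top)
    ultimately obtain K where K: "\<mu> * K powr p - \<kappa> * K \<le> 0" "K > x"
      using eventually_happens[OF eventually_conj] by fastforce
    have x0: "x > 0" using x R by (simp add: R1_def)
    define S where "S = {w. R1 \<le> norm w \<and> norm w \<le> K \<and> - sin \<delta>1 * norm w \<le> Re w}"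
    have clS: "closed S" unfolding S_def
      by (intro closed_Collect_conj closed_Collect_le continuous_intros)
    define E where "E w = H w * exp (of_real \<mu> * w powr of_real p)" for w
    have hE: "E holomorphic_on S"
      unfolding E_def H_def S_def
      by (intro holomorphic_intros holomorphic_on_compose_gen[OF _ hol, unfolded o_def])
         (use in_sec slit in auto)
    have nE: "norm (E w) = norm (H w) * exp (\<mu> * (norm w powr p * cos (p * Arg w)))" if "w \<in> S" for w
    proof -
      have "w \<noteq> 0" using that R by (auto simp: S_def R1_def)
      then show ?thesis by (simp add: E_def norm_mult Rez)
    qed
    have nH: "norm (H w) \<le> C * exp (- \<kappa> * norm w)" if "w \<in> S" for w
      using bd[OF in_sec[of w]] that by (auto simp: S_def H_def n\<sigma>)
    have nE': "norm (E w) \<le> C * exp (\<mu> * (norm w powr p * t) - \<kappa> * norm w)"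
      if "w \<in> S" "cos (p * Arg w) \<le> t" for w t
    proof -
      have "\<mu> * (norm w powr p * cos (p * Arg w)) \<le> \<mu> * (norm w powr p * t)"
        using \<mu> that by (intro mult_left_mono) auto
      then have "norm (E w) \<le> (C * exp (- \<kappa> * norm w)) * exp (\<mu> * (norm w powr p * t))"
        unfolding nE[OF that(1)] using nH[OF that(1)] C by (intro mult_mono) auto
      also have "\<dots> = C * exp (\<mu> * (norm w powr p * t) - \<kappa> * norm w)"
        by (simp add: mult.assoc flip: exp_add)
      finally show ?thesis .
    qed
    have "norm (E (of_real x)) \<le> C * exp (\<mu> * R1 powr p)"
    proof (rule maximum_modulus_frontier[of E S])
      show "E holomorphic_on interior S" by (rule holomorphic_on_subset[OF hE interior_subset])
      show "continuous_on (closure S) E"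
        using hE clS by (simp add: holomorphic_on_imp_continuous_on)
      show "bounded S" by (rule boundedI[of _ K]) (auto simp: S_def)
      have "- sin \<delta>1 * x \<le> 0" using s x0 by simp
      then show "of_real x \<in> S" using x0 x K by (simp add: S_def)
      fix w assume w: "w \<in> frontier S"
      then have wS: "w \<in> S" using clS by (simp add: frontier_def)
      have "open {w. R1 < norm w \<and> norm w < K \<and> - sin \<delta>1 * norm w < Re w}"
        by (intro open_Collect_conj open_Collect_less continuous_intros)
      then have "{w. R1 < norm w \<and> norm w < K \<and> - sin \<delta>1 * norm w < Re w} \<subseteq> interior S"
        by (intro interior_maximal) (auto simp: S_def)
      then consider "norm w = R1" | "norm w = K" | "Re w = - sin \<delta>1 * norm w"
        using w wS by (force simp: frontier_def S_def)
      then show "norm (E w) \<le> C * exp (\<mu> * R1 powr p)"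
      proof cases
        case 1
        have "norm (E w) \<le> C * exp (\<mu> * (norm w powr p * 1) - \<kappa> * norm w)"
          by (intro nE' wS) auto
        also have "\<dots> \<le> C * exp (\<mu> * R1 powr p)"
          using C \<kappa> R 1 by (intro mult_left_mono) (auto simp: R1_def)
        finally show ?thesis .
      next
        case 2
        have "norm (E w) \<le> C * exp (\<mu> * (norm w powr p * 1) - \<kappa> * norm w)"
          by (intro nE' wS) auto
        also have "\<dots> \<le> C * exp 0"
          using K C 2 by (intro mult_left_mono) auto
        also have "\<dots> \<le> C * exp (\<mu> * R1 powr p)"
          using C \<mu> by (intro mult_left_mono) auto
        finally show ?thesis .
      next
        case 3
        have w0: "norm w > 0" using wS R by (auto simp: S_def R1_def)
        have "norm w * cos (Arg w) = norm w * - sin \<delta>1" using 3 by (simp add: Re_eq_norm_mult_cos_Arg mult.commute)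
        then have "cos (Arg w) = - sin \<delta>1" using w0 by (subst (asm) mult_cancel_left) auto
        then have *: "cos \<bar>Arg w\<bar> = cos (pi/2 + \<delta>1)" by (simp add: cos_add)
        have "\<bar>Arg w\<bar> \<le> pi" "0 \<le> pi/2 + \<delta>1" "pi/2 + \<delta>1 \<le> pi"
          using Arg_bounded[of w] \<delta>1 pi_gt_zero by (simp_all add: abs_le_iff)
        from cos_inj_pi[OF abs_ge_zero this *] have "\<bar>Arg w\<bar> = pi/2 + \<delta>1" .
        moreover have "pi/2 + \<delta>1 \<noteq> 0" using \<open>0 < \<delta>1\<close> \<delta>1 pi_gt_zero by linarith
        then have "p * (pi/2 + \<delta>1) = pi/2"
          unfolding p_def by (metis nonzero_eq_divide_eq)
        ultimately have "\<bar>p * Arg w\<bar> = pi/2"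
          using p by (simp add: abs_mult)
        then have "cos \<bar>p * Arg w\<bar> = cos (pi/2)" by (rule arg_cong)
        then have "cos (p * Arg w) \<le> 0" by (simp only: cos_abs_real cos_pi_half order_refl)
        from nE'[OF wS this] have "norm (E w) \<le> C * exp (- \<kappa> * norm w)" by simp
        also have "\<dots> \<le> C * exp (\<mu> * R1 powr p)"
          using C \<mu> \<kappa> by (intro mult_left_mono) (auto intro: order_trans[of _ 0])
        finally show ?thesis .
      qed
    qed
    also have "norm (E (of_real x)) = norm (G (\<sigma> * of_real x)) * exp (\<mu> * x powr p)"
      using x0 by (simp add: E_def H_def norm_mult powr_of_real)
    finally have "norm (G (\<sigma> * of_real x)) \<le> C * exp (\<mu> * R1 powr p) / exp (\<mu> * x powr p)"
      by (simp add: field_simps)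
    then show ?thesis by (simp add: right_diff_distrib exp_diff)
  qed
  have zero: "G (\<sigma> * of_real x) = 0" if x: "x > R1" for x
  proof -
    have "R1 powr p < x powr p" using x p R by (intro powr_less_mono2) (auto simp: R1_def)
    then have d: "x powr p - R1 powr p > 0" by simp
    have "((\<lambda>\<mu>. C * exp (- \<mu> * (x powr p - R1 powr p))) \<longlongrightarrow> 0) at_top"
      using d by real_asymp
    moreover have "\<forall>\<^sub>F \<mu> in at_top. norm (G (\<sigma> * of_real x)) \<le> C * exp (- \<mu> * (x powr p - R1 powr p))"
      using eventually_ge_at_top[of 0] by eventually_elim (use key[OF x] in auto)
    ultimately have "norm (G (\<sigma> * of_real x)) \<le> 0"
      by (rule tendsto_lowerbound) simp
    then show ?thesis by simp
  qed
  define \<xi> where "\<xi> = \<sigma> * of_real (R1 + 1)"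
  have \<xi>: "\<xi> \<in> sector \<sigma> R \<delta>"
    unfolding \<xi>_def using \<sigma> R \<delta> by (intro real_in_sector) (auto simp: R1_def)
  have lim: "\<xi> islimpt (\<lambda>x. \<sigma> * of_real x) ` {R1<..}"
  proof (rule islimptI)
    fix T assume T: "\<xi> \<in> T" "open T"
    then obtain e where e: "e > 0" "ball \<xi> e \<subseteq> T" using open_contains_ball by blast
    define y where "y = \<sigma> * of_real (R1 + 1 + e/2)"
    have "dist \<xi> y < e" using \<sigma> e by (auto simp: \<xi>_def y_def dist_norm algebra_simps)
    then have "y \<in> T" using e by auto
    moreover have "y \<noteq> \<xi>" using \<sigma> e unfolding y_def \<xi>_def
      by (auto simp: complex_eq_iff)
    moreover have "y \<in> (\<lambda>x. \<sigma> * of_real x) ` {R1<..}" unfolding y_def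
      using e by (intro imageI) auto
    ultimately show "\<exists>y\<in>(\<lambda>x. \<sigma> * of_real x) ` {R1<..}. y \<in> T \<and> y \<noteq> \<xi>" by blast
  qed
  show ?thesis
  proof (rule analytic_continuation[OF hol _ _ _ \<xi> lim _ z])
    show "connected (sector \<sigma> R \<delta>)" using \<sigma> R \<delta> by (intro connected_sector) auto
    show "(\<lambda>x. \<sigma> * of_real x) ` {R1<..} \<subseteq> sector \<sigma> R \<delta>"
      using real_in_sector[OF \<sigma> _ _ \<delta>, of R] R by (auto simp: R1_def)
  qed (use zero in auto)
qed

section \<open>The formal shift is a substitution\<close>

lemma deriv_z_nth: "fps_nth (deriv_z P) j = (if j = 0 then 0 else - of_nat (j - 1) * fps_nth P (j - 1))"
proof -
  consider "j = 0" | "j = 1" | m where "j = Suc (Suc m)"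
    by (metis One_nat_def not0_implies_Suc)
  then show ?thesis
  proof cases
    case (3 m)
    then have "fps_nth (deriv_z P) j = - (of_nat (Suc m) * fps_nth P (Suc m))"
      by (simp add: deriv_z_def fps_X_power_mult_nth)
    then show ?thesis using 3 by (simp only: diff_Suc_1 nat.distinct if_False mult_minus_left)
  qed (auto simp: deriv_z_def fps_X_power_mult_nth)
qed

lemma funpow_deriv_z_nth:
  "fps_nth ((deriv_z ^^ k) P) j =
     (if k \<le> j then (-1) ^ k * pochhammer (of_nat (j - k)) k * fps_nth P (j - k) else 0)"
proof (induction k arbitrary: j)
  case (Suc k)
  show ?case
  proof (cases "Suc k \<le> j")
    case True
    then obtain m where "j = m + Suc k" by (metis add.commute le_Suc_ex)
    then show ?thesis by (simp add: deriv_z_nth Suc.IH pochhammer_Suc algebra_simps)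
  qed (auto simp: deriv_z_nth Suc.IH)
qed auto

text \<open>The \<open>k\<close>-th summand has order at least \<open>k\<close>, so each coefficient of the infinite sum is a finite sum.\<close>

lemma formal_shift_nth:
  "fps_nth (formal_shift P h) n =
     (\<Sum>k\<le>n. fps_nth (fps_const (1 / fact k) * h ^ k * (deriv_z ^^ k) P) n)"
proof -
  let ?f = "\<lambda>k. fps_const (1 / fact k) * h ^ k * (deriv_z ^^ k) P"
  let ?S = "Abs_fps (\<lambda>n. \<Sum>k\<le>n. fps_nth (?f k) n)"
  have vanish: "fps_nth (?f k) j = 0" if "j < k" for k j
    using that by (auto simp: fps_mult_nth[of "fps_const _ * h ^ k"] funpow_deriv_z_nth intro!: sum.neutral)
  have "?f sums ?S"
    unfolding sums_def
  proof (rule tendsto_fpsI)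
    fix n
    show "\<forall>\<^sub>F N in sequentially. fps_nth (sum ?f {..<N}) n = fps_nth ?S n"
      using eventually_gt_at_top[of n]
    proof eventually_elim
      case (elim N)
      have "fps_nth (sum ?f {..<N}) n = (\<Sum>k<N. fps_nth (?f k) n)" by (rule fps_sum_nth)
      also have "\<dots> = (\<Sum>k\<le>n. fps_nth (?f k) n)"
        using elim vanish by (intro sum.mono_neutral_right) auto
      finally show ?case by simp
    qed
  qed
  then have "formal_shift P h = ?S"
    unfolding formal_shift_def by (rule sums_unique[symmetric])
  then show ?thesis by simp
qed

text \<open>In the indeterminate \<open>X = 1/z\<close> the substitution \<open>z \<mapsto> z + h\<close> reads \<open>X \<mapsto> 1/(1/X + h) = X/(1 + X h)\<close>.
  On a monomial \<open>X\<^sup>m\<close> the Taylor sum is the binomial series of \<open>(1 + X h)\<^sup>-\<^sup>m\<close>; both sides are linear and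
  their \<open>n\<close>-th coefficient involves only the coefficients of \<open>P\<close> up to \<open>n\<close>. So the formal equation can
  be compared with the composition of convergent functions.\<close>

lemma formal_shift_eq_compose:
  "formal_shift P h = fps_compose P (fps_X * inverse (1 + fps_X * h))"
proof (rule fps_ext)
  fix n
  let ?g = "fps_X * inverse (1 + fps_X * h)"
  \<comment> \<open>\<open>T k m\<close> is the contribution of the \<open>k\<close>-th Taylor summand of the \<open>m\<close>-th term of \<open>P\<close> to the coefficient of order \<open>n\<close>.\<close>
  define T where "T k m = (-1) ^ k * pochhammer (of_nat m) k / fact k * fps_nth P m * fps_nth (h ^ k) (n - k - m)"
    for k m
  have l: "fps_nth (fps_const (1 / fact k) * h ^ k * (deriv_z ^^ k) P) n = (\<Sum>m\<in>{m. m \<le> n \<and> k + m \<le> n}. T k m)"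
    if "k \<le> n" for k
  proof -
    have "fps_nth (fps_const (1 / fact k) * h ^ k * (deriv_z ^^ k) P) n =
        1 / fact k * fps_nth ((deriv_z ^^ k) P * h ^ k) n"
      by (simp only: mult.assoc fps_mult_left_const_nth mult.commute[of "h ^ k"])
    also have "\<dots> = (\<Sum>i=0..n. 1 / fact k * (fps_nth ((deriv_z ^^ k) P) i * fps_nth (h ^ k) (n - i)))"
      by (simp add: fps_mult_nth sum_distrib_left)
    also have "\<dots> = (\<Sum>i=k..n. 1 / fact k * (fps_nth ((deriv_z ^^ k) P) i * fps_nth (h ^ k) (n - i)))"
      by (intro sum.mono_neutral_right) (auto simp: funpow_deriv_z_nth)
    also have "\<dots> = (\<Sum>m\<in>{m. m \<le> n \<and> k + m \<le> n}. T k m)"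
      by (rule sum.reindex_bij_witness[of _ "\<lambda>m. m + k" "\<lambda>i. i - k"])
         (auto simp: funpow_deriv_z_nth T_def diff_diff_eq)
    finally show ?thesis .
  qed
  have r: "fps_nth P m * fps_nth (?g ^ m) n = (\<Sum>k\<in>{k. k \<le> n \<and> k + m \<le> n}. T k m)"
    if "m \<le> n" for m
  proof -
    have "inverse ((1 + fps_X * h) ^ m) = fps_compose (inverse ((1 + fps_X) ^ m)) (fps_X * h)"
      by (simp add: fps_inverse_compose fps_compose_power fps_compose_add_distrib flip: fps_compose_power)
    also have "\<dots> = fps_compose (fps_binomial (- of_nat m)) (fps_X * h)"
      by (simp add: fps_binomial_minus_of_nat)
    finally have inv: "inverse ((1 + fps_X * h) ^ m) = \<dots>" .
    have "?g ^ m = fps_X ^ m * inverse ((1 + fps_X * h) ^ m)"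
      by (simp add: power_mult_distrib fps_inverse_power)
    then have "fps_nth (?g ^ m) n =
        fps_nth (fps_compose (fps_binomial (- of_nat m)) (fps_X * h)) (n - m)"
      unfolding inv using that by (simp add: fps_X_power_mult_nth)
    also have "\<dots> = (\<Sum>k=0..n-m. (- of_nat m gchoose k) * fps_nth ((fps_X * h) ^ k) (n - m))"
      by (simp add: fps_compose_nth)
    also have "\<dots> = (\<Sum>k\<in>{k. k \<le> n \<and> k + m \<le> n}. (-1) ^ k * pochhammer (of_nat m) k / fact k * fps_nth (h ^ k) (n - k - m))"
    proof (rule sum.cong)
      show "{0..n-m} = {k. k \<le> n \<and> k + m \<le> n}" using that by auto
      fix k assume k: "k \<in> {k. k \<le> n \<and> k + m \<le> n}"
      have "n - m - k = n - k - m" by simp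
      then show "(- of_nat m gchoose k) * fps_nth ((fps_X * h) ^ k) (n - m) =
          (-1) ^ k * pochhammer (of_nat m) k / fact k * fps_nth (h ^ k) (n - k - m)"
        using k by (auto simp: gbinomial_pochhammer power_mult_distrib fps_X_power_mult_nth)
    qed
    finally show ?thesis by (simp add: sum_distrib_left T_def mult_ac)
  qed
  have "fps_nth (formal_shift P h) n = (\<Sum>k\<le>n. \<Sum>m\<in>{m. m \<in> {..n} \<and> k + m \<le> n}. T k m)"
    unfolding formal_shift_nth by (intro sum.cong refl) (use l in simp)
  also have "\<dots> = (\<Sum>m\<le>n. \<Sum>k\<in>{k. k \<in> {..n} \<and> k + m \<le> n}. T k m)"
    by (rule sum.swap_restrict) auto
  also have "\<dots> = (\<Sum>m\<le>n. fps_nth P m * fps_nth (?g ^ m) n)"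
    by (intro sum.cong refl) (use r in simp)
  also have "\<dots> = fps_nth (fps_compose P ?g) n"
    by (simp add: fps_compose_nth atLeast0AtMost)
  finally show "fps_nth (formal_shift P h) n = fps_nth (fps_compose P ?g) n" .
qed

section \<open>Cauchy estimates for Taylor remainders\<close>

lemma norm_fps_nth_le:
  assumes "f has_fps_expansion A" "f holomorphic_on cball 0 r" "0 < r"
    and "\<And>u. norm u \<le> r \<Longrightarrow> norm (f u) \<le> K"
  shows "norm (fps_nth A n) \<le> K / r ^ n"
proof -
  have "norm ((deriv ^^ n) f 0) \<le> fact n * K / r ^ n"
  proof (rule Cauchy_inequality)
    show "f holomorphic_on ball 0 r" using assms(2) by (rule holomorphic_on_subset) auto
    show "continuous_on (cball 0 r) f" using assms(2) by (rule holomorphic_on_imp_continuous_on)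
  qed (use assms in auto)
  then have "norm ((deriv ^^ n) f 0) / fact n \<le> K / r ^ n" by (simp add: field_simps)
  moreover have "fps_nth A n = (deriv ^^ n) f 0 / fact n"
    using fps_nth_fps_expansion[OF assms(1)] by simp
  ultimately show ?thesis by (simp add: norm_divide)
qed

lemma norm_Taylor_remainder_le:
  assumes A: "f has_fps_expansion A" and hol: "f holomorphic_on cball 0 r" and r: "0 < r"
    and bd: "\<And>u. norm u \<le> r \<Longrightarrow> norm (f u) \<le> K" and u: "norm u \<le> r/2"
  shows "norm (f u - (\<Sum>n<N. fps_nth A n * u ^ n)) \<le> 2 * K * (norm u / r) ^ N"
proof -
  have K: "K \<ge> 0" using bd[of 0] r by (auto intro: order_trans[OF norm_ge_zero])
  define q where "q = norm u / r"
  have q: "0 \<le> q" "q \<le> 1/2" using u r by (auto simp: q_def field_simps)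
  have "(\<lambda>n. fps_nth A n * u ^ n) sums f u"
  proof (rule has_fps_expansion_imp_sums_complex[OF A])
    show "f holomorphic_on eball 0 (ereal r)" using hol by (rule holomorphic_on_subset) auto
    show "ereal (norm u) < ereal r" using u r by simp
  qed
  then have "(\<lambda>n. fps_nth A (n + N) * u ^ (n + N)) sums (f u - (\<Sum>n<N. fps_nth A n * u ^ n))"
    by (rule sums_split_initial_segment)
  moreover have g: "(\<lambda>n. K * q ^ N * q ^ n) sums (K * q ^ N * (1 / (1 - q)))"
    using q by (intro sums_mult geometric_sums) auto
  moreover have "norm (fps_nth A (n + N) * u ^ (n + N)) \<le> K * q ^ N * q ^ n" for n
  proof -
    have "norm (fps_nth A (n + N) * u ^ (n + N)) \<le> K / r ^ (n + N) * norm u ^ (n + N)"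
      unfolding norm_mult norm_power
      by (intro mult_right_mono norm_fps_nth_le[OF A hol r bd]) auto
    also have "\<dots> = K * q ^ N * q ^ n" by (simp add: q_def power_divide power_add mult_ac)
    finally show ?thesis .
  qed
  ultimately have "norm (f u - (\<Sum>n<N. fps_nth A n * u ^ n)) \<le> K * q ^ N * (1 / (1 - q))"
    by (metis (no_types, lifting) norm_suminf_le sums_iff)
  also have "\<dots> \<le> K * q ^ N * 2"
    using q K by (intro mult_left_mono) (auto simp: field_simps)
  finally show ?thesis by (simp add: q_def mult_ac)
qed

text \<open>Optimal truncation: \<open>N\<close> is chosen as the integer part of \<open>r/(2M)\<close>, so that \<open>M\<^sup>N N!/r\<^sup>N \<le> (M N/r)\<^sup>N \<le> 2\<^sup>-\<^sup>N\<close>.\<close>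

lemma exp_small_of_gevrey_small:
  assumes L: "0 \<le> L" and M: "0 < M" and r: "0 < r" and x: "\<And>N. x \<le> L * M ^ N * fact N / r ^ N"
  shows "x \<le> 2 * L * exp (- (ln 2 / (2 * M)) * (r::real))"
proof -
  define N where "N = nat \<lfloor>r / (2 * M)\<rfloor>"
  have N: "real N \<le> r / (2 * M)" "r / (2 * M) < real N + 1"
    using r M by (auto simp: N_def)
  have NN: "fact N \<le> real N ^ N"
    using fact_le_power[of N, where 'a = real] by (simp add: of_nat_power)
  have "x \<le> L * M ^ N * fact N / r ^ N" by (rule x)
  also have "\<dots> \<le> L * M ^ N * real N ^ N / r ^ N"
    using L M r NN by (intro divide_right_mono mult_left_mono) auto
  also have "\<dots> = L * (M * real N / r) ^ N" by (simp add: power_divide power_mult_distrib)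
  also have "\<dots> \<le> L * (1/2) ^ N"
    using L M r N by (intro mult_left_mono power_mono) (auto simp: field_simps)
  also have "(1/2) ^ N = 2 powr (- real N)" 
  proof -
    have "2 powr (- real N) = inverse (2 ^ N)" by (simp only: powr_minus powr_realpow zero_less_numeral)
    then show ?thesis by (simp only: power_one_over inverse_eq_divide)
  qed
  also have "2 powr (- real N) \<le> 2 powr (1 - r / (2 * M))"
    using N by (intro powr_mono) auto
  also have "\<dots> = 2 * exp (- (ln 2 / (2 * M)) * r)" 
  proof -
    have "2 powr (1 - r / (2 * M)) = exp (ln 2 + - (ln 2 / (2 * M)) * r)"
      unfolding powr_def by (simp add: algebra_simps)
    then show ?thesis by (simp only: exp_add exp_ln zero_less_numeral)
  qed
  finally have "x \<le> L * (2 * exp (- (ln 2 / (2 * M)) * r))" using L by (simp only: mult_left_mono)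
  then show ?thesis by (simp only: mult_ac)
qed

abbreviation partial_sum :: "complex fps \<Rightarrow> nat \<Rightarrow> complex \<Rightarrow> complex" where
  "partial_sum \<phi> N z \<equiv> \<Sum>n<N. fps_nth \<phi> (Suc n) / z ^ (n + 1)"

text \<open>Two consecutive remainders at one point differ by one term of the series.\<close>

lemma gevrey_coefficients_bound:
  assumes "gevrey_asymptotic \<psi> \<phi> D" "z \<in> D" "z \<noteq> 0"
  obtains A B where "0 < A" "1 \<le> B" "\<And>n. norm (fps_nth \<phi> (Suc n)) \<le> A * B ^ n * fact n"
proof -
  obtain L M where LM: "L > 0" "M > 0" and
    bd: "\<And>N. norm (\<psi> z - partial_sum \<phi> N z) \<le> L * M ^ N * fact N / norm z ^ (N + 1)"
    using assms by (auto simp: gevrey_asymptotic_def)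
  define B where "B = max 1 (2 * M)"
  have nz: "norm z > 0" using assms by simp
  show thesis
  proof (rule that[of "L * (1 + M / norm z)" B])
    show "0 < L * (1 + M / norm z)" using LM nz by (intro mult_pos_pos add_pos_pos) auto
    show "1 \<le> B" by (simp add: B_def)
    fix n
    let ?S = "\<lambda>N. \<Sum>n<N. fps_nth \<phi> (Suc n) / z ^ (n + 1)"
    have "fps_nth \<phi> (Suc n) / z ^ (n + 1) = (\<psi> z - ?S n) - (\<psi> z - ?S (Suc n))" by simp
    then have "norm (fps_nth \<phi> (Suc n) / z ^ (n + 1)) \<le>
        L * M ^ n * fact n / norm z ^ (n + 1) + L * M ^ Suc n * fact (Suc n) / norm z ^ (Suc n + 1)"
      by (smt (verit) norm_triangle_ineq4[of "\<psi> z - ?S n" "\<psi> z - ?S (Suc n)"] bd[of n] bd[of "Suc n"])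
    then have "norm (fps_nth \<phi> (Suc n)) \<le> L * M ^ n * fact n + L * M ^ Suc n * fact (Suc n) / norm z"
    proof -
      assume *: "norm (fps_nth \<phi> (Suc n) / z ^ (n + 1)) \<le>
        L * M ^ n * fact n / norm z ^ (n + 1) + L * M ^ Suc n * fact (Suc n) / norm z ^ (Suc n + 1)"
      have "norm (fps_nth \<phi> (Suc n)) = norm (fps_nth \<phi> (Suc n) / z ^ (n + 1)) * norm z ^ (n + 1)"
        using nz by (simp add: norm_divide norm_power norm_mult)
      also have "\<dots> \<le> (L * M ^ n * fact n / norm z ^ (n + 1) + L * M ^ Suc n * fact (Suc n) / norm z ^ (Suc n + 1))
          * norm z ^ (n + 1)"
        using * by (rule mult_right_mono) simp
      also have "\<dots> = L * M ^ n * fact n + L * M ^ Suc n * fact (Suc n) / norm z"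
        using nz by (simp add: distrib_right)
      finally show ?thesis .
    qed
    also have "\<dots> = L * (1 + (real n + 1) * (M / norm z)) * M ^ n * fact n"
      by (simp add: algebra_simps)
    also have "\<dots> \<le> L * (2 ^ n * (1 + M / norm z)) * M ^ n * fact n"
    proof -
      have "real n + 1 \<le> 2 ^ n"
        using of_nat_mono[OF Suc_leI[OF less_exp[of n]], where 'a = real] by simp
      then have "(real n + 1) * (M / norm z) \<le> 2 ^ n * (M / norm z)"
        using LM nz by (intro mult_right_mono) auto
      moreover have "1 \<le> (2::real) ^ n" by simp
      ultimately have "1 + (real n + 1) * (M / norm z) \<le> 2 ^ n * (1 + M / norm z)"
        unfolding distrib_left mult_1_right by (rule add_mono[rotated])
      then show ?thesis using LM by (intro mult_right_mono mult_left_mono) auto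
    qed
    also have "\<dots> = L * (1 + M / norm z) * (2 * M) ^ n * fact n"
      by (simp add: power_mult_distrib mult_ac)
    also have "\<dots> \<le> L * (1 + M / norm z) * B ^ n * fact n"
      using LM nz by (intro mult_right_mono mult_left_mono power_mono) (auto simp: B_def)
    finally show "norm (fps_nth \<phi> (Suc n)) \<le> L * (1 + M / norm z) * B ^ n * fact n" .
  qed
qed

section \<open>The sum of the formal solution solves the difference equation\<close>

lemma gevrey_asymptotic_subset:
  "gevrey_asymptotic \<psi> \<phi> D \<Longrightarrow> D' \<subseteq> D \<Longrightarrow> gevrey_asymptotic \<psi> \<phi> D'"
  unfolding gevrey_asymptotic_def by (meson holomorphic_on_subset subsetD)

lemma holomorphic_on_eval_fps_cball:
  fixes P :: "complex fps"
  assumes "ereal r < fps_conv_radius P"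
  shows "eval_fps P holomorphic_on cball 0 r"
proof (rule holomorphic_on_eval_fps)
  show "cball (0::complex) r \<subseteq> eball 0 (fps_conv_radius P)"
  proof
    fix x :: complex assume "x \<in> cball 0 r"
    then have "ereal (norm x) \<le> ereal r" by simp
    also note assms
    finally show "x \<in> eball 0 (fps_conv_radius P)" by (simp add: in_eball_iff)
  qed
qed

lemma expands_at_infinityE:
  assumes "expands_at_infinity g P"
  obtains r K where "0 < r" "ereal r < fps_conv_radius P"
    "0 < K" "\<And>u. norm u \<le> r \<Longrightarrow> norm (eval_fps P u) \<le> K"
    "\<And>z. 1 / r \<le> norm z \<Longrightarrow> g z = eval_fps P (inverse z)" "g analytic_on {z. 1 / r < norm z}"
proof -
  obtain R where R: "\<And>z. R \<le> norm z \<Longrightarrow> g z = eval_fps P (inverse z)"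
    using assms by (auto simp: expands_at_infinity_def eventually_at_infinity)
  obtain r1 where r1: "0 < r1" "ereal r1 < fps_conv_radius P"
    using assms unfolding expands_at_infinity_def by (metis ereal_dense2 ereal_less(2))
  define y where "y = max 1 R"
  have y: "y > 0" "R \<le> y" by (auto simp: y_def)
  define r where "r = min r1 (1 / y)"
  have r: "0 < r" "r \<le> r1" "r \<le> 1 / y" using r1 y by (auto simp: r_def)
  have conv: "ereal r < fps_conv_radius P" using r1(2) r(2) by (meson ereal_less_eq(3) le_less_trans)
  note hol = holomorphic_on_eval_fps_cball[OF conv]
  have "bounded (eval_fps P ` cball 0 r)"
    by (intro compact_imp_bounded compact_continuous_image holomorphic_on_imp_continuous_on hol compact_cball)
  then obtain K where K: "0 < K" "\<And>u. norm u \<le> r \<Longrightarrow> norm (eval_fps P u) \<le> K"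
    unfolding bounded_pos by (auto simp: image_iff)
  have eq: "g z = eval_fps P (inverse z)" if "1 / r \<le> norm z" for z
  proof -
    have "y \<le> 1 / r" using r y by (simp add: field_simps)
    then show ?thesis using that y by (intro R) linarith
  qed
  have "g holomorphic_on {z. 1 / r < norm z}"
  proof (rule holomorphic_transform)
    have far: "z \<noteq> 0 \<and> inverse z \<in> cball 0 r" if "1 / r < norm z" for z :: complex
    proof -
      have "0 < 1 / r" using r(1) by simp
      then have "0 < norm z" "inverse (norm z) \<le> inverse (1 / r)"
        using that by (linarith, intro le_imp_inverse_le) auto
      then show ?thesis by (simp add: norm_inverse)
    qed
    have inv: "inverse holomorphic_on {z::complex. 1 / r < norm z}" using far by (intro holomorphic_intros) auto
    have "inverse ` {z::complex. 1 / r < norm z} \<subseteq> cball 0 r" using far by blast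
    from holomorphic_on_compose_gen[OF inv hol this]
    show "(\<lambda>z. eval_fps P (inverse z)) holomorphic_on {z. 1 / r < norm z}" by (simp only: o_def)
  qed (use eq in auto)
  moreover have "open {z::complex. 1 / r < norm z}" by (intro open_Collect_less continuous_intros)
  ultimately have "g analytic_on {z. 1 / r < norm z}" by (simp add: analytic_on_open)
  then show thesis using that r(1) conv K eq by blast
qed

text \<open>The heart of the Gevrey estimate for the composed functions. Let \<open>p\<close> be the truncation of
  \<open>\<phi>\<close> at order \<open>N\<close>, a polynomial in \<open>u = 1/z\<close>. Substituted in the difference equation it leaves an error that
  is holomorphic in \<open>u\<close> on a disc whose radius does not depend on \<open>N\<close>, vanishes to order \<open>N\<close> at \<open>0\<close> by
  the formal equation, and is bounded on that disc, like the sum of the absolute coefficients of \<open>p\<close>, by a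
  constant times \<open>(2b)\<^sup>N N!\<close>. A Cauchy estimate turns this into a bound with the factor \<open>norm u ^ N\<close>.\<close>

lemma truncation_error_of_formal_solution:
  assumes formal: "formal_shift \<phi> (-1) = formal_shift \<phi> B + B1" "fps_nth \<phi> 0 = 0"
    and coeff: "0 < A" "1 \<le> b" "\<And>n. norm (fps_nth \<phi> (Suc n)) \<le> A * b ^ n * fact n"
    and r: "0 < r" "r \<le> 1/2" "ereal r < fps_conv_radius B" "ereal r < fps_conv_radius B1"
    and bd: "\<And>u. norm u \<le> r \<Longrightarrow> norm (u * eval_fps B u) \<le> 1/2" "\<And>u. norm u \<le> r \<Longrightarrow> norm (eval_fps B1 u) \<le> K"
    and p: "\<And>u. p u = (\<Sum>n<N. fps_nth \<phi> (Suc n) * u ^ (n + 1))"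
    and u: "norm u \<le> r / 2"
  shows "norm (p (u / (1 - u)) - p (u / (1 + u * eval_fps B u)) - eval_fps B1 u) \<le>
    2 * (2 * A + K) * (2 * b / r) ^ N * fact N * norm u ^ N"
proof -
  define q where "q u = p (u / (1 - u)) - p (u / (1 + u * eval_fps B u)) - eval_fps B1 u" for u
  define P where "P = fps_cutoff (N + 1) \<phi>"
  have P_sum: "P = (\<Sum>n<N. fps_const (fps_nth \<phi> (Suc n)) * fps_X ^ (n + 1))"
  proof (rule fps_ext)
    fix k
    have "fps_nth (\<Sum>n<N. fps_const (fps_nth \<phi> (Suc n)) * fps_X ^ (n + 1)) k =
        (\<Sum>n<N. if n = k - 1 \<and> k \<noteq> 0 then fps_nth \<phi> k else 0)"
      unfolding fps_sum_nth by (intro sum.cong refl) (auto simp: fps_X_power_iff simp del: power_Suc)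
    also have "\<dots> = fps_nth P k" using formal(2) by (cases k) (auto simp: P_def)
    finally show "fps_nth P k = fps_nth (\<Sum>n<N. fps_const (fps_nth \<phi> (Suc n)) * fps_X ^ (n + 1)) k" ..
  qed
  have "(\<lambda>u. \<Sum>n<N. fps_nth \<phi> (Suc n) * u ^ (n + 1)) has_fps_expansion P"
    unfolding P_sum by (intro fps_expansion_intros)
  then have p_exp: "p has_fps_expansion P" unfolding p[abs_def] .
  have B_exp: "eval_fps B has_fps_expansion B" and B1_exp: "eval_fps B1 has_fps_expansion B1"
    using order.strict_trans[of 0 "ereal r"] r by (simp_all add: eval_fps_has_fps_expansion)
  have g_exp: "(\<lambda>u. u * inverse (1 + u * eval_fps C u)) has_fps_expansion fps_X * inverse (1 + fps_X * C)"
    if "eval_fps C has_fps_expansion C" for C :: "complex fps"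
    using that by (intro fps_expansion_intros) simp_all
  have g0: "fps_nth (fps_X * inverse (1 + fps_X * C)) 0 = 0" for C :: "complex fps" by simp
  have "(p \<circ> (\<lambda>u. u * inverse (1 + u * eval_fps (-1) u))) has_fps_expansion formal_shift P (-1)"
    unfolding formal_shift_eq_compose
    by (intro has_fps_expansion_compose[OF p_exp g_exp g0] eval_fps_has_fps_expansion) simp
  then have e1: "(\<lambda>u. p (u / (1 - u))) has_fps_expansion formal_shift P (-1)"
    by (simp add: o_def divide_inverse eval_fps_minus)
  have "(p \<circ> (\<lambda>u. u * inverse (1 + u * eval_fps B u))) has_fps_expansion formal_shift P B"
    unfolding formal_shift_eq_compose
    by (intro has_fps_expansion_compose[OF p_exp g_exp g0] B_exp)
  then have e2: "(\<lambda>u. p (u / (1 + u * eval_fps B u))) has_fps_expansion formal_shift P B"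
    by (simp add: o_def divide_inverse)
  have q_exp: "q has_fps_expansion formal_shift P (-1) - formal_shift P B - B1" (is "_ has_fps_expansion ?Q")
    unfolding q_def[abs_def] by (intro has_fps_expansion_diff e1 e2 B1_exp)
  have cut: "fps_nth (formal_shift P h) n = fps_nth (formal_shift \<phi> h) n" if "n \<le> N" for h n
    unfolding formal_shift_eq_compose fps_compose_nth P_def using that by (intro sum.cong) auto
  have Q0: "fps_nth ?Q n = 0" if "n < N" for n
    using that formal(1) by (simp add: cut)
  have den: "norm (1 - u) \<ge> 1/2" "norm (1 + u * eval_fps B u) \<ge> 1/2" if "norm u \<le> r" for u
  proof -
    have "norm (1::complex) \<le> norm (1 - u) + norm u" using norm_triangle_ineq[of "1 - u" u] by simp
    then show "norm (1 - u) \<ge> 1/2" using that r by simp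
    have "norm (1::complex) \<le> norm (1 + u * eval_fps B u) + norm (u * eval_fps B u)"
      by (metis add_diff_cancel_right' norm_triangle_ineq4)
    then show "norm (1 + u * eval_fps B u) \<ge> 1/2" using bd(1)[OF that] by simp
  qed
  have p_bd: "norm (p w) \<le> A * (2 * b) ^ N * fact N" if w: "norm w \<le> 1" for w
  proof -
    have "norm (p w) \<le> (\<Sum>n<N. A * b ^ N * fact N)" unfolding p
    proof (rule sum_norm_le)
      fix n assume n: "n \<in> {..<N}"
      have "norm (fps_nth \<phi> (Suc n) * w ^ (n + 1)) \<le> (A * b ^ n * fact n) * 1"
        unfolding norm_mult norm_power using coeff w
        by (intro mult_mono power_le_one) auto
      also have "\<dots> \<le> A * b ^ N * fact N"
        using n coeff by (simp, intro mult_mono power_increasing fact_mono) auto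
      finally show "norm (fps_nth \<phi> (Suc n) * w ^ (n + 1)) \<le> A * b ^ N * fact N" .
    qed
    also have "\<dots> = real N * (A * b ^ N * fact N)" by simp
    also have "\<dots> \<le> 2 ^ N * (A * b ^ N * fact N)"
      using coeff by (intro mult_right_mono) (auto simp: less_imp_le)
    finally show ?thesis by (simp add: power_mult_distrib mult_ac)
  qed
  have K: "K \<ge> 0" using bd(2)[of 0] r by (auto intro: order_trans[OF norm_ge_zero])
  have q_bd: "norm (q u) \<le> (2 * A + K) * (2 * b) ^ N * fact N" if u: "norm u \<le> r" for u
  proof -
    have le1: "norm (u / w) \<le> 1" if "norm w \<ge> 1/2" for w
    proof -
      have "w \<noteq> 0" using that by auto
      then show ?thesis using u r that by (simp add: norm_divide field_simps)
    qed
    have "1 \<le> 2 * b" using coeff by simp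
    then have "1 \<le> (2 * b) ^ N" by (rule one_le_power)
    moreover have "1 \<le> (fact N :: real)" by simp
    ultimately have "1 \<le> (2 * b) ^ N * fact N" using mult_mono[of 1 "(2*b)^N" 1 "fact N"] by simp
    then have "K \<le> K * ((2 * b) ^ N * fact N)" using K by (metis mult.right_neutral mult_left_mono)
    moreover have "norm (q u) \<le> A * (2 * b) ^ N * fact N + A * (2 * b) ^ N * fact N + K"
      unfolding q_def
      by (intro order_trans[OF norm_triangle_ineq4] add_mono p_bd le1 den bd u)
    ultimately show ?thesis by (simp add: algebra_simps)
  qed
  have hol: "q holomorphic_on cball 0 r"
  proof -
    have "(\<lambda>u. \<Sum>n<N. fps_nth \<phi> (Suc n) * u ^ (n + 1)) holomorphic_on UNIV" by (intro holomorphic_intros)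
    then have ph: "p holomorphic_on UNIV" unfolding p[abs_def] .
    have Bh: "eval_fps B holomorphic_on cball 0 r" "eval_fps B1 holomorphic_on cball 0 r"
      using r by (simp_all add: holomorphic_on_eval_fps_cball)
    have "1 - u \<noteq> 0" "1 + u * eval_fps B u \<noteq> 0" if "u \<in> cball 0 r" for u
      using den[of u] that by (auto simp del: right_minus_eq)
    then show ?thesis unfolding q_def[abs_def]
      by (intro holomorphic_on_diff Bh holomorphic_on_compose_gen[OF _ ph, unfolded o_def] holomorphic_intros) auto
  qed
  have "norm (q u - (\<Sum>n<N. fps_nth ?Q n * u ^ n)) \<le> 2 * ((2 * A + K) * (2 * b) ^ N * fact N) * (norm u / r) ^ N"
    by (rule norm_Taylor_remainder_le[OF q_exp hol r(1) q_bd u])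
  also have "(\<Sum>n<N. fps_nth ?Q n * u ^ n) = 0" by (intro sum.neutral) (use Q0 in auto)
  finally have "norm (q u) \<le> 2 * ((2 * A + K) * (2 * b) ^ N * fact N) * (norm u / r) ^ N"
    by (simp only: diff_zero)
  then show ?thesis
    by (simp only: q_def power_divide times_divide_eq_left times_divide_eq_right mult_ac)
qed

text \<open>Replacing \<open>\<psi>\<close> by the truncations of \<open>\<phi>\<close>, with the Gevrey remainders of \<open>\<psi>\<close> and the truncation error
  above, shows that the defect \<open>G\<close> of the equation is at most \<open>L M\<^sup>N N! / norm z ^ N\<close> for all \<open>N\<close>. Hence it
  is exponentially small on a sector of opening greater than \<open>\<pi>\<close>, and vanishes.\<close>

lemma sum_of_formal_solution_solves_equation:
  assumes formal: "formal_solution b b1 \<phi>" and \<sigma>: "\<sigma> = 1 \<or> \<sigma> = -1"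
    and gevrey: "\<And>\<delta>. 0 < \<delta> \<Longrightarrow> \<delta> < pi/2 \<Longrightarrow> \<exists>R. gevrey_asymptotic \<psi> \<phi> (sector \<sigma> R \<delta>)"
    and \<delta>: "0 < \<delta>" "\<delta> < pi/2"
  shows "\<exists>R. \<forall>z\<in>sector \<sigma> R \<delta>. \<psi> (z - 1) = \<psi> (z + b z) + b1 z"
proof -
  obtain B B1 where B: "expands_at_infinity b B" and B1: "expands_at_infinity b1 B1"
    and eq: "formal_shift \<phi> (-1) = formal_shift \<phi> B + B1" and \<phi>0: "fps_nth \<phi> 0 = 0"
    using formal by (auto simp: formal_solution_def)
  obtain r1 K1 where r1: "0 < r1" "ereal r1 < fps_conv_radius B"
      "\<And>z. 1 / r1 \<le> norm z \<Longrightarrow> b z = eval_fps B (inverse z)" "b analytic_on {z. 1 / r1 < norm z}"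
    and K1: "0 < K1" "\<And>u. norm u \<le> r1 \<Longrightarrow> norm (eval_fps B u) \<le> K1"
    using B by (rule expands_at_infinityE) blast
  obtain r2 K where r2: "0 < r2" "ereal r2 < fps_conv_radius B1"
      "\<And>z. 1 / r2 \<le> norm z \<Longrightarrow> b1 z = eval_fps B1 (inverse z)" "b1 analytic_on {z. 1 / r2 < norm z}"
    and K: "0 < K" "\<And>u. norm u \<le> r2 \<Longrightarrow> norm (eval_fps B1 u) \<le> K"
    using B1 by (rule expands_at_infinityE) blast
  define r where "r = min (min r1 r2) (min (1/2) (1 / (2 * K1)))"
  have "r \<le> 1 / (2 * K1)" by (simp add: r_def)
  then have r: "0 < r" "r \<le> r1" "r \<le> r2" "r \<le> 1/2" "r * K1 \<le> 1/2"
    using r1(1) r2(1) K1(1) by (simp_all add: r_def field_simps)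
  have rB: "ereal r < fps_conv_radius B" "ereal r < fps_conv_radius B1"
    using r(2,3) r1(2) r2(2) by (meson ereal_less_eq(3) le_less_trans)+
  have uB: "norm (u * eval_fps B u) \<le> 1/2" if "norm u \<le> r" for u
  proof -
    have "norm (u * eval_fps B u) \<le> r * K1" unfolding norm_mult
      using that r K1 by (intro mult_mono K1) auto
    then show ?thesis using r by simp
  qed
  define \<delta>' where "\<delta>' = (\<delta> + pi/2) / 2"
  have \<delta>': "\<delta> < \<delta>'" "0 < \<delta>'" "\<delta>' < pi/2" using \<delta> by (auto simp: \<delta>'_def)
  obtain R1 where R1: "gevrey_asymptotic \<psi> \<phi> (sector \<sigma> R1 \<delta>')" using gevrey \<delta>' by blast
  then have \<psi>h: "\<psi> holomorphic_on sector \<sigma> R1 \<delta>'" by (simp add: gevrey_asymptotic_def)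
  obtain L M where LM: "L > 0" "M > 0" and
    bd: "\<And>N z. z \<in> sector \<sigma> R1 \<delta>' \<Longrightarrow>
      norm (\<psi> z - partial_sum \<phi> N z) \<le> L * M ^ N * fact N / norm z ^ (N + 1)"
    using R1 unfolding gevrey_asymptotic_def by blast
  have "\<sigma> * of_real (\<bar>R1\<bar> + 1) \<in> sector \<sigma> R1 \<delta>'"
    using \<sigma> \<delta>' by (intro real_in_sector) auto
  moreover have "\<sigma> * of_real (\<bar>R1\<bar> + 1) \<noteq> 0" using \<sigma> by (auto simp del: of_real_add)
  ultimately obtain A c where Ac: "0 < A" "1 \<le> c" "\<And>n. norm (fps_nth \<phi> (Suc n)) \<le> A * c ^ n * fact n"
    using gevrey_coefficients_bound[OF R1] by blast
  have \<sigma>n: "norm \<sigma> = 1" using \<sigma> by auto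
  obtain \<eta> where \<eta>: "0 < \<eta>" "\<eta> \<le> 1/2"
    "\<And>R z w. 0 \<le> R \<Longrightarrow> z \<in> sector \<sigma> R \<delta> \<Longrightarrow> norm (w - z) \<le> \<eta> * norm z \<Longrightarrow> w \<in> sector \<sigma> (R/2) \<delta>'"
    using sector_perturb[OF \<delta>(1) \<delta>'(1,3) \<sigma>n] by blast
  define R where "R = Max {2 / r, 1 / \<eta>, K1 / \<eta>, 2 * \<bar>R1\<bar>, 2}"
  have R: "2 / r \<le> R" "1 / \<eta> \<le> R" "K1 / \<eta> \<le> R" "2 * \<bar>R1\<bar> \<le> R" "2 \<le> R"
    by (auto simp: R_def le_max_iff_disj)
  define G where "G z = \<psi> (z - 1) - \<psi> (z + b z) - b1 z" for z
  have big: "2 / r \<le> norm z" "1 \<le> \<eta> * norm z" "K1 \<le> \<eta> * norm z" "2 \<le> norm z" "z \<noteq> 0"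
    "1 / r1 < norm z" "1 / r2 < norm z" "norm (inverse z) \<le> r / 2"
    if "z \<in> sector \<sigma> R \<delta>" for z
  proof -
    have z: "R < norm z" using that by (simp add: sector_def)
    show 1: "2 / r \<le> norm z" "2 \<le> norm z" using R z by linarith+
    have "1 / \<eta> < norm z" "K1 / \<eta> < norm z" using R z by linarith+
    then show "1 \<le> \<eta> * norm z" "K1 \<le> \<eta> * norm z" using \<eta> by (simp_all add: field_simps)
    show z0: "z \<noteq> 0" using 1 by auto
    have "1 / r1 \<le> 2 / r" "1 / r2 \<le> 2 / r" using r r1 r2 by (auto simp: field_simps)
    then show "1 / r1 < norm z" "1 / r2 < norm z" using R(1) z by linarith+
    show "norm (inverse z) \<le> r / 2" using le_imp_inverse_le[OF 1(1)] r(1) by (simp only: norm_inverse) simp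
  qed
  have bz: "b z = eval_fps B (inverse z)" "b1 z = eval_fps B1 (inverse z)" "norm (b z) \<le> K1"
    if "z \<in> sector \<sigma> R \<delta>" for z
  proof -
    show "b z = eval_fps B (inverse z)" "b1 z = eval_fps B1 (inverse z)"
      using r1(3) r2(3) big[OF that] by simp_all
    then show "norm (b z) \<le> K1" using K1(2)[of "inverse z"] big(8)[OF that] r by simp
  qed
  have near: "w \<in> sector \<sigma> R1 \<delta>' \<and> norm z / 2 \<le> norm w" 
    if "z \<in> sector \<sigma> R \<delta>" "norm (w - z) \<le> \<eta> * norm z" for z w
  proof
    have "w \<in> sector \<sigma> (R/2) \<delta>'" using \<eta>(3)[OF _ that] R by simp
    moreover have "R1 \<le> R/2" using R(4) abs_ge_self[of R1] by linarith
    ultimately show "w \<in> sector \<sigma> R1 \<delta>'" using sector_mono by blast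
    have "norm z \<le> norm w + norm (w - z)" by (metis norm_minus_commute norm_triangle_sub)
    moreover have "\<eta> * norm z \<le> 1/2 * norm z" using \<eta> by (intro mult_right_mono) auto
    ultimately show "norm z / 2 \<le> norm w" using that(2) by simp
  qed
  have in': "z - 1 \<in> sector \<sigma> R1 \<delta>' \<and> norm z / 2 \<le> norm (z - 1)"
    "z + b z \<in> sector \<sigma> R1 \<delta>' \<and> norm z / 2 \<le> norm (z + b z)" if "z \<in> sector \<sigma> R \<delta>" for z
    by (rule near[OF that], use big(2,3)[OF that] bz(3)[OF that] in simp)+
  have bh: "b holomorphic_on sector \<sigma> R \<delta>" "b1 holomorphic_on sector \<sigma> R \<delta>"
    using big(6,7) by (auto intro!: analytic_imp_holomorphic analytic_on_subset[OF r1(4)] analytic_on_subset[OF r2(4)])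
  have Gh: "G holomorphic_on sector \<sigma> R \<delta>"
    unfolding G_def[abs_def]
    by (intro holomorphic_on_diff bh holomorphic_on_compose_gen[OF _ \<psi>h, unfolded o_def] holomorphic_intros)
       (use in' in auto)
  define M' where "M' = max (2 * M) (2 * c / r)"
  define L' where "L' = 2 * L + 2 * (2 * A + K)"
  have G_bd: "norm (G z) \<le> L' * M' ^ N * fact N / norm z ^ N" if z: "z \<in> sector \<sigma> R \<delta>" for z N
  proof -
    define p where "p u = (\<Sum>n<N. fps_nth \<phi> (Suc n) * u ^ (n + 1))" for u
    have nz: "norm z > 0" using big(5)[OF z] by simp
    have rem: "norm (\<psi> w - p (inverse w)) \<le> L * M' ^ N * fact N / norm z ^ N"
      if w: "w \<in> sector \<sigma> R1 \<delta>' \<and> norm z / 2 \<le> norm w" for w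
    proof -
      have w1: "1 \<le> norm w" using w big(4)[OF z] by simp
      then have w0: "0 < norm w" by linarith
      have "norm (\<psi> w - p (inverse w)) \<le> L * M ^ N * fact N / norm w ^ (N + 1)"
        using bd[of w N] w by (simp add: p_def field_simps)
      also have "\<dots> \<le> L * M ^ N * fact N / norm w ^ N"
        using LM w1 w0 by (intro divide_left_mono mult_pos_pos power_increasing zero_less_power) auto
      also have "\<dots> \<le> L * M ^ N * fact N / (norm z / 2) ^ N"
        using LM w nz w0 by (intro divide_left_mono mult_pos_pos power_mono zero_less_power) auto
      also have "\<dots> = L * (2 * M) ^ N * fact N / norm z ^ N"
        by (simp add: power_mult_distrib power_divide mult_ac)
      also have "\<dots> \<le> L * M' ^ N * fact N / norm z ^ N"
        using LM by (intro divide_right_mono mult_right_mono mult_left_mono power_mono) (auto simp: M'_def)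
      finally show ?thesis .
    qed
    define u where "u = inverse z"
    have z0: "z \<noteq> 0" using big(5)[OF z] .
    have "z - 1 \<noteq> 0" "z + b z \<noteq> 0" using in'[OF z] nz by auto
    then have i: "inverse (z - 1) = u / (1 - u)" "inverse (z + b z) = u / (1 + u * eval_fps B u)"
      using z0 bz(1)[OF z] by (auto simp: u_def field_simps)
    have "norm (p (u / (1 - u)) - p (u / (1 + u * eval_fps B u)) - eval_fps B1 u) \<le>
       2 * (2 * A + K) * (2 * c / r) ^ N * fact N * norm u ^ N"
      by (rule truncation_error_of_formal_solution[OF eq \<phi>0 Ac r(1,4) rB uB, where K = K])
         (use K r big(8)[OF z] in \<open>auto simp: p_def u_def\<close>)
    also have "\<dots> \<le> 2 * (2 * A + K) * M' ^ N * fact N * norm u ^ N"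
      using Ac K r by (intro mult_right_mono mult_left_mono power_mono) (auto simp: M'_def)
    finally have "norm (p (inverse (z - 1)) - p (inverse (z + b z)) - b1 z) \<le>
       2 * (2 * A + K) * M' ^ N * fact N / norm z ^ N"
      using bz(2)[OF z] unfolding i u_def by (simp add: norm_inverse divide_inverse power_inverse)
    moreover have "G z = (\<psi> (z - 1) - p (inverse (z - 1))) - (\<psi> (z + b z) - p (inverse (z + b z)))
        + (p (inverse (z - 1)) - p (inverse (z + b z)) - b1 z)" by (simp add: G_def)
    ultimately have "norm (G z) \<le> L * M' ^ N * fact N / norm z ^ N + L * M' ^ N * fact N / norm z ^ N
        + 2 * (2 * A + K) * M' ^ N * fact N / norm z ^ N"
      using rem[OF in'(1)[OF z]] rem[OF in'(2)[OF z]]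
      by (metis (no_types, lifting) add_mono norm_triangle_le norm_triangle_le_diff)
    also have "\<dots> = L' * M' ^ N * fact N / norm z ^ N"
      by (simp add: L'_def add_divide_distrib algebra_simps)
    finally show ?thesis .
  qed
  have L': "0 \<le> L'" and M': "0 < M'" using LM Ac K by (auto simp: L'_def M'_def)
  have "G z = 0" if z: "z \<in> sector \<sigma> R \<delta>" for z
  proof (rule exponentially_flat_on_wide_sector_eq_0[OF \<sigma> _ \<delta> Gh _ _ z])
    show "0 \<le> R" using R by simp
    show "0 < ln 2 / (2 * M')" using M' by simp
    fix z assume z: "z \<in> sector \<sigma> R \<delta>"
    then show "norm (G z) \<le> 2 * L' * exp (- (ln 2 / (2 * M')) * norm z)"
      using L' M' big[OF z] G_bd[OF z] by (intro exp_small_of_gevrey_small) auto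
  qed
  then show ?thesis unfolding G_def by (intro exI[of _ R] ballI) (simp add: algebra_simps)
qed

section \<open>Holomorphic maps close to the identity on a sector\<close>

definition sublinear_on_sector :: "complex \<Rightarrow> real \<Rightarrow> (complex \<Rightarrow> complex) \<Rightarrow> bool" where
  "sublinear_on_sector \<sigma> \<delta> h \<longleftrightarrow> (\<forall>\<epsilon>>0. \<exists>R. \<forall>z\<in>sector \<sigma> R \<delta>. norm (h z) \<le> \<epsilon> * norm z)"

text \<open>As the sector is not convex, the mean value inequality applies only locally. If \<open>z1 + h z1 = z2 + h z2\<close> and the two points are
  close relative to their size, then the segment between them stays in the wider sector, where Cauchy's
  inequality makes the derivative of \<open>h\<close> small. If they are far apart, then \<open>norm (h z1 - h z2)\<close> is already too
  small because \<open>h\<close> is sublinear.\<close>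

lemma inj_on_near_identity:
  assumes \<delta>: "0 < \<delta>" "\<delta> < \<delta>'" "\<delta>' < pi/2" and \<sigma>: "norm \<sigma> = 1"
    and hol: "h holomorphic_on sector \<sigma> R1 \<delta>'" and small: "sublinear_on_sector \<sigma> \<delta>' h"
  shows "\<exists>R. inj_on (\<lambda>z. z + h z) (sector \<sigma> R \<delta>)"
proof -
  obtain \<eta> where \<eta>: "0 < \<eta>" "\<eta> \<le> 1/2"
    "\<And>R z w. 0 \<le> R \<Longrightarrow> z \<in> sector \<sigma> R \<delta> \<Longrightarrow> norm (w - z) \<le> \<eta> * norm z \<Longrightarrow> w \<in> sector \<sigma> (R/2) \<delta>'"
    using sector_perturb[OF \<delta> \<sigma>] by blast
  \<comment> \<open>With this \<open>\<epsilon>\<close> the derivative of \<open>h\<close> is at most \<open>3 \<epsilon>/\<eta> \<le> 1/2\<close> in the first case, and the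
    displacement at most \<open>3 \<epsilon> norm z1 < \<eta>/2 norm z1\<close> in the second.\<close>
  define \<epsilon> where "\<epsilon> = \<eta> / 8"
  obtain R2 where R2: "\<And>z. z \<in> sector \<sigma> R2 \<delta>' \<Longrightarrow> norm (h z) \<le> \<epsilon> * norm z"
    using small \<eta>(1) unfolding sublinear_on_sector_def by (metis \<epsilon>_def divide_pos_pos zero_less_numeral)
  define R where "R = 2 * max (max R1 R2) 0"
  have R: "0 \<le> R" "R1 \<le> R/2" "R2 \<le> R/2" by (auto simp: R_def)
  have close: "w \<in> sector \<sigma> R1 \<delta>'" "norm (h w) \<le> 3/2 * \<epsilon> * norm z"
    if "z \<in> sector \<sigma> R \<delta>" "norm (w - z) \<le> \<eta> * norm z" for z w
  proof -
    have w: "w \<in> sector \<sigma> (R/2) \<delta>'" by (rule \<eta>(3)[OF R(1) that])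
    then show "w \<in> sector \<sigma> R1 \<delta>'" using sector_mono[OF R(2)] by blast
    have "\<eta> * norm z \<le> 1/2 * norm z" using \<eta> by (intro mult_right_mono) auto
    then have "norm w \<le> 3/2 * norm z"
      using that(2) norm_triangle_ineq2[of w z] by simp
    have "norm (h w) \<le> \<epsilon> * norm w" using w sector_mono[OF R(3)] by (intro R2) auto
    also have "\<dots> \<le> \<epsilon> * (3/2 * norm z)"
      using \<open>norm w \<le> 3/2 * norm z\<close> \<eta> by (intro mult_left_mono) (auto simp: \<epsilon>_def)
    finally show "norm (h w) \<le> 3/2 * \<epsilon> * norm z" by simp
  qed
  have key: "z1 = z2" if z1: "z1 \<in> sector \<sigma> R \<delta>" and z2: "z2 \<in> sector \<sigma> R \<delta>"
    and le: "norm z2 \<le> norm z1" and eq: "z1 + h z1 = z2 + h z2" for z1 z2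
  proof (cases "norm (z2 - z1) < \<eta>/2 * norm z1")
    case True
    define s where "s = \<eta>/2 * norm z1"
    have z1p: "norm z1 > 0" using z1 R by (auto simp: sector_def)
    have s: "s > 0" using z1p \<eta> by (simp add: s_def)
    have der: "norm (deriv h w) \<le> 1/2" if w: "w \<in> closed_segment z1 z2" for w
    proof -
      have wz: "norm (w - z1) \<le> norm (z2 - z1)"
        using w segment_bound(1) by (metis norm_minus_commute)
      have in_ball: "x \<in> sector \<sigma> R1 \<delta>' \<and> norm (h x) \<le> 3/2 * \<epsilon> * norm z1" if "norm (w - x) \<le> s" for x
      proof -
        have "norm (x - z1) \<le> norm (w - x) + norm (w - z1)"
          by (metis norm_minus_commute norm_triangle_sub norm_triangle_ineq diff_add_cancel add_diff_eq)
        then have "norm (x - z1) \<le> \<eta> * norm z1" using that wz True by (simp add: s_def)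
        then show ?thesis using close[OF z1] by blast
      qed
      have sub: "cball w s \<subseteq> sector \<sigma> R1 \<delta>'" using in_ball by (auto simp: dist_norm)
      have "norm ((deriv ^^ 1) h w) \<le> fact 1 * (3/2 * \<epsilon> * norm z1) / s ^ 1"
      proof (rule Cauchy_inequality[OF _ _ s])
        show "h holomorphic_on ball w s" using hol sub by (meson ball_subset_cball holomorphic_on_subset order_trans)
        show "continuous_on (cball w s) h" using hol sub by (meson holomorphic_on_imp_continuous_on holomorphic_on_subset)
        show "norm (h x) \<le> 3/2 * \<epsilon> * norm z1" if "norm (w - x) = s" for x using in_ball that by simp
      qed
      also have "\<dots> \<le> 1/2" using z1p \<eta> by (simp add: s_def \<epsilon>_def field_simps)
      finally show ?thesis by simp
    qed
    have "norm (h z1 - h z2) \<le> 1/2 * norm (z1 - z2)"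
    proof (rule field_differentiable_bound[of "closed_segment z1 z2" h "deriv h"])
      fix w assume w: "w \<in> closed_segment z1 z2"
      have "norm (w - z1) \<le> \<eta> * norm z1"
        using segment_bound(1)[OF w] True mult_pos_pos[OF \<eta>(1) z1p]
        by (simp add: norm_minus_commute)
      then have "w \<in> sector \<sigma> R1 \<delta>'" using close z1 by blast
      then show "(h has_field_derivative deriv h w) (at w within closed_segment z1 z2)"
        using hol by (meson holomorphic_derivI open_sector has_field_derivative_at_within)
    qed (use der in auto)
    moreover have "h z1 - h z2 = z2 - z1" using eq by (simp add: algebra_simps)
    ultimately have "norm (z1 - z2) \<le> 1/2 * norm (z1 - z2)" by (simp add: norm_minus_commute)
    then show ?thesis by simp
  next
    case False
    have z1p: "norm z1 > 0" using z1 R by (auto simp: sector_def)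
    have "h z1 - h z2 = z2 - z1" using eq by (simp add: algebra_simps)
    then have "norm (z2 - z1) = norm (h z1 - h z2)" by simp
    also have "\<dots> \<le> norm (h z1) + norm (h z2)" by (rule norm_triangle_ineq4)
    also have "\<dots> \<le> 3/2 * \<epsilon> * norm z1 + 3/2 * \<epsilon> * norm z2"
      using \<eta> by (intro add_mono close(2)[OF z1] close(2)[OF z2]) auto
    also have "\<dots> \<le> 3/2 * \<epsilon> * norm z1 + 3/2 * \<epsilon> * norm z1"
      using le \<eta> by (intro add_left_mono mult_left_mono) (auto simp: \<epsilon>_def)
    also have "\<dots> = 3/8 * (\<eta> * norm z1)" by (simp add: \<epsilon>_def)
    finally have "\<eta> * norm z1 \<le> 0" using False by simp
    then show ?thesis using mult_pos_pos[OF \<eta>(1) z1p] by linarith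
  qed
  have "inj_on (\<lambda>z. z + h z) (sector \<sigma> R \<delta>)"
  proof (rule inj_onI)
    fix z1 z2 assume "z1 \<in> sector \<sigma> R \<delta>" "z2 \<in> sector \<sigma> R \<delta>" "z1 + h z1 = z2 + h z2"
    then show "z1 = z2" using key[of z1 z2] key[of z2 z1] by (metis linear)
  qed
  then show ?thesis by blast
qed

text \<open>The equation \<open>z + h z = w\<close> is solved by a fixed point of \<open>z \<mapsto> w - h z\<close>, which maps the ball of radius
  \<open>\<eta> norm w\<close> about \<open>w\<close> to itself.\<close>

lemma sector_subset_image_near_identity:
  assumes \<delta>: "0 < \<delta>" "\<delta> < \<delta>'" "\<delta>' < pi/2" and \<sigma>: "norm \<sigma> = 1"
    and cont: "continuous_on (sector \<sigma> R \<delta>') h" and small: "sublinear_on_sector \<sigma> \<delta>' h"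
  shows "\<exists>R'>0. sector \<sigma> R' \<delta> \<subseteq> (\<lambda>z. z + h z) ` sector \<sigma> R \<delta>'"
proof -
  obtain \<eta> where \<eta>: "0 < \<eta>" "\<eta> \<le> 1/2"
    "\<And>R z w. 0 \<le> R \<Longrightarrow> z \<in> sector \<sigma> R \<delta> \<Longrightarrow> norm (w - z) \<le> \<eta> * norm z \<Longrightarrow> w \<in> sector \<sigma> (R/2) \<delta>'"
    using sector_perturb[OF \<delta> \<sigma>] by blast
  obtain R2 where R2: "\<And>z. z \<in> sector \<sigma> R2 \<delta>' \<Longrightarrow> norm (h z) \<le> \<eta>/2 * norm z"
    using small \<eta>(1) unfolding sublinear_on_sector_def by (metis half_gt_zero)
  define R' where "R' = 2 * max (max R R2) 1"
  have R': "0 < R'" "R \<le> R'/2" "R2 \<le> R'/2" by (auto simp: R'_def)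
  have "w \<in> (\<lambda>z. z + h z) ` sector \<sigma> R \<delta>'" if w: "w \<in> sector \<sigma> R' \<delta>" for w
  proof -
    have "norm w > 0" using w R' by (auto simp: sector_def)
    then have wp: "\<eta> * norm w > 0" using \<eta> by (intro mult_pos_pos)
    have near: "z \<in> sector \<sigma> (R'/2) \<delta>'" if "z \<in> cball w (\<eta> * norm w)" for z
      using that R' by (intro \<eta>(3)[OF _ w]) (auto simp: dist_norm norm_minus_commute)
    obtain z where z: "z \<in> cball w (\<eta> * norm w)" "w - h z = z"
    proof (rule brouwer_ball[OF wp, of w "\<lambda>z. w - h z"])
      show "continuous_on (cball w (\<eta> * norm w)) (\<lambda>z. w - h z)"
        using near sector_mono[OF R'(2)]
        by (intro continuous_intros continuous_on_subset[OF cont]) blast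
      show "(\<lambda>z. w - h z) \<in> cball w (\<eta> * norm w) \<rightarrow> cball w (\<eta> * norm w)"
      proof
        fix z assume z: "z \<in> cball w (\<eta> * norm w)"
        have "norm z \<le> norm w + norm (z - w)" by (metis norm_triangle_sub)
        also have "norm (z - w) \<le> \<eta> * norm w" using z by (simp add: dist_norm norm_minus_commute)
        also have "\<eta> * norm w \<le> 1 * norm w" using \<eta> by (intro mult_right_mono) auto
        finally have "\<eta>/2 * norm z \<le> \<eta>/2 * (2 * norm w)" using \<eta> by (intro mult_left_mono) auto
        moreover have "norm (h z) \<le> \<eta>/2 * norm z"
          using near[OF z] sector_mono[OF R'(3)] by (intro R2) auto
        ultimately show "w - h z \<in> cball w (\<eta> * norm w)" by (simp add: dist_norm)
      qed
    qed blast
    show ?thesis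
      using z(2) near[OF z(1)] sector_mono[OF R'(2)] by (intro image_eqI[of _ _ z]) (auto simp: algebra_simps)
  qed
  then show ?thesis using R'(1) by blast
qed

section \<open>Uniqueness of Fatou coordinates\<close>

text \<open>The relation \<open>u (w + 1) = u w + 1\<close> extends \<open>u\<close> to an injective entire function \<open>U\<close>. For \<open>s\<close> different from
  \<open>0\<close> and \<open>1\<close>, the function \<open>w \<mapsto> U (w + s) - U w\<close> omits \<open>0\<close> by injectivity, and omits \<open>1\<close> since
  \<open>U w + 1 = U (w + 1)\<close>. By the little Picard theorem it is constant, so \<open>U'\<close> is constant.\<close>

lemma injective_map_commuting_with_unit_translation:
  assumes hol: "u holomorphic_on {w. R < Re w}" and inj: "inj_on u {w. R < Re w}"
    and step: "\<And>w. R < Re w \<Longrightarrow> u (w + 1) = u w + 1"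
  shows "\<exists>\<beta>. \<forall>w. R < Re w \<longrightarrow> u w = w + \<beta>"
proof -
  have iter: "u (w + of_nat n) = u w + of_nat n" if "R < Re w" for w n
  proof (induction n)
    case (Suc n)
    then show ?case using step[of "w + of_nat n"] that by (simp add: algebra_simps)
  qed simp
  define U where "U w = (let n = nat \<lceil>R - Re w\<rceil> + 1 in u (w + of_nat n) - of_nat n)" for w
  have U: "U w = u (w + of_nat n) - of_nat n" if n: "R < Re w + real n" for w n
  proof -
    define m where "m = nat \<lceil>R - Re w\<rceil> + 1"
    have m: "R < Re w + real m" unfolding m_def by linarith
    have "u (w + of_nat n + of_nat m) = u (w + of_nat n) + of_nat m"
      "u (w + of_nat m + of_nat n) = u (w + of_nat m) + of_nat n"
      using n m by (auto intro!: iter)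
    moreover have "w + of_nat n + of_nat m = w + of_nat m + of_nat n" by simp
    ultimately have "u (w + of_nat m) + of_nat n = u (w + of_nat n) + of_nat m" by metis
    moreover have "U w = u (w + of_nat m) - of_nat m" unfolding U_def Let_def m_def ..
    moreover have "a - of_nat m = b - of_nat n" if "a + of_nat n = b + of_nat m" for a b :: complex
    proof -
      have "a = b + of_nat m - of_nat n" using that by (simp only: eq_diff_eq)
      then show ?thesis by simp
    qed
    ultimately show ?thesis by simp
  qed
  have U_eq: "U w = u w" if "R < Re w" for w using U[of w 0] that by simp
  have large: "\<exists>n. R < Re w1 + real n \<and> R < Re w2 + real n" for w1 w2
  proof -
    obtain n where "real n > max (R - Re w1) (R - Re w2)" using reals_Archimedean2 by blast
    then show ?thesis by (intro exI[of _ n]) auto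
  qed
  have U_hol: "U holomorphic_on UNIV"
  proof -
    have "U holomorphic_on (\<Union>n. {w. R < Re w + real n})"
    proof (rule holomorphic_on_UN_open)
      fix n
      have "(\<lambda>w. u (w + of_nat n) - of_nat n) holomorphic_on {w. R < Re w + real n}"
        by (intro holomorphic_intros holomorphic_on_compose_gen[OF _ hol, unfolded o_def]) auto
      then show "U holomorphic_on {w. R < Re w + real n}"
        by (rule holomorphic_transform) (use U in simp)
      show "open {w. R < Re w + real n}" by (intro open_Collect_less continuous_intros)
    qed
    moreover have "w \<in> (\<Union>n. {w. R < Re w + real n})" for w using large[of w w] by auto
    then have "(\<Union>n. {w. R < Re w + real n}) = UNIV" by blast
    ultimately show ?thesis by simp
  qed
  have U_inj: "w1 = w2" if "U w1 = U w2" for w1 w2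
  proof -
    obtain n where n: "R < Re w1 + real n" "R < Re w2 + real n" using large by blast
    then have "u (w1 + of_nat n) = u (w2 + of_nat n)" using that U by simp
    then show ?thesis using inj_onD[OF inj, of "w1 + of_nat n" "w2 + of_nat n"] n by simp
  qed
  have U_step: "U (w + 1) = U w + 1" for w
  proof -
    obtain n where n: "R < Re w + real n" using large by blast
    then have "U (w + 1) = u (w + 1 + of_nat n) - of_nat n" by (intro U) simp
    also have "w + 1 + of_nat n = (w + of_nat n) + 1" by simp
    also have "u \<dots> = u (w + of_nat n) + 1" using n by (intro step) simp
    finally show ?thesis using U[OF n] by simp
  qed
  have add: "U (w + s) = U w + (U s - U 0)" for w s
  proof (cases "s = 0 \<or> s = 1")
    case True
    then show ?thesis using U_step[of w] U_step[of 0] by auto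
  next
    case False
    define q where "q w = U (w + s) - U w" for w
    have "q holomorphic_on UNIV" unfolding q_def
      by (intro holomorphic_intros holomorphic_on_compose_gen[OF _ U_hol, unfolded o_def] U_hol) auto
    moreover have "q w \<noteq> 0 \<and> q w \<noteq> 1" for w
    proof (intro conjI notI)
      assume "q w = 0"
      then show False using U_inj[of "w + s" w] False by (simp add: q_def)
    next
      assume "q w = 1"
      then have "U (w + s) = U (w + 1)" using U_step[of w] by (simp add: q_def algebra_simps)
      then show False using U_inj[of "w + s" "w + 1"] False by simp
    qed
    ultimately obtain c where "q = (\<lambda>w. c)" by (rule little_Picard_01)
    then have "q w = q 0" by simp
    then show ?thesis by (simp add: q_def algebra_simps)
  qed
  have U_der: "(U has_field_derivative deriv U w) (at w)" for w
    using U_hol by (meson UNIV_I holomorphic_derivI open_UNIV)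
  have "((\<lambda>w. U w - deriv U 0 * w) has_field_derivative 0) (at s)" for s
  proof -
    have "((\<lambda>w. U (w + s)) has_field_derivative deriv U s) (at 0)"
      using U_der[of s] DERIV_shift[of U "deriv U s" 0 s] by simp
    moreover have "((\<lambda>w. U w + (U s - U 0)) has_field_derivative deriv U 0) (at 0)"
      using U_der[of 0] by (auto intro!: derivative_eq_intros)
    ultimately have "deriv U s = deriv U 0" unfolding add by (rule DERIV_unique)
    then show ?thesis using U_der[of s] by (auto intro!: derivative_eq_intros)
  qed
  then have "(\<lambda>w. U w - deriv U 0 * w) constant_on UNIV"
    by (intro has_field_derivative_0_imp_constant_on) auto
  then obtain \<beta> where \<beta>: "\<And>w. U w - deriv U 0 * w = \<beta>" by (auto simp: constant_on_def)
  have "deriv U 0 = 1" using \<beta>[of 0] \<beta>[of 1] U_step[of 0] by simp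
  then show ?thesis using \<beta> U_eq by (metis add.commute diff_add_cancel mult_1)
qed

text \<open>The image of \<open>v\<close> contains a half-plane on which \<open>V \<circ> v\<^sup>-\<^sup>1\<close> is defined, injective and commutes with the unit
  translation; so it is a translation there, and the identity theorem carries \<open>V = v + c\<close> to the whole sector.
  On the left side the half-plane is turned around by conjugating with \<open>w \<mapsto> \<sigma> w\<close>.\<close>

lemma fatou_coordinate_unique:
  fixes f h V :: "complex \<Rightarrow> complex"
  defines "v \<equiv> \<lambda>z. z + h z"
  assumes \<sigma>: "\<sigma> = 1 \<or> \<sigma> = -1" and \<delta>: "0 < \<delta>" "\<delta> < pi/2" and R: "0 \<le> R"
    and f: "\<And>z. z \<in> sector \<sigma> R \<delta> \<Longrightarrow> norm (f z - (z + 1)) \<le> K"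
    and h: "h holomorphic_on sector \<sigma> R \<delta>" and small: "sublinear_on_sector \<sigma> \<delta> h"
    and v: "inj_on v (sector \<sigma> R \<delta>)"
      "\<And>z. z \<in> sector \<sigma> R \<delta> \<Longrightarrow> f z \<in> sector \<sigma> R \<delta> \<Longrightarrow> v (f z) = v z + 1"
    and V: "V holomorphic_on sector \<sigma> R \<delta>" "inj_on V (sector \<sigma> R \<delta>)"
      "\<And>z. z \<in> sector \<sigma> R \<delta> \<Longrightarrow> f z \<in> sector \<sigma> R \<delta> \<Longrightarrow> V (f z) = V z + 1"
  shows "\<exists>c. \<forall>z\<in>sector \<sigma> R \<delta>. V z = v z + c"
proof -
  define S where "S = sector \<sigma> R \<delta>"
  have \<sigma>n: "norm \<sigma> = 1" using \<sigma> by auto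
  have vh: "v holomorphic_on S" unfolding v_def S_def by (intro holomorphic_intros h)
  obtain g where g: "g holomorphic_on v ` S" "\<And>z. z \<in> S \<Longrightarrow> g (v z) = z"
    using holomorphic_has_inverse[OF vh _ v(1)[folded S_def]] by (metis S_def open_sector)
  define \<delta>1 where "\<delta>1 = \<delta> / 2"
  have \<delta>1: "0 < \<delta>1" "\<delta>1 < \<delta>" "\<delta>1 / 2 < \<delta>1" "\<delta>1 < pi/2" "\<delta>1 / 2 < pi/2" "0 < \<delta>1 / 2"
    using \<delta> by (auto simp: \<delta>1_def)
  obtain \<eta> where \<eta>: "0 < \<eta>" "\<eta> \<le> 1/2"
    "\<And>R z w. 0 \<le> R \<Longrightarrow> z \<in> sector \<sigma> R \<delta>1 \<Longrightarrow> norm (w - z) \<le> \<eta> * norm z \<Longrightarrow> w \<in> sector \<sigma> (R/2) \<delta>"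
    using sector_perturb[OF \<delta>1(1,2) \<delta>(2) \<sigma>n] by blast
  \<comment> \<open>Beyond \<open>R2\<close> the step from \<open>z\<close> to \<open>f z\<close>, of length at most \<open>K + 1\<close>, is a perturbation of relative size \<open>\<eta>\<close>.\<close>
  define R2 where "R2 = max (2 * R) ((\<bar>K\<bar> + 1) / \<eta>)"
  have R2: "0 \<le> R2" "R \<le> R2 / 2" "R \<le> R2" using R by (auto simp: R2_def)
  have SS: "sector \<sigma> R2 \<delta>1 \<subseteq> S" unfolding S_def by (rule sector_widen[OF \<delta>1(1,2) \<delta>(2) R2(3)])
  have fS: "f z \<in> S" if z: "z \<in> sector \<sigma> R2 \<delta>1" for z
  proof -
    have "(\<bar>K\<bar> + 1) / \<eta> < norm z" using z by (auto simp: sector_def R2_def)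
    then have "\<bar>K\<bar> + 1 \<le> \<eta> * norm z" using \<eta> by (simp add: field_simps)
    moreover have "norm (f z - z) \<le> norm (f z - (z + 1)) + norm (1::complex)"
      by (metis add_diff_cancel_left' diff_diff_add diff_diff_eq2 norm_triangle_ineq diff_add_cancel)
    ultimately have "norm (f z - z) \<le> \<eta> * norm z" using f[of z] z SS by (auto simp: S_def)
    then have "f z \<in> sector \<sigma> (R2/2) \<delta>" using \<eta>(3)[OF R2(1) z] by blast
    then show ?thesis using sector_mono[OF R2(2)] by (auto simp: S_def)
  qed
  have small1: "sublinear_on_sector \<sigma> \<delta>1 h"
    using small sector_widen[OF \<delta>1(1,2) \<delta>(2) order_refl] unfolding sublinear_on_sector_def by (meson subsetD)
  obtain R3 where R3: "R3 > 0" "sector \<sigma> R3 (\<delta>1/2) \<subseteq> v ` sector \<sigma> R2 \<delta>1"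
    using sector_subset_image_near_identity[OF \<delta>1(6,3,4) \<sigma>n _ small1] h SS unfolding v_def S_def
    by (meson continuous_on_subset holomorphic_on_imp_continuous_on)
  define H where "H = {w. R3 < Re (\<sigma> * w)}"
  have H_sub: "H \<subseteq> v ` sector \<sigma> R2 \<delta>1"
  proof -
    have "w \<in> sector \<sigma> R3 (\<delta>1/2)" if "w \<in> H" for w
    proof -
      have "R3 < norm w" using that complex_Re_le_cmod[of "\<sigma> * w"] by (simp add: H_def norm_mult \<sigma>n)
      moreover have "sin (\<delta>1/2) > 0" using \<delta>1 by (intro sin_gt_zero) auto
      then have "- sin (\<delta>1/2) * norm w \<le> 0" by simp
      ultimately show ?thesis using that R3 by (simp add: H_def sector_def)
    qed
    then show ?thesis using R3(2) by blast
  qed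
  have gH: "g w \<in> sector \<sigma> R2 \<delta>1" "v (g w) = w" if "w \<in> H" for w
  proof -
    obtain z where z: "z \<in> sector \<sigma> R2 \<delta>1" "w = v z" using H_sub \<open>w \<in> H\<close> by blast
    then have "g w = z" using g(2) SS by blast
    then show "g w \<in> sector \<sigma> R2 \<delta>1" "v (g w) = w" using z by simp_all
  qed
  have step: "V (g (w + 1)) = V (g w) + 1" if "w \<in> H" for w
  proof -
    have z: "g w \<in> S" "f (g w) \<in> S" using gH[OF that] SS fS by auto
    then have "v (f (g w)) = w + 1" using v(2) gH(2)[OF that] by (simp add: S_def)
    then have "g (w + 1) = f (g w)" using g(2)[OF z(2)] by simp
    then show ?thesis using V(3) z by (simp add: S_def)
  qed
  define u where "u w = \<sigma> * V (g (\<sigma> * w))" for w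
  have \<sigma>2: "\<sigma> * \<sigma> = 1" and \<sigma>0: "\<sigma> \<noteq> 0" using \<sigma> by auto
  have \<sigma>\<sigma>: "\<sigma> * (\<sigma> * w) = w" for w by (simp add: \<sigma>2 flip: mult.assoc)
  have H_iff: "\<sigma> * w \<in> H \<longleftrightarrow> R3 < Re w" for w by (simp only: H_def mem_Collect_eq \<sigma>\<sigma>)
  have "\<exists>\<beta>. \<forall>w. R3 < Re w \<longrightarrow> u w = w + \<beta>"
  proof (rule injective_map_commuting_with_unit_translation)
    have im1: "(\<lambda>w. \<sigma> * w) ` {w. R3 < Re w} \<subseteq> v ` S"
    proof (rule image_subsetI)
      fix w assume "w \<in> {w. R3 < Re w}"
      then have "\<sigma> * w \<in> H" by (simp only: H_iff mem_Collect_eq)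
      then show "\<sigma> * w \<in> v ` S" using H_sub SS by blast
    qed
    have im2: "(\<lambda>w. g (\<sigma> * w)) ` {w. R3 < Re w} \<subseteq> sector \<sigma> R \<delta>"
    proof (rule image_subsetI)
      fix w assume "w \<in> {w. R3 < Re w}"
      then have "\<sigma> * w \<in> H" by (simp only: H_iff mem_Collect_eq)
      then show "g (\<sigma> * w) \<in> sector \<sigma> R \<delta>" using gH(1) SS S_def by blast
    qed
    have "(\<lambda>w. V (g (\<sigma> * w))) holomorphic_on {w. R3 < Re w}"
      by (intro holomorphic_on_compose_gen[OF _ V(1), unfolded o_def]
           holomorphic_on_compose_gen[OF _ g(1), unfolded o_def] holomorphic_intros)
         (rule im1 im2)+
    then show "u holomorphic_on {w. R3 < Re w}" unfolding u_def by (intro holomorphic_intros)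
    show "inj_on u {w. R3 < Re w}"
    proof (rule inj_onI)
      fix w1 w2 assume w: "w1 \<in> {w. R3 < Re w}" "w2 \<in> {w. R3 < Re w}" and "u w1 = u w2"
      then have eq: "V (g (\<sigma> * w1)) = V (g (\<sigma> * w2))"
        unfolding u_def by (simp only: mult_cancel_left \<sigma>0 simp_thms)
      have H: "\<sigma> * w1 \<in> H" "\<sigma> * w2 \<in> H" using w by (simp_all only: H_iff mem_Collect_eq)
      have "g (\<sigma> * w1) \<in> sector \<sigma> R \<delta>" "g (\<sigma> * w2) \<in> sector \<sigma> R \<delta>"
        using gH(1)[OF H(1)] gH(1)[OF H(2)] SS unfolding S_def by blast+
      from inj_onD[OF V(2) eq this] have "\<sigma> * w1 = \<sigma> * w2"
        using gH(2)[OF H(1)] gH(2)[OF H(2)] by metis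
      then show "w1 = w2" using \<sigma>0 by simp
    qed
    fix w assume w: "R3 < Re w"
    show "u (w + 1) = u w + 1"
      using \<sigma>
    proof
      assume "\<sigma> = 1"
      then show ?thesis using step[of w] w H_iff[of w] by (simp add: u_def)
    next
      assume "\<sigma> = -1"
      then show ?thesis using step[of "- (w + 1)"] w H_iff[of "w + 1"] by (simp add: u_def)
    qed
  qed
  then obtain \<beta> where \<beta>: "\<And>w. R3 < Re w \<Longrightarrow> u w = w + \<beta>" by blast
  have V_eq: "V (g w) = w + \<sigma> * \<beta>" if "w \<in> H" for w
  proof -
    have "u (\<sigma> * w) = \<sigma> * w + \<beta>" using that by (intro \<beta>) (simp add: H_def)
    then have "\<sigma> * (\<sigma> * V (g w)) = \<sigma> * (\<sigma> * w + \<beta>)" by (simp add: u_def \<sigma>\<sigma>)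
    then show ?thesis by (simp add: \<sigma>\<sigma> distrib_left)
  qed
  define T where "T = S \<inter> v -` H"
  have "V z = v z + \<sigma> * \<beta>" if "z \<in> S" for z
  proof (rule analytic_continuation_open[of T S V "\<lambda>z. v z + \<sigma> * \<beta>"])
    have "open H" unfolding H_def by (intro open_Collect_less continuous_intros)
    then show "open T" unfolding T_def
      using vh by (intro continuous_open_preimage) (auto intro: holomorphic_on_imp_continuous_on simp: S_def)
    have "\<sigma> * of_real (R3 + 1) \<in> H" unfolding H_iff by simp
    then show "T \<noteq> {}" using gH SS unfolding T_def by blast
    show "connected S" unfolding S_def by (rule connected_sector[OF \<sigma>n R \<delta>])
    show "V z = v z + \<sigma> * \<beta>" if "z \<in> T" for z
      using that V_eq[of "v z"] g(2)[of z] by (auto simp: T_def)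
  qed (use that V(1) vh in \<open>auto simp: T_def S_def intro!: holomorphic_intros\<close>)
  then show ?thesis unfolding S_def by blast
qed

section \<open>Integrals over a half-line with exponential decay\<close>

lemma set_integrable_exp_neg:
  assumes "0 < (a::real)"
  shows "set_integrable lborel {0..} (\<lambda>t. exp (- a * t))"
proof -
  have "set_integrable lebesgue {0..} (\<lambda>t. exp (- a * t))"
    using assms by (intro nonnegative_absolutely_integrable_1 integrable_on_exp_minus_to_infinity) auto
  moreover have "(\<lambda>t. indicator {0..} t *\<^sub>R exp (- a * t)) \<in> borel_measurable lborel"
    by simp
  ultimately show ?thesis unfolding set_integrable_def by (simp add: integrable_completion)
qed

lemma power_le_exp:
  assumes "0 \<le> t" "0 < b"
  shows "t ^ m \<le> fact m / b ^ m * exp (b * t :: real)"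
proof -
  have "(\<Sum>n\<in>{m}. inverse (fact n) *\<^sub>R (b * t) ^ n) \<le> (\<Sum>n. inverse (fact n) *\<^sub>R (b * t) ^ n)"
    using assms by (intro sum_le_suminf summable_exp_generic) auto
  then have "(b * t) ^ m / fact m \<le> exp (b * t)"
    by (simp add: exp_def divide_inverse mult.commute)
  then show ?thesis using assms by (simp add: power_mult_distrib field_simps)
qed

lemma set_integrable_exp_bounded:
  fixes f :: "real \<Rightarrow> complex"
  assumes meas: "set_borel_measurable lborel {0..} f" and a: "0 < a"
    and bd: "\<And>t. 0 \<le> t \<Longrightarrow> norm (f t) \<le> C * t ^ N * exp (- a * t)"
  shows "set_integrable lborel {0..} f"
proof (rule set_integrable_bound[OF _ meas])
  show "set_integrable lborel {0..} (\<lambda>t. \<bar>C\<bar> * (fact N / (a/2) ^ N) * exp (- (a/2) * t))"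
    using a by (intro set_integrable_mult_right set_integrable_exp_neg) auto
  have "norm (f t) \<le> norm (\<bar>C\<bar> * (fact N / (a/2) ^ N) * exp (- (a/2) * t))" if t: "0 \<le> t" for t
  proof -
    have "norm (f t) \<le> C * t ^ N * exp (- a * t)" by (rule bd[OF t])
    also have "\<dots> \<le> \<bar>C\<bar> * t ^ N * exp (- a * t)"
      using t by (intro mult_right_mono) auto
    also have "\<dots> \<le> \<bar>C\<bar> * (fact N / (a/2) ^ N * exp (a/2 * t)) * exp (- a * t)"
      using t a by (intro mult_right_mono mult_left_mono power_le_exp) auto
    also have "\<dots> = \<bar>C\<bar> * (fact N / (a/2) ^ N) * (exp (a/2 * t) * exp (- a * t))" by (simp only: mult.assoc)
    also have "exp (a/2 * t) * exp (- a * t) = exp (- (a/2) * t)"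
      by (simp add: exp_add[symmetric] algebra_simps)
    finally have *: "norm (f t) \<le> \<bar>C\<bar> * (fact N / (a/2) ^ N) * exp (- (a/2) * t)" .
    then show ?thesis unfolding real_norm_def by (rule order_trans[OF _ abs_ge_self])
  qed
  then show "AE t in lborel. t \<in> {0..} \<longrightarrow> norm (f t) \<le> norm (\<bar>C\<bar> * (fact N / (a/2) ^ N) * exp (- (a/2) * t))"
    by simp
qed

lemma set_borel_measurable_continuous_on:
  fixes f :: "real \<Rightarrow> complex"
  assumes "A \<in> sets borel" "continuous_on A f"
  shows "set_borel_measurable lborel A f"
  unfolding set_borel_measurable_def using borel_measurable_continuous_on_indicator[OF assms] by simp

lemma LBINT_half_line_eq_lim:
  fixes f :: "real \<Rightarrow> complex"
  assumes "set_integrable lborel {0..} f"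
  shows "((\<lambda>T. integral {0..T} f) \<longlongrightarrow> (LBINT t:{0..}. f t)) at_top"
proof -
  have "((\<lambda>T. LBINT t:{0..T}. f t) \<longlongrightarrow> (LBINT t:{0..}. f t)) at_top"
    using assms by (intro tendsto_set_lebesgue_integral_at_top) auto
  moreover have "(LBINT t:{0..T}. f t) = integral {0..T} f" for T
    using assms by (intro set_borel_integral_eq_integral set_integrable_subset[OF assms]) auto
  ultimately show ?thesis by simp
qed

lemma LBINT_half_line_FTC:
  fixes f F :: "real \<Rightarrow> complex"
  assumes "set_integrable lborel {0..} f"
    and "\<And>t. 0 \<le> t \<Longrightarrow> (F has_vector_derivative f t) (at t within {0..})"
  shows "((\<lambda>T. F T - F 0) \<longlongrightarrow> (LBINT t:{0..}. f t)) at_top"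
proof (rule Lim_transform_eventually[OF LBINT_half_line_eq_lim[OF assms(1)]])
  show "\<forall>\<^sub>F T in at_top. integral {0..T} f = F T - F 0"
    using eventually_ge_at_top[of 0]
  proof eventually_elim
    case (elim T)
    have "(f has_integral (F T - F 0)) {0..T}"
    proof (rule fundamental_theorem_of_calculus[OF elim])
      fix t assume t: "t \<in> {0..T}"
      show "(F has_vector_derivative f t) (at t within {0..T})"
        by (rule has_vector_derivative_within_subset[OF assms(2)]) (use t in auto)
    qed
    then show ?case by (rule integral_unique)
  qed
qed

abbreviation exp_monomial :: "complex \<Rightarrow> nat \<Rightarrow> real \<Rightarrow> complex" where
  "exp_monomial s n t \<equiv> exp (- (s * of_real t)) * of_real t ^ n"

lemma has_field_derivative_exp_minus_mult:
  "((\<lambda>w. exp (- (s * w))) has_field_derivative exp (- (s * x)) * - s) (at (x::complex))"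
  by (intro DERIV_fun_exp DERIV_minus DERIV_cmult_Id)

text \<open>The primitive is kept abstract; integration by parts gives it for \<open>n + 1\<close> from the one for \<open>n\<close>.\<close>

lemma exp_monomial_primitive:
  fixes s :: complex
  assumes "0 < Re s"
  shows "\<exists>F. (\<forall>t. (F has_vector_derivative exp_monomial s n t) (at t)) \<and>
      F 0 = - fact n / s ^ (n + 1) \<and> (F \<longlongrightarrow> 0) at_top"
proof (induction n)
  have s0: "s \<noteq> 0" using assms by auto
  have small: "(exp_monomial s m \<longlongrightarrow> 0) at_top" for m
  proof (rule Lim_null_comparison)
    show "\<forall>\<^sub>F t in at_top. norm (exp_monomial s m t) \<le> fact m / (Re s/2) ^ m * exp (- (Re s/2) * t)"
      using eventually_ge_at_top[of 0]
    proof eventually_elim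
      case (elim t)
      have "norm (exp_monomial s m t) = exp (- Re s * t) * t ^ m"
        using elim by (simp add: norm_mult norm_power)
      also have "\<dots> \<le> exp (- Re s * t) * (fact m / (Re s/2) ^ m * exp (Re s/2 * t))"
        using elim assms by (intro mult_left_mono power_le_exp) auto
      also have "\<dots> = fact m / (Re s/2) ^ m * (exp (- Re s * t) * exp (Re s/2 * t))" by (simp only: mult_ac)
      also have "exp (- Re s * t) * exp (Re s/2 * t) = exp (- (Re s/2) * t)"
        by (simp add: exp_add[symmetric] algebra_simps)
      finally show ?case .
    qed
    define c where "c = Re s / 2"
    have "c > 0" using assms by (simp add: c_def)
    then have "((\<lambda>t. exp (- c * t)) \<longlongrightarrow> 0) at_top" by real_asymp
    then show "((\<lambda>t. fact m / (Re s/2) ^ m * exp (- (Re s/2) * t)) \<longlongrightarrow> 0) at_top"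
      unfolding c_def by (rule tendsto_mult_right_zero)
  qed
  case 0
  show ?case
  proof (intro exI conjI allI)
    fix t
    have "((\<lambda>w. - exp (- (s * w)) / s) has_field_derivative exp (- (s * of_real t))) (at (of_real t))"
      by (rule DERIV_cong[OF DERIV_cdivide[OF DERIV_minus[OF has_field_derivative_exp_minus_mult]]]) (simp add: s0)
    from has_vector_derivative_real_field[OF this]
    show "((\<lambda>t. - exp (- (s * of_real t)) / s) has_vector_derivative exp_monomial s 0 t) (at t)"
      by simp
  next
    show "((\<lambda>t. - exp (- (s * of_real t)) / s) \<longlongrightarrow> 0) at_top"
      using tendsto_divide[OF tendsto_minus[OF small[of 0]] tendsto_const s0] by simp
  qed simp
  case (Suc n)
  then obtain F where F: "\<And>t. (F has_vector_derivative exp_monomial s n t) (at t)"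
      "F 0 = - fact n / s ^ (n + 1)" "(F \<longlongrightarrow> 0) at_top" by blast
  define G where "G t = (of_nat (Suc n) * F t - exp_monomial s (Suc n) t) / s" for t
  show ?case
  proof (intro exI conjI allI)
    fix t
    have "((\<lambda>w. exp (- (s * w)) * w ^ Suc n) has_field_derivative
        of_nat (Suc n) * exp_monomial s n t - s * exp_monomial s (Suc n) t) (at (of_real t))"
    proof -
      have "((\<lambda>w. w ^ Suc n) has_field_derivative of_nat (Suc n) * of_real t ^ n) (at (complex_of_real t))"
        by (rule DERIV_cong[OF DERIV_power[OF DERIV_ident]]) simp
      from DERIV_mult[OF has_field_derivative_exp_minus_mult[of s] this] show ?thesis by (rule DERIV_cong) (simp add: algebra_simps del: power_Suc of_nat_Suc)
    qed
    from has_vector_derivative_real_field[OF this]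
    have E: "((exp_monomial s (Suc n)) has_vector_derivative
        of_nat (Suc n) * exp_monomial s n t - s * exp_monomial s (Suc n) t) (at t)" .
    have "((\<lambda>t. of_nat (Suc n) * F t - exp_monomial s (Suc n) t) has_vector_derivative
        of_nat (Suc n) * exp_monomial s n t -
        (of_nat (Suc n) * exp_monomial s n t - s * exp_monomial s (Suc n) t)) (at t)"
      by (intro has_vector_derivative_diff E has_vector_derivative_mult_right F(1))
    then have "(G has_vector_derivative (s * exp_monomial s (Suc n) t) / s) (at t)"
      unfolding G_def by (intro has_vector_derivative_divide) simp
    then show "(G has_vector_derivative exp_monomial s (Suc n) t) (at t)"
      using s0 by simp
  next
    show "G 0 = - fact (Suc n) / s ^ (Suc n + 1)" 
    proof -
      have "G 0 = of_nat (Suc n) * F 0 / s" by (simp add: G_def)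
      also have "\<dots> = - (of_nat (Suc n) * fact n) / (s ^ (n + 1) * s)" unfolding F(2) by simp
      also have "s ^ (n + 1) * s = s ^ (Suc n + 1)" by simp
      also have "of_nat (Suc n) * fact n = (fact (Suc n) :: complex)" by simp
      finally show ?thesis .
    qed
    have "(G \<longlongrightarrow> (of_nat (Suc n) * 0 - 0) / s) at_top"
      unfolding G_def by (intro tendsto_divide tendsto_diff tendsto_mult_left tendsto_const F(3) small s0)
    then show "(G \<longlongrightarrow> 0) at_top" by simp
  qed
qed

lemma LBINT_exp_monomial:
  fixes s :: complex
  assumes s: "0 < Re s"
  shows "set_integrable lborel {0..} (exp_monomial s n)"
    and "(LBINT t:{0..}. exp_monomial s n t) = fact n / s ^ (n + 1)"
proof -
  show int: "set_integrable lborel {0..} (exp_monomial s n)"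
    by (rule set_integrable_exp_bounded[OF set_borel_measurable_continuous_on s, where C = 1 and N = n])
       (auto intro!: continuous_intros simp: norm_mult norm_power)
  obtain F where F: "\<And>t. (F has_vector_derivative exp_monomial s n t) (at t)"
      "F 0 = - fact n / s ^ (n + 1)" "(F \<longlongrightarrow> 0) at_top" using exp_monomial_primitive[OF s] by blast
  have "((\<lambda>T. F T - F 0) \<longlongrightarrow> (LBINT t:{0..}. exp_monomial s n t)) at_top"
    by (rule LBINT_half_line_FTC[OF int has_vector_derivative_at_within[OF F(1)]])
  moreover have "((\<lambda>T. F T - F 0) \<longlongrightarrow> 0 - F 0) at_top" by (rule tendsto_diff[OF F(3) tendsto_const])
  ultimately show "(LBINT t:{0..}. exp_monomial s n t) = fact n / s ^ (n + 1)"
  proof -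
    assume "((\<lambda>T. F T - F 0) \<longlongrightarrow> 0 - F 0) at_top"
      "((\<lambda>T. F T - F 0) \<longlongrightarrow> (LBINT t:{0..}. exp_monomial s n t)) at_top"
    then have "(LBINT t:{0..}. exp_monomial s n t) = 0 - F 0"
      by (intro tendsto_unique[OF trivial_limit_at_top_linorder])
    then show ?thesis unfolding F(2) by simp
  qed
qed

lemma norm_LBINT_half_line_le:
  fixes f :: "real \<Rightarrow> complex"
  assumes meas: "set_borel_measurable lborel {0..} f" and a: "0 < a"
    and bd: "\<And>t. 0 \<le> t \<Longrightarrow> norm (f t) \<le> C * t ^ N * exp (- a * t)"
  shows "norm (LBINT t:{0..}. f t) \<le> C * fact N / a ^ (N + 1)"
proof -
  have int: "set_integrable lborel {0..} f" by (rule set_integrable_exp_bounded[OF assms])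
  have eq: "complex_of_real (t ^ N * exp (- a * t)) = exp (- (of_real a * of_real t)) * of_real t ^ N" for t
  proof -
    have "- (of_real a * of_real t) = complex_of_real (- a * t)" by simp
    then have "exp (- (of_real a * of_real t)) = complex_of_real (exp (- a * t))" by (simp only: exp_of_real)
    then show ?thesis by simp
  qed
  have "(LBINT t:{0..}. complex_of_real (t ^ N * exp (- a * t))) = fact N / of_real a ^ (N + 1)"
    unfolding eq by (rule LBINT_exp_monomial(2)) (use a in simp)
  then have "of_real (LBINT t:{0..}. t ^ N * exp (- a * t)) = complex_of_real (fact N / a ^ (N + 1))"
    unfolding set_integral_complex_of_real by simp
  then have val: "(LBINT t:{0..}. t ^ N * exp (- a * t)) = fact N / a ^ (N + 1)"
    by (simp only: of_real_eq_iff)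
  have "set_integrable lborel {0..} (\<lambda>t. complex_of_real (t ^ N * exp (- a * t)))"
    unfolding eq by (rule LBINT_exp_monomial(1)) (use a in simp)
  then have "set_integrable lborel {0..} (\<lambda>t. norm (complex_of_real (t ^ N * exp (- a * t))))"
    by (rule set_integrable_norm)
  moreover have "set_integrable lborel {0..} (\<lambda>t. norm (complex_of_real (t ^ N * exp (- a * t)))) \<longleftrightarrow>
      set_integrable lborel {0..} (\<lambda>t. t ^ N * exp (- a * t))"
    by (rule set_integrable_cong[OF refl refl]) (simp only: norm_of_real, simp)
  ultimately have rint: "set_integrable lborel {0..} (\<lambda>t. t ^ N * exp (- a * t))" by (rule iffD1[rotated])
  have "norm (LBINT t:{0..}. f t) \<le> (LBINT t:{0..}. norm (f t))"
    by (rule set_integral_norm_bound[OF int])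
  also have "\<dots> \<le> (LBINT t:{0..}. C * (t ^ N * exp (- a * t)))"
  proof (rule set_integral_mono)
    show "set_integrable lborel {0..} (\<lambda>t. norm (f t))" by (rule set_integrable_norm[OF int])
    show "set_integrable lborel {0..} (\<lambda>t. C * (t ^ N * exp (- a * t)))"
      by (rule set_integrable_mult_right) (rule rint)
    show "norm (f t) \<le> C * (t ^ N * exp (- a * t))" if "t \<in> {0..}" for t
      using bd[of t] that unfolding mult.assoc by simp
  qed
  also have "\<dots> = C * fact N / a ^ (N + 1)" by (simp only: set_integral_mult_right val times_divide_eq_right)
  finally show ?thesis .
qed

section \<open>Laplace transforms along rays\<close>

lemma open_half_plane [simp]: "open (half_plane \<theta> R)"
  unfolding half_plane_def by (intro open_Collect_less continuous_intros)

lemma convex_half_plane [simp]: "convex (half_plane \<theta> R)"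
proof -
  have "half_plane \<theta> R = {z. inner (cis (- \<theta>)) z > R}"
    by (auto simp: half_plane_def inner_complex_def algebra_simps)
  then show ?thesis by (simp add: convex_halfspace_gt)
qed

abbreviation laplace_integrand :: "real \<Rightarrow> (complex \<Rightarrow> complex) \<Rightarrow> complex \<Rightarrow> real \<Rightarrow> complex" where
  "laplace_integrand \<theta> g z t \<equiv> exp (- z * (of_real t * cis \<theta>)) * g (of_real t * cis \<theta>) * cis \<theta>"

lemma norm_laplace_integrand_le:
  assumes "\<And>t. 0 \<le> t \<Longrightarrow> norm (g (of_real t * cis \<theta>)) \<le> C * exp (R * t)" "0 \<le> t"
  shows "norm (laplace_integrand \<theta> g z t)
    \<le> C * exp (- (Re (z * cis \<theta>) - R) * t)"
proof -
  have "- z * (of_real t * cis \<theta>) = - (of_real t * (z * cis \<theta>))" by (simp add: mult_ac)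
  moreover have "Re (of_real t * (z * cis \<theta>)) = t * Re (z * cis \<theta>)" by (simp add: algebra_simps)
  ultimately have "norm (exp (- z * (of_real t * cis \<theta>))) = exp (- (t * Re (z * cis \<theta>)))"
    by (simp only: norm_exp_eq_Re uminus_complex.sel)
  then have "norm (laplace_integrand \<theta> g z t)
      = exp (- (t * Re (z * cis \<theta>))) * norm (g (of_real t * cis \<theta>))"
    by (simp only: norm_mult norm_cis mult_1_right)
  also have "\<dots> \<le> exp (- (t * Re (z * cis \<theta>))) * (C * exp (R * t))"
    using assms by (intro mult_left_mono) auto
  also have "\<dots> = C * exp (- (t * Re (z * cis \<theta>)) + R * t)" by (simp only: exp_add mult_ac)
  also have "- (t * x) + R * t = - (x - R) * t" for x by (simp add: algebra_simps)
  finally show ?thesis .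
qed

lemma laplace_integrand_measurable:
  assumes "continuous_on {0..} (\<lambda>t. g (of_real t * cis \<theta>))"
  shows "set_borel_measurable lborel {0..} (laplace_integrand \<theta> g z)"
  using assms by (intro set_borel_measurable_continuous_on continuous_intros) auto

lemma norm_LBINT_tail_le:
  fixes f :: "real \<Rightarrow> complex"
  assumes meas: "set_borel_measurable lborel {0..} f" and a: "0 < a" and C: "0 \<le> C" and T: "0 \<le> T"
    and bd: "\<And>t. 0 \<le> t \<Longrightarrow> norm (f t) \<le> C * exp (- a * t)"
  shows "norm ((LBINT t:{0..}. f t) - integral {0..T} f) \<le> C * exp (- (a/2) * T) * (2/a)"
proof -
  have int: "set_integrable lborel {0..} f"
    using bd by (intro set_integrable_exp_bounded[OF meas a, where N = 0]) simp
  have sub: "set_integrable lborel {0..T} f" "set_integrable lborel {T<..} f"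
    using T by (auto intro!: set_integrable_subset[OF int])
  have "{0..} = {0..T} \<union> {T<..}" using T by auto
  then have "(LBINT t:{0..}. f t) = (LBINT t:{0..T} \<union> {T<..}. f t)" by simp
  also have "\<dots> = (LBINT t:{0..T}. f t) + (LBINT t:{T<..}. f t)"
    by (rule set_integral_Un) (use sub in auto)
  also have "(LBINT t:{0..T}. f t) = integral {0..T} f"
    by (rule set_borel_integral_eq_integral(2)[OF sub(1)])
  finally have "(LBINT t:{0..}. f t) - integral {0..T} f = (LBINT t:{T<..}. f t)" by simp
  also have "\<dots> = (LBINT t:{0..}. indicator {T<..} t *\<^sub>R f t)"
    unfolding set_lebesgue_integral_def
    using T by (intro Bochner_Integration.integral_cong) (auto simp: indicator_def)
  also have "norm \<dots> \<le> C * exp (- (a/2) * T) * fact 0 / (a/2) ^ (0 + 1)"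
  proof (rule norm_LBINT_half_line_le)
    have "(\<lambda>t. indicator {T<..} t *\<^sub>R (indicator {0..} t *\<^sub>R f t)) \<in> borel_measurable lborel"
      using meas unfolding set_borel_measurable_def by measurable
    then show "set_borel_measurable lborel {0..} (\<lambda>t. indicator {T<..} t *\<^sub>R f t)"
      unfolding set_borel_measurable_def by (simp add: mult.commute)
    fix t :: real assume t: "0 \<le> t"
    show "norm (indicator {T<..} t *\<^sub>R f t) \<le> C * exp (- (a/2) * T) * t ^ 0 * exp (- (a/2) * t)"
    proof (cases "T < t")
      case True
      have "norm (f t) \<le> C * (exp (- (a/2) * t) * exp (- (a/2) * t))"
        using bd[OF t] by (simp add: exp_add[symmetric])
      also have "\<dots> \<le> C * (exp (- (a/2) * T) * exp (- (a/2) * t))"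
        using True a C by (intro mult_left_mono mult_right_mono) auto
      finally show ?thesis using True by (simp add: mult.assoc)
    qed (use C in simp)
  qed (use a in simp)
  finally show ?thesis using a by simp
qed

text \<open>The integrals over finite segments are holomorphic in \<open>z\<close> and converge uniformly on small discs, because
  the tail of the integral is exponentially small uniformly in \<open>z\<close>.\<close>

lemma laplace_holomorphic:
  assumes cont: "continuous_on {0..} (\<lambda>t. g (of_real t * cis \<theta>))"
    and bd: "\<And>t. 0 \<le> t \<Longrightarrow> norm (g (of_real t * cis \<theta>)) \<le> C * exp (R * t)"
  shows "laplace \<theta> g holomorphic_on half_plane \<theta> R"
proof (rule holomorphic_uniform_sequence)
  define h where "h z t = laplace_integrand \<theta> g z t" for z t
  have C: "0 \<le> C" using order_trans[OF norm_ge_zero bd[of 0]] by simp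
  show "open (half_plane \<theta> R)" by simp
  show "(\<lambda>z. integral (cbox 0 (real n)) (h z)) holomorphic_on half_plane \<theta> R" for n
  proof (rule leibniz_rule_holomorphic)
    fix z t assume "t \<in> cbox 0 (real n)"
    show "((\<lambda>z. h z t) has_field_derivative
        exp (- z * (of_real t * cis \<theta>)) * (- 1 * (of_real t * cis \<theta>)) * g (of_real t * cis \<theta>) * cis \<theta>)
        (at z within half_plane \<theta> R)"
      unfolding h_def
      by (rule has_field_derivative_at_within) (intro DERIV_cmult_right DERIV_fun_exp DERIV_minus DERIV_ident)
  next
    have ct: "continuous_on (cbox 0 (real n)) (\<lambda>t. g (of_real t * cis \<theta>))"
      by (rule continuous_on_subset[OF cont]) auto
    then show "h z integrable_on cbox 0 (real n)" for z
      unfolding h_def by (intro integrable_continuous continuous_intros)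
    have "continuous_on (half_plane \<theta> R \<times> cbox 0 (real n)) (\<lambda>x. g (of_real (snd x) * cis \<theta>))"
      by (rule continuous_on_compose2[OF cont, where f = snd]) (auto intro: continuous_on_snd continuous_on_id)
    then show "continuous_on (half_plane \<theta> R \<times> cbox 0 (real n))
      (\<lambda>(z, t). exp (- z * (of_real t * cis \<theta>)) * (- 1 * (of_real t * cis \<theta>)) * g (of_real t * cis \<theta>) * cis \<theta>)"
      unfolding case_prod_unfold by (intro continuous_intros)
  qed simp
  fix z0 assume z0: "z0 \<in> half_plane \<theta> R"
  define a where "a = (Re (z0 * cis \<theta>) - R) / 2"
  have a: "0 < a" using z0 by (simp add: a_def half_plane_def)
  have near: "a \<le> Re (z * cis \<theta>) - R" if "z \<in> cball z0 a" for z
  proof -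
    have "Re (z0 * cis \<theta>) - Re (z * cis \<theta>) \<le> norm ((z0 - z) * cis \<theta>)"
      using complex_Re_le_cmod[of "(z0 - z) * cis \<theta>"] by (simp only: left_diff_distrib minus_complex.sel)
    also have "\<dots> \<le> a" using that by (simp add: norm_mult dist_norm)
    finally show ?thesis by (simp add: a_def field_simps)
  qed
  have tail: "norm (laplace \<theta> g z - integral (cbox 0 (real n)) (h z)) \<le> C * exp (- (a/2) * real n) * (2/a)"
    if "z \<in> cball z0 a" for z n
  proof -
    have bdh: "norm (h z t) \<le> C * exp (- a * t)" if "0 \<le> t" for t
    proof -
      have "norm (h z t) \<le> C * exp (- (Re (z * cis \<theta>) - R) * t)"
        unfolding h_def by (rule norm_laplace_integrand_le[OF bd that])
      also have "\<dots> \<le> C * exp (- a * t)"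
      proof -
        have "- (Re (z * cis \<theta>) - R) * t \<le> - a * t"
          by (rule mult_right_mono) (use near[OF \<open>z \<in> cball z0 a\<close>] that in linarith)+
        then show ?thesis using C by (intro mult_left_mono) (simp_all only: exp_le_cancel_iff)
      qed
      finally show ?thesis .
    qed
    have "norm ((LBINT t:{0..}. h z t) - integral {0..real n} (h z)) \<le> C * exp (- (a/2) * real n) * (2/a)"
      by (rule norm_LBINT_tail_le[OF _ a C _ bdh])
        (use laplace_integrand_measurable[OF cont] in \<open>auto simp: h_def\<close>)
    then show ?thesis by (simp add: laplace_def h_def)
  qed
  have "((\<lambda>n. C * exp (- (a/2) * real n) * (2/a)) \<longlongrightarrow> 0) sequentially" using a by real_asymp
  then have ev: "\<forall>\<^sub>F n in sequentially. C * exp (- (a/2) * real n) * (2/a) < e" if "e > 0" for e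
    using that by (rule order_tendstoD(2))
  show "\<exists>d>0. cball z0 d \<subseteq> half_plane \<theta> R \<and>
      uniform_limit (cball z0 d) (\<lambda>n z. integral (cbox 0 (real n)) (h z)) (laplace \<theta> g) sequentially"
  proof (intro exI conjI)
    show "0 < a" by (rule a)
    show "cball z0 a \<subseteq> half_plane \<theta> R" using near a by (force simp: half_plane_def)
    show "uniform_limit (cball z0 a) (\<lambda>n z. integral (cbox 0 (real n)) (h z)) (laplace \<theta> g) sequentially"
    proof (rule uniform_limitI)
      fix e :: real assume "e > 0"
      from ev[OF this] show "\<forall>\<^sub>F n in sequentially. \<forall>z\<in>cball z0 a. dist (integral (cbox 0 (real n)) (h z)) (laplace \<theta> g z) < e"
      proof (eventually_elim, intro ballI)
        fix n z assume n: "C * exp (- (a/2) * real n) * (2/a) < e" and z: "z \<in> cball z0 a"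
        show "dist (integral (cbox 0 (real n)) (h z)) (laplace \<theta> g z) < e"
          unfolding dist_norm norm_minus_commute[of "integral _ _"]
          by (rule le_less_trans[OF tail[OF z] n])
      qed
    qed
  qed
qed

text \<open>The integrand has a primitive \<open>P\<close> on the closed cone of half-opening \<open>\<delta>\<close>, since that cone is convex. The integrals up to
  distance \<open>T\<close> in the two directions differ by \<open>P (T cis \<theta>1) - P (T cis \<theta>2)\<close>, which is estimated along the
  chord between these points. On the chord \<open>Re (z w)\<close> is a convex combination of its values at the ends, so that the
  integrand is exponentially small there, while the chord has length at most \<open>2 T\<close>.\<close>

lemma laplace_rotate:
  assumes \<delta>: "0 < \<delta>" "\<delta> < pi/2" and an: "g analytic_on {w. 0 < Re w} \<union> {0}"
    and bd: "\<And>\<theta> t. \<bar>\<theta>\<bar> \<le> \<delta> \<Longrightarrow> 0 \<le> t \<Longrightarrow> norm (g (of_real t * cis \<theta>)) \<le> C * exp (R * t)"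
    and R: "0 \<le> R" and \<theta>: "\<bar>\<theta>1\<bar> \<le> \<delta>" "\<bar>\<theta>2\<bar> \<le> \<delta>"
    and z: "z \<in> half_plane \<theta>1 R" "z \<in> half_plane \<theta>2 R"
  shows "laplace \<theta>1 g z = laplace \<theta>2 g z"
proof -
  define K where "K = {w. cos \<delta> * norm w \<le> Re w}"
  have cos\<delta>: "0 < cos \<delta>" using \<delta> by (intro cos_gt_zero_pi) auto
  have C: "0 \<le> C" using order_trans[OF norm_ge_zero bd[OF \<theta>(1), of 0]] by simp
  have K_sub: "K \<subseteq> {w. 0 < Re w} \<union> {0}"
  proof
    fix w assume "w \<in> K"
    then show "w \<in> {w. 0 < Re w} \<union> {0}"
      using cos\<delta> by (cases "w = 0") (auto simp: K_def intro: less_le_trans[of 0 "cos \<delta> * norm w"])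
  qed
  have gK: "g analytic_on K" by (rule analytic_on_subset[OF an K_sub])
  have convK: "convex K"
  proof (rule convexI)
    fix x y u v assume xy: "x \<in> K" "y \<in> K" and uv: "0 \<le> u" "0 \<le> v" "u + v = (1::real)"
    have "cos \<delta> * norm (u *\<^sub>R x + v *\<^sub>R y) \<le> cos \<delta> * (u * norm x + v * norm y)"
      using norm_triangle_ineq[of "u *\<^sub>R x" "v *\<^sub>R y"] uv cos\<delta> by (intro mult_left_mono) auto
    also have "\<dots> = u * (cos \<delta> * norm x) + v * (cos \<delta> * norm y)" by (simp add: algebra_simps)
    also have "\<dots> \<le> u * Re x + v * Re y"
      using xy uv by (intro add_mono mult_left_mono) (auto simp: K_def)
    finally show "u *\<^sub>R x + v *\<^sub>R y \<in> K" by (simp add: K_def)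
  qed
  have ray: "of_real t * cis \<theta> \<in> K" if "0 \<le> t" "\<bar>\<theta>\<bar> \<le> \<delta>" for t \<theta>
  proof -
    have "cos \<delta> \<le> cos \<bar>\<theta>\<bar>" using that \<delta> by (intro cos_monotone_0_pi_le) auto
    then have "cos \<delta> * t \<le> cos \<theta> * t" using that by (intro mult_right_mono) simp_all
    then show ?thesis using that by (simp add: K_def norm_mult mult.commute)
  qed
  have bdK: "norm (g w) \<le> C * exp (R * norm w)" if w: "w \<in> K" for w
  proof (cases "w = 0")
    case True
    then show ?thesis using bd[OF \<theta>(1), of 0] by simp
  next
    case False
    have "cos \<delta> * norm w \<le> cos (Arg w) * norm w"
      using w by (simp add: K_def Re_eq_norm_mult_cos_Arg mult.commute)
    then have *: "cos \<delta> \<le> cos \<bar>Arg w\<bar>" using False by simp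
    have "\<bar>Arg w\<bar> \<le> \<delta>"
    proof (rule ccontr)
      assume "\<not> \<bar>Arg w\<bar> \<le> \<delta>"
      then have "cos \<bar>Arg w\<bar> < cos \<delta>"
        using Arg_bounded[of w] \<delta> by (intro cos_monotone_0_pi) auto
      with * show False by simp
    qed
    from bd[OF this norm_ge_zero[of w]] show ?thesis
      using rcis_cmod_Arg[of w] by (simp add: rcis_def)
  qed
  define f where "f w = exp (- z * w) * g w" for w
  have fK: "f analytic_on K"
    unfolding f_def by (intro analytic_intros gK) 
  obtain P where P: "\<And>w. w \<in> K \<Longrightarrow> (P has_field_derivative f w) (at w within K)"
  proof (rule holomorphic_convex_primitive[OF convK finite.emptyI])
    show "continuous_on K f" using fK by (intro holomorphic_on_imp_continuous_on analytic_imp_holomorphic)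
    show "f field_differentiable at x" if "x \<in> interior K - {}" for x
      using that fK interior_subset[of K] analytic_on_imp_differentiable_at by blast
  qed blast
  have lim: "((\<lambda>T. P (of_real T * cis \<theta>) - P 0) \<longlongrightarrow> laplace \<theta> g z) at_top"
    if \<theta>: "\<bar>\<theta>\<bar> \<le> \<delta>" and z: "z \<in> half_plane \<theta> R" for \<theta>
  proof -
    let ?h = "laplace_integrand \<theta> g z"
    have "continuous_on {0..} (\<lambda>t. g (of_real t * cis \<theta>))"
      by (rule continuous_on_compose2[OF holomorphic_on_imp_continuous_on[OF analytic_imp_holomorphic[OF gK]]])
         (auto intro!: continuous_intros ray \<theta>)
    note meas = laplace_integrand_measurable[OF this]
    have "set_integrable lborel {0..} ?h"
      using norm_laplace_integrand_le[OF bd[OF \<theta>]] z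
      by (intro set_integrable_exp_bounded[OF meas, where a = "Re (z * cis \<theta>) - R" and C = C and N = 0]) (auto simp: half_plane_def)
    moreover have "((\<lambda>t. P (of_real t * cis \<theta>)) has_vector_derivative ?h t) (at t within {0..})" if "0 \<le> t" for t
    proof -
      have "((\<lambda>t. complex_of_real t * cis \<theta>) has_vector_derivative of_real 1 * cis \<theta>) (at t within {0..})"
        by (rule has_vector_derivative_mult_left[OF has_vector_derivative_of_real[OF DERIV_ident]])
      then have "((\<lambda>t. of_real t * cis \<theta>) has_vector_derivative cis \<theta>) (at t within {0..})" by simp
      moreover have "(P has_field_derivative f (of_real t * cis \<theta>)) (at (of_real t * cis \<theta>) within (\<lambda>t. of_real t * cis \<theta>) ` {0..})"
        using P[OF ray[OF that \<theta>]] by (rule has_field_derivative_subset) (auto intro: ray \<theta>)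
      ultimately have "((P \<circ> (\<lambda>t. of_real t * cis \<theta>)) has_vector_derivative cis \<theta> * f (of_real t * cis \<theta>)) (at t within {0..})"
        by (rule field_vector_diff_chain_within)
      then show ?thesis by (simp add: o_def f_def mult_ac)
    qed
    ultimately have "((\<lambda>T. P (of_real T * cis \<theta>) - P (of_real 0 * cis \<theta>)) \<longlongrightarrow> (LBINT t:{0..}. ?h t)) at_top"
      by (rule LBINT_half_line_FTC)
    then show ?thesis by (simp add: laplace_def)
  qed
  define m where "m = min (Re (z * cis \<theta>1)) (Re (z * cis \<theta>2))"
  have m: "R < m" using z by (simp add: m_def half_plane_def)
  have chord: "norm (P (of_real T * cis \<theta>1) - P (of_real T * cis \<theta>2)) \<le> C * exp (- (m - R) * T) * (2 * T)"
    if T: "0 \<le> T" for T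
  proof -
    let ?a = "of_real T * cis \<theta>1" and ?b = "of_real T * cis \<theta>2"
    have ab: "?a \<in> K" "?b \<in> K" using ray T \<theta> by auto
    have seg: "closed_segment ?a ?b \<subseteq> K" using convK ab by (simp add: closed_segment_subset)
    have "norm (P ?a - P ?b) \<le> C * exp (- (m - R) * T) * norm (?a - ?b)"
    proof (rule field_differentiable_bound[of "closed_segment ?a ?b" P f])
      fix w assume w: "w \<in> closed_segment ?a ?b"
      show "(P has_field_derivative f w) (at w within closed_segment ?a ?b)"
        using P w seg by (meson has_field_derivative_subset subsetD)
      obtain u where u: "0 \<le> u" "u \<le> 1" "w = (1 - u) *\<^sub>R ?a + u *\<^sub>R ?b"
        using w by (auto simp: in_segment)
      have "norm w \<le> (1 - u) * T + u * T"
        using norm_triangle_ineq[of "(1 - u) *\<^sub>R ?a" "u *\<^sub>R ?b"] u T by (simp add: norm_mult)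
      then have nw: "norm w \<le> T" by (simp add: algebra_simps)
      have "m * T = (1 - u) * (m * T) + u * (m * T)" by (simp add: algebra_simps)
      also have "\<dots> \<le> (1 - u) * (Re (z * cis \<theta>1) * T) + u * (Re (z * cis \<theta>2) * T)"
        using u T by (intro add_mono mult_left_mono mult_right_mono) (auto simp: m_def)
      also have "\<dots> = Re (z * w)"
        unfolding u(3) by (simp add: algebra_simps)
      finally have zw: "m * T \<le> Re (z * w)" .
      have "norm (f w) = exp (- Re (z * w)) * norm (g w)"
        by (simp only: f_def norm_mult norm_exp_eq_Re mult_minus_left uminus_complex.sel)
      also have "\<dots> \<le> exp (- (m * T)) * (C * exp (R * T))"
      proof (rule mult_mono)
        have "norm (g w) \<le> C * exp (R * norm w)" using bdK w seg by blast
        also have "\<dots> \<le> C * exp (R * T)"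
          using nw R C by (intro mult_left_mono) (auto intro: mult_left_mono)
        finally show "norm (g w) \<le> C * exp (R * T)" .
      qed (use zw C in auto)
      also have "\<dots> = C * exp (- (m * T) + R * T)" by (simp only: exp_add mult_ac)
      also have "- (m * T) + R * T = - (m - R) * T" by (simp add: algebra_simps)
      finally show "norm (f w) \<le> C * exp (- (m - R) * T)" .
    qed auto
    also have "\<dots> \<le> C * exp (- (m - R) * T) * (2 * T)"
      using norm_triangle_ineq4[of ?a ?b] T C by (intro mult_left_mono) (auto simp: norm_mult)
    finally show ?thesis .
  qed
  have "((\<lambda>T. (P (of_real T * cis \<theta>1) - P 0) - (P (of_real T * cis \<theta>2) - P 0)) \<longlongrightarrow> laplace \<theta>1 g z - laplace \<theta>2 g z) at_top"
    by (rule tendsto_diff[OF lim[OF \<theta>(1) z(1)] lim[OF \<theta>(2) z(2)]])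
  moreover have "((\<lambda>T. (P (of_real T * cis \<theta>1) - P 0) - (P (of_real T * cis \<theta>2) - P 0)) \<longlongrightarrow> 0) at_top"
  proof (rule Lim_null_comparison)
    show "\<forall>\<^sub>F T in at_top. norm ((P (of_real T * cis \<theta>1) - P 0) - (P (of_real T * cis \<theta>2) - P 0)) \<le> C * exp (- (m - R) * T) * (2 * T)"
      using eventually_ge_at_top[of 0] by eventually_elim (use chord in simp)
    define k where "k = m - R"
    have "0 < k" using m by (simp add: k_def)
    then show "((\<lambda>T. C * exp (- (m - R) * T) * (2 * T)) \<longlongrightarrow> 0) at_top"
      unfolding k_def[symmetric] by real_asymp
  qed
  ultimately have "laplace \<theta>1 g z - laplace \<theta>2 g z = 0"
    by (intro tendsto_unique[OF trivial_limit_at_top_linorder])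
  then show ?thesis by simp
qed

section \<open>Borel sums\<close>

text \<open>The best direction is \<open>- Arg z\<close>, clipped to the allowed interval of directions; what remains of the argument of
  \<open>z cis \<theta>\<close> is at most \<open>\<pi>/2 - (\<beta> - \<delta>)\<close>.\<close>

lemma exists_direction_of_decay:
  assumes \<delta>: "0 < \<delta>" "\<delta> < \<beta>" "\<beta> < pi/2" and R: "0 \<le> R" and z: "z \<in> sector 1 R \<delta>"
  shows "\<exists>\<theta>\<in>I_plus \<beta>. sin (\<beta> - \<delta>) * norm z \<le> Re (z * cis \<theta>)"
proof -
  define \<alpha> where "\<alpha> = Arg z"
  have \<alpha>: "\<bar>\<alpha>\<bar> < pi/2 + \<delta>" unfolding \<alpha>_def using abs_Arg_less_of_sector[OF R _ _ z] \<delta> by simp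
  define \<theta> where "\<theta> = (if \<alpha> < - \<beta> then \<beta> else if \<beta> < \<alpha> then - \<beta> else - \<alpha>)"
  have \<theta>: "\<theta> \<in> I_plus \<beta>" "\<bar>\<alpha> + \<theta>\<bar> \<le> pi/2 - (\<beta> - \<delta>)"
    using \<alpha> \<delta> by (auto simp: \<theta>_def I_plus_def abs_less_iff abs_le_iff)
  have "cos (pi/2 - (\<beta> - \<delta>)) \<le> cos \<bar>\<alpha> + \<theta>\<bar>"
    using \<theta>(2) \<delta> by (intro cos_monotone_0_pi_le) auto
  then have "sin (\<beta> - \<delta>) \<le> cos (\<alpha> + \<theta>)" 
    by (simp only: cos_abs_real cos_diff cos_pi_half sin_pi_half mult_zero_left mult_1_left add_0)
  then have "sin (\<beta> - \<delta>) * norm z \<le> cos (\<alpha> + \<theta>) * norm z" by (rule mult_right_mono) simp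
  also have "\<dots> = Re (rcis (norm z) \<alpha> * cis \<theta>)" by (simp add: cos_add algebra_simps)
  also have "rcis (norm z) \<alpha> = z" by (simp add: \<alpha>_def rcis_cmod_Arg)
  finally show ?thesis using \<theta>(1) by blast
qed

text \<open>The hypotheses on the Borel transform that concern the directions around the positive real axis. The other
  side is reduced to this one by the reflection \<open>\<zeta> \<mapsto> - \<zeta>\<close>.\<close>

locale borel_summable =
  fixes g :: "complex \<Rightarrow> complex" and R0 :: "real \<Rightarrow> real"
  assumes analytic: "g analytic_on {w. 0 < Re w} \<union> {0}"
    and growth: "\<And>\<beta>. 0 < \<beta> \<Longrightarrow> \<beta> < pi/2 \<Longrightarrow> R0 \<beta> > 0 \<and>
      (\<exists>C>0. \<forall>\<theta>\<in>I_plus \<beta>. \<forall>t\<ge>0. norm (g (of_real t * cis \<theta>)) \<le> C * exp (R0 \<beta> * t))"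
begin

lemma continuous_on_ray:
  assumes "\<bar>\<theta>\<bar> < pi/2"
  shows "continuous_on {0..} (\<lambda>t. g (of_real t * cis \<theta>))"
proof (rule continuous_on_compose2[OF holomorphic_on_imp_continuous_on[OF analytic_imp_holomorphic[OF analytic]]])
  show "continuous_on {0..} (\<lambda>t. of_real t * cis \<theta>)" by (intro continuous_intros)
  have "0 < cos \<theta>" using assms by (intro cos_gt_zero_pi) auto
  then show "(\<lambda>t. of_real t * cis \<theta>) ` {0..} \<subseteq> {w. 0 < Re w} \<union> {0}" by (auto simp: less_le)
qed

lemma laplace_holomorphic_on_half_plane:
  assumes "0 < \<beta>" "\<beta> < pi/2" "\<theta> \<in> I_plus \<beta>"
  shows "laplace \<theta> g holomorphic_on half_plane \<theta> (R0 \<beta>)"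
proof -
  obtain C where "\<And>t. 0 \<le> t \<Longrightarrow> norm (g (of_real t * cis \<theta>)) \<le> C * exp (R0 \<beta> * t)"
    using growth[OF assms(1,2)] assms(3) by blast
  then show ?thesis
    using assms by (intro laplace_holomorphic continuous_on_ray) (auto simp: I_plus_def)
qed

text \<open>Different \<open>\<delta>1\<close> and \<open>\<delta>2\<close> come with unrelated growth rates \<open>R0 \<delta>1\<close> and \<open>R0 \<delta>2\<close>, so that rotation applies
  directly only where \<open>z\<close> is also in the half-planes given by the rate of the larger angle. These points form a
  nonempty open part of the convex intersection of the original half-planes, and the identity theorem does the rest.\<close>

lemma laplace_agree:
  assumes \<delta>1: "0 < \<delta>1" "\<delta>1 < pi/2" "\<theta>1 \<in> I_plus \<delta>1" "z \<in> half_plane \<theta>1 (R0 \<delta>1)"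
    and \<delta>2: "0 < \<delta>2" "\<delta>2 < pi/2" "\<theta>2 \<in> I_plus \<delta>2" "z \<in> half_plane \<theta>2 (R0 \<delta>2)"
  shows "laplace \<theta>1 g z = laplace \<theta>2 g z"
proof -
  define \<delta> where "\<delta> = max \<delta>1 \<delta>2"
  have \<delta>: "0 < \<delta>" "\<delta> < pi/2" using \<delta>1 \<delta>2 by (auto simp: \<delta>_def)
  have \<theta>: "\<bar>\<theta>1\<bar> \<le> \<delta>" "\<bar>\<theta>2\<bar> \<le> \<delta>" using \<delta>1 \<delta>2 by (auto simp: \<delta>_def I_plus_def)
  obtain C where C: "0 < R0 \<delta>" "\<And>\<theta> t. \<theta> \<in> I_plus \<delta> \<Longrightarrow> 0 \<le> t \<Longrightarrow> norm (g (of_real t * cis \<theta>)) \<le> C * exp (R0 \<delta> * t)"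
    using growth[OF \<delta>] by blast
  define D where "D = half_plane \<theta>1 (R0 \<delta>1) \<inter> half_plane \<theta>2 (R0 \<delta>2)"
  define s where "s = D \<inter> (half_plane \<theta>1 (R0 \<delta>) \<inter> half_plane \<theta>2 (R0 \<delta>))"
  show ?thesis
  proof (rule analytic_continuation_open[of s D "laplace \<theta>1 g" "laplace \<theta>2 g"])
    show "open s" "open D" "s \<subseteq> D" by (auto simp: s_def D_def intro!: open_Int)
    show "connected D" unfolding D_def by (intro convex_connected convex_Int) auto
    show "z \<in> D" using \<delta>1 \<delta>2 by (simp add: D_def)
    show "laplace \<theta>1 g holomorphic_on D" "laplace \<theta>2 g holomorphic_on D"
      using laplace_holomorphic_on_half_plane[OF \<delta>1(1-3)] laplace_holomorphic_on_half_plane[OF \<delta>2(1-3)]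
      by (auto simp: D_def intro: holomorphic_on_subset)
    show "laplace \<theta>1 g w = laplace \<theta>2 g w" if "w \<in> s" for w
    proof (rule laplace_rotate[OF \<delta> analytic _ _ \<theta>])
      show "norm (g (of_real t * cis \<theta>)) \<le> C * exp (R0 \<delta> * t)" if "\<bar>\<theta>\<bar> \<le> \<delta>" "0 \<le> t" for \<theta> t
        by (rule C(2)) (use that in \<open>auto simp: I_plus_def abs_le_iff\<close>)
    qed (use that C(1) in \<open>auto simp: s_def\<close>)
    define c where "c = min (cos \<theta>1) (cos \<theta>2)"
    define M where "M = max (R0 \<delta>) (max (R0 \<delta>1) (R0 \<delta>2))"
    have "0 < cos \<theta>1" "0 < cos \<theta>2" using \<theta> \<delta> by (auto intro!: cos_gt_zero_pi)
    then have c: "0 < c" by (simp add: c_def)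
    have M: "0 < M" using C(1) by (simp add: M_def)
    have "M < (M + 1) / c * cos \<theta>" if "c \<le> cos \<theta>" for \<theta>
    proof -
      have "M < (M + 1) / c * c" using c by simp
      also have "\<dots> \<le> (M + 1) / c * cos \<theta>" using that c M by (intro mult_left_mono) auto
      finally show ?thesis .
    qed
    then have "M < (M + 1) / c * cos \<theta>1" "M < (M + 1) / c * cos \<theta>2" by (simp_all add: c_def)
    \<comment> \<open>Every direction has positive cosine, so all the half-planes contain the large positive reals.\<close>
    then have "of_real ((M + 1) / c) \<in> s"
      unfolding s_def D_def half_plane_def by (auto simp: M_def)
    then show "s \<noteq> {}" by blast
  qed
qed

lemma L_plus_eq_laplace:
  assumes "0 < \<beta>" "\<beta> < pi/2" "\<theta> \<in> I_plus \<beta>" "z \<in> half_plane \<theta> (R0 \<beta>)"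
  shows "L_plus R0 g z = laplace \<theta> g z"
  unfolding laplace_sum_def
proof (rule the_equality)
  show "\<exists>\<beta>\<in>{0<..<pi/2}. \<exists>\<theta>'\<in>I_plus \<beta>. z \<in> half_plane \<theta>' (R0 \<beta>) \<and> laplace \<theta> g z = laplace \<theta>' g z"
    using assms by (intro bexI[of _ \<beta>] bexI[of _ \<theta>]) auto
  fix w assume "\<exists>\<beta>\<in>{0<..<pi/2}. \<exists>\<theta>\<in>I_plus \<beta>. z \<in> half_plane \<theta> (R0 \<beta>) \<and> w = laplace \<theta> g z"
  then obtain \<delta>' \<theta>' where "0 < \<delta>'" "\<delta>' < pi/2" "\<theta>' \<in> I_plus \<delta>'" "z \<in> half_plane \<theta>' (R0 \<delta>')" "w = laplace \<theta>' g z"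
    by auto
  then show "w = laplace \<theta> g z" using laplace_agree[OF _ _ _ _ assms] by blast
qed

lemma L_plus_holomorphic: "L_plus R0 g holomorphic_on U_plus R0"
  unfolding sum_domain_def
proof (intro holomorphic_on_UN_open)
  fix \<beta> \<theta> assume *: "\<beta> \<in> {0<..<pi/2}" "\<theta> \<in> I_plus \<beta>"
  then have "laplace \<theta> g holomorphic_on half_plane \<theta> (R0 \<beta>)"
    by (intro laplace_holomorphic_on_half_plane) auto
  then show "L_plus R0 g holomorphic_on half_plane \<theta> (R0 \<beta>)"
    by (rule holomorphic_transform) (use * L_plus_eq_laplace in auto)
qed auto

lemma sector_subset_U_plus:
  assumes "0 < \<delta>" "\<delta> < \<beta>" "\<beta> < pi/2" "0 \<le> R" "R0 \<beta> / sin (\<beta> - \<delta>) \<le> R"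
  shows "sector 1 R \<delta> \<subseteq> U_plus R0"
proof
  fix z assume z: "z \<in> sector 1 R \<delta>"
  obtain \<theta> where \<theta>: "\<theta> \<in> I_plus \<beta>" "sin (\<beta> - \<delta>) * norm z \<le> Re (z * cis \<theta>)"
    using exists_direction_of_decay[OF assms(1-4) z] by blast
  have "0 < sin (\<beta> - \<delta>)" using assms by (intro sin_gt_zero) auto
  moreover have "R0 \<beta> / sin (\<beta> - \<delta>) < norm z" using assms(5) z by (simp add: sector_def)
  ultimately have "R0 \<beta> < sin (\<beta> - \<delta>) * norm z" by (simp add: pos_divide_less_eq mult.commute)
  then have "z \<in> half_plane \<theta> (R0 \<beta>)" using \<theta>(2) by (simp only: half_plane_def mem_Collect_eq)
  then show "z \<in> U_plus R0" using \<theta>(1) assms unfolding sum_domain_def by auto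
qed

text \<open>Near \<open>0\<close> this is the Cauchy estimate for the Taylor remainder. Beyond half the radius \<open>r\<close> of a disc of
  holomorphy the ratio \<open>q = 2t/r\<close> is at least \<open>1\<close>, so \<open>g\<close> and its Taylor polynomial separately are at most a constant
  times \<open>q\<^sup>N\<close> and the exponential.\<close>

lemma Taylor_remainder_on_rays:
  assumes exp: "g has_fps_expansion A" and \<beta>: "0 < \<beta>" "\<beta> < pi/2"
  obtains K b where "0 < K" "0 < b"
    "\<And>N \<theta> t. \<theta> \<in> I_plus \<beta> \<Longrightarrow> 0 \<le> t \<Longrightarrow>
      norm (g (of_real t * cis \<theta>) - (\<Sum>n<N. fps_nth A n * (of_real t * cis \<theta>) ^ n)) \<le> K * b ^ N * t ^ N * exp (R0 \<beta> * t)"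
proof -
  obtain C where C: "0 < R0 \<beta>" "0 < C"
    "\<And>\<theta> t. \<theta> \<in> I_plus \<beta> \<Longrightarrow> 0 \<le> t \<Longrightarrow> norm (g (of_real t * cis \<theta>)) \<le> C * exp (R0 \<beta> * t)"
    using growth[OF \<beta>] by blast
  obtain s where s: "open s" "0 \<in> s" "g holomorphic_on s"
    using has_fps_expansion_imp_holomorphic[OF exp] by blast
  obtain r where r: "0 < r" "cball 0 r \<subseteq> s" using s by (meson open_contains_cball)
  have hol: "g holomorphic_on cball 0 r" using s(3) r(2) by (rule holomorphic_on_subset)
  have "bounded (g ` cball 0 r)"
    by (intro compact_imp_bounded compact_continuous_image holomorphic_on_imp_continuous_on hol compact_cball)
  then obtain K where K: "0 < K" "\<And>u. norm u \<le> r \<Longrightarrow> norm (g u) \<le> K"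
    unfolding bounded_pos by (auto simp: image_iff)
  show thesis
  proof (rule that[of "2 * K + C" "2 / r"])
    show "0 < 2 * K + C" "0 < 2 / r" using K C r by auto
    fix N \<theta> t assume \<theta>: "\<theta> \<in> I_plus \<beta>" and t: "(0::real) \<le> t"
    define u where "u = of_real t * cis \<theta>"
    have u: "norm u = t" using t by (simp add: u_def norm_mult)
    define q where "q = 2 * t / r"
    have q: "0 \<le> q" using t r by (simp add: q_def)
    have e1: "1 \<le> exp (R0 \<beta> * t)" using C(1) t by simp
    have "norm (g u - (\<Sum>n<N. fps_nth A n * u ^ n)) \<le> (2 * K + C) * q ^ N * exp (R0 \<beta> * t)"
    proof (cases "t \<le> r/2")
      case True
      have "norm (g u - (\<Sum>n<N. fps_nth A n * u ^ n)) \<le> 2 * K * (t / r) ^ N"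
        using norm_Taylor_remainder_le[OF exp hol r(1) K(2), of u N] u True by simp
      also have "\<dots> \<le> 2 * K * q ^ N"
        using K(1) t r by (intro mult_left_mono power_mono) (auto simp: q_def field_simps)
      also have "\<dots> \<le> (2 * K + C) * q ^ N" using C(2) q by (intro mult_right_mono) auto
      also have "\<dots> \<le> (2 * K + C) * q ^ N * exp (R0 \<beta> * t)"
        using mult_left_mono[OF e1, of "(2 * K + C) * q ^ N"] K(1) C(2) q by simp
      finally show ?thesis .
    next
      case False
      then have q1: "1 \<le> q" using r by (simp add: q_def field_simps)
      have "norm (g u) \<le> C * exp (R0 \<beta> * t)" unfolding u_def by (rule C(3)[OF \<theta> t])
      also have "\<dots> \<le> C * (q ^ N * exp (R0 \<beta> * t))"
        using C(2) q1 by (intro mult_left_mono) (auto simp: one_le_power)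
      finally have 1: "norm (g u) \<le> C * q ^ N * exp (R0 \<beta> * t)" by (simp only: mult.assoc)
      have "norm (\<Sum>n<N. fps_nth A n * u ^ n) \<le> (\<Sum>n<N. K * q ^ N * (1/2) ^ n)"
      proof (rule sum_norm_le)
        fix n assume n: "n \<in> {..<N}"
        have "norm (fps_nth A n * u ^ n) \<le> K / r ^ n * t ^ n"
          unfolding norm_mult norm_power u
          using t by (intro mult_right_mono norm_fps_nth_le[OF exp hol r(1) K(2)]) auto
        also have "\<dots> = K * q ^ n * (1/2) ^ n" using r by (simp add: q_def power_divide power_mult_distrib)
        also have "\<dots> \<le> K * q ^ N * (1/2) ^ n"
          using n q1 K by (intro mult_right_mono mult_left_mono power_increasing) auto
        finally show "norm (fps_nth A n * u ^ n) \<le> K * q ^ N * (1/2) ^ n" .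
      qed
      also have "\<dots> = K * q ^ N * (\<Sum>n<N. (1/2) ^ n)" by (simp add: sum_distrib_left)
      also have "(\<Sum>n<N. (1/2::real) ^ n) \<le> 2"
        using sum_gp_strict[of "1/2::real" N] by simp
      then have "K * q ^ N * (\<Sum>n<N. (1/2) ^ n) \<le> K * q ^ N * 2"
        using K q by (intro mult_left_mono) auto
      also have "\<dots> \<le> K * q ^ N * 2 * exp (R0 \<beta> * t)"
        using mult_left_mono[OF e1, of "K * q ^ N * 2"] K q by simp
      finally have 2: "norm (\<Sum>n<N. fps_nth A n * u ^ n) \<le> K * q ^ N * 2 * exp (R0 \<beta> * t)" .
      have "norm (g u - (\<Sum>n<N. fps_nth A n * u ^ n)) \<le> C * q ^ N * exp (R0 \<beta> * t) + K * q ^ N * 2 * exp (R0 \<beta> * t)"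
        by (rule order_trans[OF norm_triangle_ineq4 add_mono[OF 1 2]])
      also have "\<dots> = (2 * K + C) * q ^ N * exp (R0 \<beta> * t)" by (simp add: algebra_simps)
      finally show ?thesis .
    qed
    also have "(2 * K + C) * q ^ N * exp (R0 \<beta> * t) = (2 * K + C) * (2 / r) ^ N * t ^ N * exp (R0 \<beta> * t)"
      by (simp add: q_def power_mult_distrib power_divide)
    finally show "norm (g (of_real t * cis \<theta>) - (\<Sum>n<N. fps_nth A n * (of_real t * cis \<theta>) ^ n)) \<le>
        (2 * K + C) * (2 / r) ^ N * t ^ N * exp (R0 \<beta> * t)" by (simp only: u_def)
  qed
qed

lemma laplace_monomial:
  assumes "0 < Re (z * cis \<theta>)"
  shows "set_integrable lborel {0..} (\<lambda>t. exp (- z * (of_real t * cis \<theta>)) * (of_real t * cis \<theta>) ^ n * cis \<theta>)"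
    and "(LBINT t:{0..}. exp (- z * (of_real t * cis \<theta>)) * (of_real t * cis \<theta>) ^ n * cis \<theta>) = fact n / z ^ (n + 1)"
proof -
  have eq: "exp (- z * (of_real t * cis \<theta>)) * (of_real t * cis \<theta>) ^ n * cis \<theta> =
      cis \<theta> ^ (n + 1) * (exp (- ((z * cis \<theta>) * of_real t)) * of_real t ^ n)" for t
  proof -
    have "- z * (of_real t * cis \<theta>) = - ((z * cis \<theta>) * of_real t)" by (simp add: mult_ac)
    then show ?thesis by (simp add: power_mult_distrib mult_ac)
  qed
  show "set_integrable lborel {0..} (\<lambda>t. exp (- z * (of_real t * cis \<theta>)) * (of_real t * cis \<theta>) ^ n * cis \<theta>)"
    unfolding eq by (rule set_integrable_mult_right) (rule LBINT_exp_monomial(1)[OF assms])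
  show "(LBINT t:{0..}. exp (- z * (of_real t * cis \<theta>)) * (of_real t * cis \<theta>) ^ n * cis \<theta>) = fact n / z ^ (n + 1)"
    unfolding eq set_integral_mult_right LBINT_exp_monomial(2)[OF assms]
    by (simp only: power_mult_distrib) simp
qed

text \<open>The Laplace transform of the Taylor polynomial of \<open>g\<close> is the truncated series, and the factor \<open>N!\<close> is the Laplace
  integral of the \<open>t\<^sup>N\<close> in the bound of the Taylor remainder. Every point of the sector has a direction in which the decay rate
  is at least \<open>\<kappa> norm z\<close>; \<open>R\<close> is so large that half of it compensates the growth rate \<open>R0 \<beta>\<close>.\<close>

lemma L_plus_gevrey:
  assumes exp: "g has_fps_expansion borel_transform \<phi>" and \<delta>: "0 < \<delta>" "\<delta> < pi/2"
  shows "\<exists>R>0. sector 1 R \<delta> \<subseteq> U_plus R0 \<and> gevrey_asymptotic (L_plus R0 g) \<phi> (sector 1 R \<delta>)"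
proof -
  define \<beta> where "\<beta> = (\<delta> + pi/2) / 2"
  have \<beta>: "0 < \<beta>" "\<delta> < \<beta>" "\<beta> < pi/2" using \<delta> by (auto simp: \<beta>_def)
  define \<kappa> where "\<kappa> = sin (\<beta> - \<delta>)"
  have \<kappa>: "0 < \<kappa>" unfolding \<kappa>_def using \<beta> \<delta> by (intro sin_gt_zero) auto
  have R0: "0 < R0 \<beta>" using growth[OF \<beta>(1,3)] by blast
  define R where "R = 2 * R0 \<beta> / \<kappa>"
  have R: "0 < R" using R0 \<kappa> by (simp add: R_def)
  have R': "R0 \<beta> / sin (\<beta> - \<delta>) \<le> R" unfolding R_def \<kappa>_def[symmetric] using R0 \<kappa> by (simp add: field_simps)
  have sub: "sector 1 R \<delta> \<subseteq> U_plus R0"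
    by (rule sector_subset_U_plus[OF \<delta>(1) \<beta>(2,3) less_imp_le[OF R] R'])
  obtain K b where Kb: "0 < K" "0 < b" and
    rem: "\<And>N \<theta> t. \<theta> \<in> I_plus \<beta> \<Longrightarrow> 0 \<le> t \<Longrightarrow>
      norm (g (of_real t * cis \<theta>) - (\<Sum>n<N. fps_nth (borel_transform \<phi>) n * (of_real t * cis \<theta>) ^ n)) \<le>
      K * b ^ N * t ^ N * exp (R0 \<beta> * t)"
    using Taylor_remainder_on_rays[OF exp \<beta>(1,3)] by blast
  have "norm (L_plus R0 g z - partial_sum \<phi> N z)
      \<le> K * (2/\<kappa>) * (b * (2/\<kappa>)) ^ N * fact N / norm z ^ (N + 1)" if z: "z \<in> sector 1 R \<delta>" for z N
  proof -
    obtain \<theta> where \<theta>: "\<theta> \<in> I_plus \<beta>" "\<kappa> * norm z \<le> Re (z * cis \<theta>)"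
      using exists_direction_of_decay[OF \<delta>(1) \<beta>(2,3) less_imp_le[OF R] z] unfolding \<kappa>_def by blast
    have nz: "R < norm z" using z by (simp add: sector_def)
    then have "2 * R0 \<beta> < \<kappa> * norm z" using \<kappa> by (simp add: R_def field_simps)
    moreover define a where "a = Re (z * cis \<theta>) - R0 \<beta>"
    ultimately have a: "\<kappa> / 2 * norm z \<le> a" "0 < a" "0 < Re (z * cis \<theta>)" using \<theta>(2) R0 by linarith+
    have hp: "z \<in> half_plane \<theta> (R0 \<beta>)" using a(2) unfolding half_plane_def a_def by simp
    define e where "e t = exp (- z * (of_real t * cis \<theta>))" for t
    define p where "p t = (\<Sum>n<N. fps_nth (borel_transform \<phi>) n * (of_real t * cis \<theta>) ^ n)" for t
    have abs\<theta>: "\<bar>\<theta>\<bar> < pi/2" using \<theta>(1) \<beta> by (auto simp: I_plus_def)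
    note cont = continuous_on_ray[OF abs\<theta>]
    obtain C where C: "\<And>t. 0 \<le> t \<Longrightarrow> norm (g (of_real t * cis \<theta>)) \<le> C * exp (R0 \<beta> * t)"
      using growth[OF \<beta>(1,3)] \<theta>(1) by blast
    have int_g: "set_integrable lborel {0..} (\<lambda>t. e t * g (of_real t * cis \<theta>) * cis \<theta>)"
      unfolding e_def using norm_laplace_integrand_le[OF C] a(2) unfolding a_def
      by (intro set_integrable_exp_bounded[OF laplace_integrand_measurable[OF cont],
            where a = "Re (z * cis \<theta>) - R0 \<beta>" and C = C and N = 0]) auto
    have p_eq: "e t * p t * cis \<theta> = (\<Sum>n<N. fps_nth (borel_transform \<phi>) n * (e t * (of_real t * cis \<theta>) ^ n * cis \<theta>))" for t
      by (simp add: p_def sum_distrib_left sum_distrib_right mult_ac)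
    have int_m: "set_integrable lborel {0..} (\<lambda>t. fps_nth (borel_transform \<phi>) n * (e t * (of_real t * cis \<theta>) ^ n * cis \<theta>))" for n
      unfolding e_def by (rule set_integrable_mult_right) (rule laplace_monomial(1)[OF a(3)])
    have int_p: "set_integrable lborel {0..} (\<lambda>t. e t * p t * cis \<theta>)"
      unfolding p_eq using int_m unfolding set_integrable_def scaleR_sum_right
      by (intro Bochner_Integration.integrable_sum)
    have "(LBINT t:{0..}. e t * p t * cis \<theta>) =
        (\<Sum>n<N. LBINT t:{0..}. fps_nth (borel_transform \<phi>) n * (e t * (of_real t * cis \<theta>) ^ n * cis \<theta>))"
      unfolding p_eq using int_m unfolding set_integrable_def set_lebesgue_integral_def scaleR_sum_right
      by (intro Bochner_Integration.integral_sum)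
    also have "\<dots> = partial_sum \<phi> N z"
    proof (rule sum.cong[OF refl])
      fix n
      have "(LBINT t:{0..}. e t * (of_real t * cis \<theta>) ^ n * cis \<theta>) = fact n / z ^ (n + 1)"
        unfolding e_def by (rule laplace_monomial(2)[OF a(3)])
      then show "(LBINT t:{0..}. fps_nth (borel_transform \<phi>) n * (e t * (of_real t * cis \<theta>) ^ n * cis \<theta>))
          = fps_nth \<phi> (Suc n) / z ^ (n + 1)"
        unfolding set_integral_mult_right by (simp add: borel_transform_def)
    qed
    finally have int_p_val: "(LBINT t:{0..}. e t * p t * cis \<theta>) = partial_sum \<phi> N z" .
    have "L_plus R0 g z = (LBINT t:{0..}. e t * g (of_real t * cis \<theta>) * cis \<theta>)"
      unfolding L_plus_eq_laplace[OF \<beta>(1,3) \<theta>(1) hp] laplace_def e_def ..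
    then have "L_plus R0 g z - partial_sum \<phi> N z =
        (LBINT t:{0..}. e t * g (of_real t * cis \<theta>) * cis \<theta> - e t * p t * cis \<theta>)"
      unfolding int_p_val[symmetric] by (simp only: set_integral_diff(2)[OF int_g int_p])
    also have "norm \<dots> \<le> K * b ^ N * fact N / a ^ (N + 1)"
    proof (rule norm_LBINT_half_line_le)
      show "set_borel_measurable lborel {0..} (\<lambda>t. e t * g (of_real t * cis \<theta>) * cis \<theta> - e t * p t * cis \<theta>)"
        unfolding e_def p_def by (intro set_borel_measurable_continuous_on continuous_intros cont) auto
      show "0 < a" by (rule a)
      fix t :: real assume t: "0 \<le> t"
      have "e t * g (of_real t * cis \<theta>) * cis \<theta> - e t * p t * cis \<theta> = e t * (g (of_real t * cis \<theta>) - p t) * cis \<theta>"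
        by (simp add: algebra_simps)
      moreover have "norm (exp (- z * (of_real s * cis \<theta>)) * 1 * cis \<theta>) \<le> 1 * exp (- (Re (z * cis \<theta>) - 0) * s)" if "0 \<le> s" for s
        using norm_laplace_integrand_le[of "\<lambda>_. 1" \<theta> 1 0 s z] that by simp
      then have "norm (e t) \<le> exp (- Re (z * cis \<theta>) * t)" using t by (simp add: e_def norm_mult)
      then have "norm (e t) * norm (g (of_real t * cis \<theta>) - p t) \<le>
          exp (- Re (z * cis \<theta>) * t) * (K * b ^ N * t ^ N * exp (R0 \<beta> * t))"
        unfolding p_def using rem[OF \<theta>(1) t] by (intro mult_mono) auto
      moreover have "exp (- x * t) * (k * exp (r * t)) = k * exp (- (x - r) * t)" for x k r
      proof -
        have "exp (- x * t) * (k * exp (r * t)) = k * exp (- x * t + r * t)" by (simp only: exp_add mult_ac)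
        then show ?thesis by (simp add: algebra_simps)
      qed
      ultimately show "norm (e t * g (of_real t * cis \<theta>) * cis \<theta> - e t * p t * cis \<theta>) \<le> K * b ^ N * t ^ N * exp (- a * t)"
        unfolding a_def by (simp only: norm_mult norm_cis mult_1_right)
    qed
    also have "\<dots> \<le> K * b ^ N * fact N / (\<kappa> / 2 * norm z) ^ (N + 1)"
      using Kb a(1) \<kappa> nz R by (intro divide_left_mono power_mono mult_pos_pos zero_less_power a(2)) auto
    also have "\<dots> = K * (2/\<kappa>) * (b * (2/\<kappa>)) ^ N * fact N / norm z ^ (N + 1)"
      by (simp add: power_mult_distrib power_divide mult_ac)
    finally show ?thesis .
  qed
  moreover have "0 < K * (2/\<kappa>)" "0 < b * (2/\<kappa>)" using Kb \<kappa> by auto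
  moreover have "L_plus R0 g holomorphic_on sector 1 R \<delta>"
    by (rule holomorphic_on_subset[OF L_plus_holomorphic sub])
  ultimately have "gevrey_asymptotic (L_plus R0 g) \<phi> (sector 1 R \<delta>)"
    unfolding gevrey_asymptotic_def by blast
  then show ?thesis using R sub by blast
qed

end

section \<open>The left-hand sector by reflection\<close>

lemma laplace_reflect: "laplace (pi + \<theta>) g z = - laplace \<theta> (\<lambda>w. g (- w)) (- z)"
proof -
  have "cis (pi + \<theta>) = - cis \<theta>" by (simp flip: cis_mult)
  then have "laplace (pi + \<theta>) g z =
      (LBINT t:{0..}. - (exp (- (- z) * (of_real t * cis \<theta>)) * g (- (of_real t * cis \<theta>)) * cis \<theta>))"
    by (simp add: laplace_def)
  also have "\<dots> = - laplace \<theta> (\<lambda>w. g (- w)) (- z)"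
    by (simp only: laplace_def set_lebesgue_integral_def scaleR_minus_right Bochner_Integration.integral_minus)
  finally show ?thesis .
qed

lemma half_plane_reflect: "z \<in> half_plane (pi + \<theta>) R \<longleftrightarrow> - z \<in> half_plane \<theta> R"
proof -
  have "cis (pi + \<theta>) = - cis \<theta>" by (simp flip: cis_mult)
  then show ?thesis by (simp add: half_plane_def)
qed

lemma I_minus_eq: "\<theta> \<in> I_minus \<beta> \<longleftrightarrow> \<theta> - pi \<in> I_plus \<beta>"
  by (auto simp: I_minus_def I_plus_def)

lemma U_minus_iff: "z \<in> U_minus R0 \<longleftrightarrow> - z \<in> U_plus R0"
proof
  assume "z \<in> U_minus R0"
  then obtain \<beta> \<theta> where *: "\<beta> \<in> {0<..<pi/2}" "\<theta> \<in> I_minus \<beta>" "z \<in> half_plane \<theta> (R0 \<beta>)"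
    by (auto simp: sum_domain_def)
  then have "- z \<in> half_plane (\<theta> - pi) (R0 \<beta>)" using half_plane_reflect[of z "\<theta> - pi"] by simp
  then show "- z \<in> U_plus R0" using * unfolding sum_domain_def I_minus_eq by blast
next
  assume "- z \<in> U_plus R0"
  then obtain \<beta> \<theta> where *: "\<beta> \<in> {0<..<pi/2}" "\<theta> \<in> I_plus \<beta>" "- z \<in> half_plane \<theta> (R0 \<beta>)"
    by (auto simp: sum_domain_def)
  then have "z \<in> half_plane (pi + \<theta>) (R0 \<beta>)" "pi + \<theta> \<in> I_minus \<beta>"
    using half_plane_reflect[of z \<theta>] by (auto simp: I_minus_eq)
  then show "z \<in> U_minus R0" using *(1) unfolding sum_domain_def by blast
qed

lemma L_minus_eq_reflected_L_plus:
  assumes "borel_summable (\<lambda>w. g (- w)) R0" "z \<in> U_minus R0"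
  shows "L_minus R0 g z = - L_plus R0 (\<lambda>w. g (- w)) (- z)"
proof -
  interpret borel_summable "\<lambda>w. g (- w)" R0 by fact
  have val: "laplace \<theta> g z = - L_plus R0 (\<lambda>w. g (- w)) (- z)"
    if "\<beta> \<in> {0<..<pi/2}" "\<theta> \<in> I_minus \<beta>" "z \<in> half_plane \<theta> (R0 \<beta>)" for \<beta> \<theta>
  proof -
    have "- z \<in> half_plane (\<theta> - pi) (R0 \<beta>)" using that(3) half_plane_reflect[of z "\<theta> - pi"] by simp
    then have "L_plus R0 (\<lambda>w. g (- w)) (- z) = laplace (\<theta> - pi) (\<lambda>w. g (- w)) (- z)"
      using that by (intro L_plus_eq_laplace[of \<beta>]) (auto simp: I_minus_eq)
    then show ?thesis using laplace_reflect[of "\<theta> - pi" g z] by simp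
  qed
  obtain \<beta> \<theta> where *: "\<beta> \<in> {0<..<pi/2}" "\<theta> \<in> I_minus \<beta>" "z \<in> half_plane \<theta> (R0 \<beta>)"
    using assms(2) by (auto simp: sum_domain_def)
  show ?thesis unfolding laplace_sum_def[of I_minus]
  proof (rule the_equality)
    show "\<exists>\<beta>\<in>{0<..<pi/2}. \<exists>\<theta>\<in>I_minus \<beta>. z \<in> half_plane \<theta> (R0 \<beta>) \<and>
        - L_plus R0 (\<lambda>w. g (- w)) (- z) = laplace \<theta> g z"
      using * val[OF *] by metis
    fix w assume "\<exists>\<beta>\<in>{0<..<pi/2}. \<exists>\<theta>\<in>I_minus \<beta>. z \<in> half_plane \<theta> (R0 \<beta>) \<and> w = laplace \<theta> g z"
    then show "w = - L_plus R0 (\<lambda>w. g (- w)) (- z)" using val by blast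
  qed
qed

text \<open>If \<open>g\<close> is the Borel transform of \<open>\<phi>(z)\<close>, then \<open>\<zeta> \<mapsto> g (- \<zeta>)\<close> is that of \<open>- \<phi>(- z)\<close>.\<close>

lemma L_minus_gevrey:
  assumes bs: "borel_summable (\<lambda>w. g (- w)) R0"
    and exp: "g has_fps_expansion borel_transform \<phi>" and \<delta>: "0 < \<delta>" "\<delta> < pi/2"
  shows "\<exists>R>0. sector (-1) R \<delta> \<subseteq> U_minus R0 \<and> gevrey_asymptotic (L_minus R0 g) \<phi> (sector (-1) R \<delta>)"
proof -
  interpret borel_summable "\<lambda>w. g (- w)" R0 by fact
  define \<phi>' where "\<phi>' = Abs_fps (\<lambda>n. (- 1) ^ Suc n * fps_nth \<phi> n)"
  have "(g \<circ> uminus) has_fps_expansion fps_compose (borel_transform \<phi>) (- fps_X)"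
    by (rule has_fps_expansion_compose[OF exp]) (auto intro!: fps_expansion_intros)
  moreover have "fps_compose (borel_transform \<phi>) (- fps_X) = borel_transform \<phi>'"
    by (rule fps_ext) (simp add: fps_compose_uminus' borel_transform_def \<phi>'_def)
  ultimately have "(\<lambda>w. g (- w)) has_fps_expansion borel_transform \<phi>'" by (simp add: o_def)
  then obtain R where R: "0 < R" "sector 1 R \<delta> \<subseteq> U_plus R0"
      "gevrey_asymptotic (L_plus R0 (\<lambda>w. g (- w))) \<phi>' (sector 1 R \<delta>)"
    using L_plus_gevrey \<delta> by blast
  define \<psi> where "\<psi> = L_plus R0 (\<lambda>w. g (- w))"
  obtain L M where LM: "L > 0" "M > 0" and
    bd: "\<And>N z. z \<in> sector 1 R \<delta> \<Longrightarrow>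
      norm (\<psi> z - partial_sum \<phi>' N z) \<le> L * M ^ N * fact N / norm z ^ (N + 1)"
    using R(3) unfolding gevrey_asymptotic_def \<psi>_def by blast
  have \<psi>h: "\<psi> holomorphic_on sector 1 R \<delta>" using R(3) by (simp add: gevrey_asymptotic_def \<psi>_def)
  have mem: "z \<in> sector (-1) R \<delta> \<longleftrightarrow> - z \<in> sector 1 R \<delta>" for z by (simp add: sector_def)
  have sub: "sector (-1) R \<delta> \<subseteq> U_minus R0" using R(2) by (auto simp: mem U_minus_iff)
  have val: "L_minus R0 g z = - \<psi> (- z)" if "z \<in> sector (-1) R \<delta>" for z
    unfolding \<psi>_def using sub that by (intro L_minus_eq_reflected_L_plus bs) auto
  have "L_minus R0 g holomorphic_on sector (-1) R \<delta>"
  proof (rule holomorphic_transform)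
    show "(\<lambda>z. - \<psi> (- z)) holomorphic_on sector (-1) R \<delta>"
      by (intro holomorphic_on_minus holomorphic_on_compose_gen[OF _ \<psi>h, unfolded o_def] holomorphic_on_ident)
         (auto simp: mem)
  qed (simp add: val)
  moreover have "norm (L_minus R0 g z - partial_sum \<phi> N z) \<le> L * M ^ N * fact N / norm z ^ (N + 1)"
    if z: "z \<in> sector (-1) R \<delta>" for z N
  proof -
    have "fps_nth \<phi>' (Suc n) / (- z) ^ (n + 1) = - (fps_nth \<phi> (Suc n) / z ^ (n + 1))" for n
      by (simp add: \<phi>'_def power_minus[of z] field_simps)
    then have "partial_sum \<phi>' N (- z) = - partial_sum \<phi> N z"
      by (simp only: sum_negf)
    then have "\<psi> (- z) - partial_sum \<phi>' N (- z) =
        - (L_minus R0 g z - partial_sum \<phi> N z)"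
      using val[OF z] by simp
    then show ?thesis using bd[of "- z" N] z unfolding mem by (simp only: norm_minus_cancel)
  qed
  ultimately have "gevrey_asymptotic (L_minus R0 g) \<phi> (sector (-1) R \<delta>)"
    unfolding gevrey_asymptotic_def using LM by blast
  then show ?thesis using R(1) sub by blast
qed

section \<open>Fatou coordinates from a Gevrey solution of the difference equation\<close>

lemma sector_avoids_slit:
  assumes "0 \<le> R" "0 < \<delta>" "\<delta> < pi/2" "z \<in> sector \<sigma> R \<delta>" "norm \<sigma> = 1"
  shows "\<sigma> * z \<notin> \<real>\<^sub>\<le>\<^sub>0"
proof
  assume "\<sigma> * z \<in> \<real>\<^sub>\<le>\<^sub>0"
  then have im: "Im (\<sigma> * z) = 0" "Re (\<sigma> * z) \<le> 0" by (simp_all only: complex_nonpos_Reals_iff)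
  have "norm (\<sigma> * z) = \<bar>Re (\<sigma> * z)\<bar>" unfolding cmod_def im(1) by simp
  then have "Re (\<sigma> * z) = - norm z" using im(2) assms(5) by (simp only: norm_mult mult_1_left)
  moreover have "- sin \<delta> * norm z < Re (\<sigma> * z)" "0 < norm z" using assms(1,4) by (auto simp: sector_def)
  ultimately have "1 * norm z < sin \<delta> * norm z" by simp
  then have "1 < sin \<delta>" using \<open>0 < norm z\<close> by (rule mult_right_less_imp_less[OF _ less_imp_le])
  then show False using sin_le_one[of \<delta>] by linarith
qed

lemma sector_mult_mem: "norm \<sigma> = 1 \<Longrightarrow> z \<in> sector \<sigma> R \<delta> \<longleftrightarrow> \<sigma> * z \<in> sector 1 R \<delta>"
  by (simp add: sector_def norm_mult)

text \<open>The argument of \<open>\<sigma> z\<close> stays at distance \<open>\<pi>/2 - \<delta>\<close> from \<open>\<plusminus>\<pi>\<close>, which exceeds the argument of the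
  factor \<open>w/z\<close>; so no multiple of \<open>2 \<pi> \<i>\<close> appears.\<close>

lemma Ln_increment_on_sector:
  assumes \<sigma>: "norm \<sigma> = 1" and R: "0 \<le> R" and \<delta>: "0 < \<delta>" "\<delta> < pi/2" and z: "z \<in> sector \<sigma> R \<delta>"
    and w: "norm (w - z) \<le> e * norm z" "e \<le> 1/4" "2 * e < pi/2 - \<delta>" "w \<noteq> 0"
  shows "Ln (\<sigma> * w) = Ln (\<sigma> * z) + Ln (w / z)"
proof -
  have z0: "z \<noteq> 0" and \<sigma>0: "\<sigma> \<noteq> 0" using z R \<sigma> by (auto simp: sector_def)
  define u where "u = (w - z) / z"
  have "w / z = 1 + u" using z0 by (simp add: u_def diff_divide_distrib)
  have nu: "norm u \<le> e" using w(1) z0 by (simp add: u_def norm_divide field_simps)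
  have "norm (Ln (1 + u)) \<le> 2 * norm u" using nu w(2) by (intro norm_Ln_le) linarith
  then have "\<bar>Im (Ln (1 + u))\<bar> \<le> 2 * e" using nu abs_Im_le_cmod[of "Ln (1 + u)"] by linarith
  moreover have "\<bar>Arg (\<sigma> * z)\<bar> < pi/2 + \<delta>"
    using abs_Arg_less_of_sector[OF R \<delta>] z unfolding sector_mult_mem[OF \<sigma>] by blast
  then have "\<bar>Im (Ln (\<sigma> * z))\<bar> < pi/2 + \<delta>" using z0 \<sigma>0 by (simp add: Arg_eq_Im_Ln)
  ultimately have "- pi < Im (Ln (\<sigma> * z)) + Im (Ln (1 + u))" "Im (Ln (\<sigma> * z)) + Im (Ln (1 + u)) \<le> pi"
    using w(3) by linarith+
  then have "Ln ((\<sigma> * z) * (w / z)) = Ln (\<sigma> * z) + Ln (w / z)"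
    using z0 \<sigma>0 w(4) unfolding \<open>w / z = 1 + u\<close>[symmetric] by (intro Ln_times_simple) auto
  moreover have "(\<sigma> * z) * (w / z) = \<sigma> * w" using z0 by simp
  ultimately show ?thesis by simp
qed

text \<open>Both sides of the theorem are instances: \<open>\<psi>\<close> is the Borel sum on the side \<open>\<sigma>\<close>, and
  \<open>\<kappa> + Ln (\<sigma> z)\<close>, with \<open>\<kappa> = 0\<close> or \<open>\<kappa> = \<i> \<pi>\<close>, is the branch of the logarithm.\<close>

locale gevrey_solution =
  fixes \<sigma> \<rho> \<kappa> :: complex and b b1 f \<psi> v :: "complex \<Rightarrow> complex" and \<phi> :: "complex fps"
  assumes sigma: "\<sigma> = 1 \<or> \<sigma> = -1"
    and formal: "formal_solution b b1 \<phi>"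
    and b1: "\<And>z. b1 z = b z + \<rho> * Ln ((1 + inverse z * b z) / (1 - inverse z))"
    and f: "\<And>z. f z = z + 1 + b (z + 1)"
    and gevrey: "\<And>\<delta>. 0 < \<delta> \<Longrightarrow> \<delta> < pi/2 \<Longrightarrow> \<exists>R>0. gevrey_asymptotic \<psi> \<phi> (sector \<sigma> R \<delta>)"
    and v: "\<And>z. \<sigma> * z \<notin> \<real>\<^sub>\<le>\<^sub>0 \<Longrightarrow> v z = z + \<rho> * (\<kappa> + Ln (\<sigma> * z)) + \<psi> z"
begin

abbreviation "S \<equiv> sector \<sigma>"

lemma norm_sigma: "norm \<sigma> = 1" using sigma by auto

lemma b_bounded_analytic:
  obtains K R where "0 < K" "0 < R" "\<And>z. R \<le> norm z \<Longrightarrow> norm (b z) \<le> K" "b analytic_on {z. R < norm z}"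
proof -
  obtain B where "expands_at_infinity b B" using formal by (auto simp: formal_solution_def)
  then obtain r K where r: "0 < r" "0 < K" "\<And>u. norm u \<le> r \<Longrightarrow> norm (eval_fps B u) \<le> K"
    "\<And>z. 1 / r \<le> norm z \<Longrightarrow> b z = eval_fps B (inverse z)" "b analytic_on {z. 1 / r < norm z}"
    by (rule expands_at_infinityE) blast
  have "norm (b z) \<le> K" if "1 / r \<le> norm z" for z
    using le_imp_inverse_le[OF that] r(1) unfolding r(4)[OF that] by (intro r(3)) (simp add: norm_inverse)
  then show ?thesis using r by (intro that[of K "1 / r"]) auto
qed

lemma v_eq:
  assumes "0 \<le> R" "0 < \<delta>" "\<delta> < pi/2" "z \<in> S R \<delta>"
  shows "v z = z + \<rho> * (\<kappa> + Ln (\<sigma> * z)) + \<psi> z"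
  by (rule v[OF sector_avoids_slit[OF assms norm_sigma]])

lemma displacement_holomorphic:
  assumes \<delta>: "0 < \<delta>" "\<delta> < pi/2"
  shows "\<exists>R>0. (\<lambda>z. v z - z) holomorphic_on S R \<delta>"
proof -
  obtain R where R: "0 < R" "gevrey_asymptotic \<psi> \<phi> (S R \<delta>)" using gevrey[OF \<delta>] by blast
  then have \<psi>h: "\<psi> holomorphic_on S R \<delta>" by (simp add: gevrey_asymptotic_def)
  have "(\<lambda>z. v z - z) holomorphic_on S R \<delta>"
  proof (rule holomorphic_transform)
    show "(\<lambda>z. \<rho> * (\<kappa> + Ln (\<sigma> * z)) + \<psi> z) holomorphic_on S R \<delta>"
      using sector_avoids_slit[OF less_imp_le[OF R(1)] \<delta> _ norm_sigma]
      by (intro holomorphic_on_add holomorphic_on_mult holomorphic_on_const holomorphic_on_Ln' holomorphic_on_ident \<psi>h) auto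
    show "\<rho> * (\<kappa> + Ln (\<sigma> * z)) + \<psi> z = v z - z" if "z \<in> S R \<delta>" for z
      using v_eq[OF less_imp_le[OF R(1)] \<delta> that] by simp
  qed
  then show ?thesis using R(1) by blast
qed

lemma displacement_sublinear:
  assumes \<delta>: "0 < \<delta>" "\<delta> < pi/2"
  shows "sublinear_on_sector \<sigma> \<delta> (\<lambda>z. v z - z)"
  unfolding sublinear_on_sector_def
proof (intro allI impI)
  fix \<epsilon> :: real assume \<epsilon>: "0 < \<epsilon>"
  obtain R where R: "0 < R" "gevrey_asymptotic \<psi> \<phi> (S R \<delta>)" using gevrey[OF \<delta>] by blast
  obtain L M where LM: "L > 0" "M > 0" and
    bd: "\<And>N z. z \<in> S R \<delta> \<Longrightarrow>
      norm (\<psi> z - partial_sum \<phi> N z) \<le> L * M ^ N * fact N / norm z ^ (N + 1)"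
    using R(2) unfolding gevrey_asymptotic_def by blast
  define A where "A = norm \<rho>"
  define B where "B = norm \<rho> * (norm \<kappa> + pi) + L"
  have "eventually (\<lambda>x. A * ln x + B \<le> \<epsilon> * x) at_top" using \<epsilon> by real_asymp
  then obtain R1 where R1: "\<And>x. R1 \<le> x \<Longrightarrow> A * ln x + B \<le> \<epsilon> * x" by (auto simp: eventually_at_top_linorder)
  define R2 where "R2 = max (max R R1) 1"
  show "\<exists>R. \<forall>z\<in>S R \<delta>. norm (v z - z) \<le> \<epsilon> * norm z"
  proof (intro exI[of _ R2] ballI)
    fix z assume z: "z \<in> S R2 \<delta>"
    then have nz: "R1 \<le> norm z" "1 < norm z" by (auto simp: sector_def R2_def)
    have zR: "z \<in> S R \<delta>" using z by (auto simp: R2_def sector_def)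
    have "norm (\<psi> z) \<le> L / norm z" using bd[OF zR, of 0] by simp
    also have "\<dots> \<le> L / 1" using LM nz by (intro divide_left_mono) auto
    finally have \<psi>: "norm (\<psi> z) \<le> L" by simp
    have s0: "\<sigma> * z \<noteq> 0" using nz sigma by auto
    have "norm (Ln (\<sigma> * z)) \<le> \<bar>Re (Ln (\<sigma> * z))\<bar> + \<bar>Im (Ln (\<sigma> * z))\<bar>" by (rule cmod_le)
    also have "Re (Ln (\<sigma> * z)) = ln (norm z)" using s0 by (simp add: norm_mult norm_sigma)
    also have "\<bar>Im (Ln (\<sigma> * z))\<bar> \<le> pi"
      using Im_Ln_le_pi[OF s0] mpi_less_Im_Ln[OF s0] by linarith
    also have "\<bar>ln (norm z)\<bar> = ln (norm z)" using nz by simp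
    finally have "norm (\<kappa> + Ln (\<sigma> * z)) \<le> norm \<kappa> + (ln (norm z) + pi)"
      using norm_triangle_ineq[of \<kappa> "Ln (\<sigma> * z)"] by linarith
    then have "norm \<rho> * norm (\<kappa> + Ln (\<sigma> * z)) \<le> norm \<rho> * (norm \<kappa> + (ln (norm z) + pi))"
      by (intro mult_left_mono) auto
    moreover have "v z - z = \<rho> * (\<kappa> + Ln (\<sigma> * z)) + \<psi> z"
      using v_eq[OF less_imp_le[OF R(1)] \<delta> zR] by simp
    then have "norm (v z - z) \<le> norm \<rho> * norm (\<kappa> + Ln (\<sigma> * z)) + norm (\<psi> z)"
      using norm_triangle_ineq[of "\<rho> * (\<kappa> + Ln (\<sigma> * z))" "\<psi> z"] by (simp only: norm_mult)
    ultimately have "norm (v z - z) \<le> A * ln (norm z) + B"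
      using \<psi> by (simp add: A_def B_def algebra_simps)
    then show "norm (v z - z) \<le> \<epsilon> * norm z" using R1[OF nz(1)] by linarith
  qed
qed

text \<open>The function \<open>b1\<close> is made for this: at \<open>w = z + 1\<close> one has \<open>f z = w + b w\<close>, the difference equation reads
  \<open>\<psi> z = \<psi> (f z) + b1 w\<close>, and the logarithm in \<open>b1 w\<close> is \<open>Ln (f z / z)\<close>, the increment of the logarithm in \<open>v\<close>.\<close>

lemma abel_equation:
  assumes \<delta>: "0 < \<delta>" "\<delta> < pi/2"
  shows "\<exists>R>0. \<forall>z\<in>S R \<delta>. f z \<in> S R \<delta> \<longrightarrow> v (f z) = v z + 1"
proof -
  define \<delta>' where "\<delta>' = (\<delta> + pi/2) / 2"
  have \<delta>': "\<delta> < \<delta>'" "0 < \<delta>'" "\<delta>' < pi/2" using \<delta> by (auto simp: \<delta>'_def)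
  obtain R1 where R1: "\<And>w. w \<in> S R1 \<delta>' \<Longrightarrow> \<psi> (w - 1) = \<psi> (w + b w) + b1 w"
    using sum_of_formal_solution_solves_equation[OF formal sigma _ \<delta>'(2,3)] gevrey by meson
  obtain \<eta> where \<eta>: "0 < \<eta>" "\<eta> \<le> 1/2"
    "\<And>R z w. 0 \<le> R \<Longrightarrow> z \<in> S R \<delta> \<Longrightarrow> norm (w - z) \<le> \<eta> * norm z \<Longrightarrow> w \<in> S (R/2) \<delta>'"
    using sector_perturb[OF \<delta>(1) \<delta>'(1,3) norm_sigma] by blast
  obtain K R2 where K: "0 < K" "0 < R2" "\<And>z. R2 \<le> norm z \<Longrightarrow> norm (b z) \<le> K"
    using b_bounded_analytic by metis
  define e where "e = min (1/4) ((pi/2 - \<delta>) / 4)"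
  have e: "0 < e" "e \<le> 1/4" "2 * e < pi/2 - \<delta>" using \<delta> by (auto simp: e_def min_def)
  define R where "R = Max {2 * \<bar>R1\<bar>, R2 + 1, 1 / \<eta>, (1 + K) / e, 1}"
  have R: "2 * \<bar>R1\<bar> \<le> R" "R2 + 1 \<le> R" "1 / \<eta> \<le> R" "(1 + K) / e \<le> R" "1 \<le> R"
    by (auto simp: R_def le_max_iff_disj)
  have R0: "0 \<le> R" using R(5) by linarith
  have "v (f z) = v z + 1" if z: "z \<in> S R \<delta>" and fz: "f z \<in> S R \<delta>" for z
  proof -
    define w where "w = z + 1"
    have nz: "R < norm z" using z by (simp add: sector_def)
    have z0: "z \<noteq> 0" using nz R by auto
    have "1 / \<eta> < norm z" "(1 + K) / e < norm z" using nz R by linarith+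
    then have big: "1 \<le> \<eta> * norm z" "1 + K \<le> e * norm z"
      using \<eta>(1) e(1) by (simp_all add: field_simps)
    have "norm z \<le> norm w + 1" using norm_triangle_ineq4[of w 1] by (simp add: w_def)
    then have nw: "R2 \<le> norm w" "0 < norm w" using nz R(2) K(2) by linarith+
    have bw: "norm (b w) \<le> K" by (rule K(3)[OF nw(1)])
    have fzw: "f z = w + b w" by (simp add: f w_def)
    have "w \<in> S (R/2) \<delta>'" by (rule \<eta>(3)[OF R0 z]) (use big in \<open>simp add: w_def\<close>)
    moreover have "R1 \<le> R / 2" using R(1) abs_ge_self[of R1] by linarith
    ultimately have "w \<in> S R1 \<delta>'" using sector_mono by blast
    from R1[OF this] have \<psi>: "\<psi> z = \<psi> (f z) + b1 w" by (simp add: fzw w_def)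
    have fz0: "f z \<noteq> 0" using fz R0 by (auto simp: sector_def)
    have "norm (f z - z) \<le> 1 + K"
      using norm_triangle_ineq[of 1 "b w"] bw by (simp add: fzw w_def add.commute)
    then have "norm (f z - z) \<le> e * norm z" using big(2) by linarith
    from Ln_increment_on_sector[OF norm_sigma R0 \<delta> z this e(2,3) fz0]
    have ln: "Ln (\<sigma> * f z) = Ln (\<sigma> * z) + Ln (f z / z)" .
    have w0: "w \<noteq> 0" using nw by auto
    have "(1 + inverse w * b w) / (1 - inverse w) = (w * (1 + inverse w * b w)) / (w * (1 - inverse w))"
      using w0 by simp
    also have "w * (1 + inverse w * b w) = f z" using w0 by (simp add: fzw distrib_left)
    also have "w * (1 - inverse w) = z" using w0 by (simp add: right_diff_distrib) (simp add: w_def)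
    finally have "b1 w = b w + \<rho> * Ln (f z / z)" by (simp only: b1)
    then have "v (f z) - v z = f z - z - b w"
      unfolding v_eq[OF R0 \<delta> z] v_eq[OF R0 \<delta> fz] ln \<psi> by (simp add: algebra_simps)
    then show ?thesis by (simp add: fzw w_def algebra_simps)
  qed
  moreover have "0 < R" using R(5) by linarith
  ultimately show ?thesis by blast
qed

lemma fatou_coordinate_exists:
  assumes \<delta>: "0 < \<delta>" "\<delta> < pi/2"
  shows "\<exists>R>0. v holomorphic_on S R \<delta> \<and> inj_on v (S R \<delta>) \<and>
    (\<forall>z\<in>S R \<delta>. f z \<in> S R \<delta> \<longrightarrow> v (f z) = v z + 1)"
proof -
  define \<delta>' where "\<delta>' = (\<delta> + pi/2) / 2"
  have \<delta>': "\<delta> < \<delta>'" "0 < \<delta>'" "\<delta>' < pi/2" using \<delta> by (auto simp: \<delta>'_def)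
  obtain R1 where R1: "0 < R1" "(\<lambda>z. v z - z) holomorphic_on S R1 \<delta>'"
    using displacement_holomorphic[OF \<delta>'(2,3)] by blast
  obtain R2 where R2: "inj_on (\<lambda>z. z + (v z - z)) (S R2 \<delta>)"
    using inj_on_near_identity[OF \<delta>(1) \<delta>'(1,3) norm_sigma R1(2) displacement_sublinear[OF \<delta>'(2,3)]] by blast
  obtain R3 where R3: "\<And>z. z \<in> S R3 \<delta> \<Longrightarrow> f z \<in> S R3 \<delta> \<Longrightarrow> v (f z) = v z + 1"
    using abel_equation[OF \<delta>] by blast
  define R where "R = max R1 (max R2 R3)"
  have "R1 \<le> R" "R2 \<le> R" "R3 \<le> R" by (auto simp: R_def)
  then have sub: "S R \<delta> \<subseteq> S R1 \<delta>'" "S R \<delta> \<subseteq> S R2 \<delta>" "S R \<delta> \<subseteq> S R3 \<delta>"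
    using sector_widen[OF \<delta>(1) \<delta>'(1,3)] sector_mono by blast+
  have "(\<lambda>z. z + (v z - z)) holomorphic_on S R \<delta>"
    by (intro holomorphic_on_add holomorphic_on_ident holomorphic_on_subset[OF R1(2) sub(1)])
  then have "v holomorphic_on S R \<delta>" by simp
  moreover have "inj_on v (S R \<delta>)" using inj_on_subset[OF R2 sub(2)] by simp
  moreover have "0 < R" using R1(1) \<open>R1 \<le> R\<close> by linarith
  ultimately show ?thesis using R3 sub(3) by blast
qed

lemma sector_subset_image:
  assumes \<delta>: "0 < \<delta>'" "\<delta>' < \<delta>" "\<delta> < pi/2"
  shows "\<exists>R0. \<forall>R\<ge>R0. \<exists>R'>0. S R' \<delta>' \<subseteq> v ` S R \<delta>"
proof -
  have \<beta>: "0 < \<delta>" using \<delta> by linarith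
  obtain R1 where R1: "0 < R1" "(\<lambda>z. v z - z) holomorphic_on S R1 \<delta>"
    using displacement_holomorphic[OF \<beta> \<delta>(3)] by blast
  have "\<exists>R'>0. S R' \<delta>' \<subseteq> v ` S R \<delta>" if "R1 \<le> R" for R
  proof -
    have "continuous_on (S R \<delta>) (\<lambda>z. v z - z)"
      by (rule holomorphic_on_imp_continuous_on[OF holomorphic_on_subset[OF R1(2) sector_mono[OF that]]])
    from sector_subset_image_near_identity[OF \<delta> norm_sigma this displacement_sublinear[OF \<beta> \<delta>(3)]]
    show ?thesis by simp
  qed
  then show ?thesis by blast
qed

lemma fatou_coordinate_unique_up_to_constant:
  assumes \<delta>: "0 < \<delta>" "\<delta> < pi/2" and R: "0 < R"
    and V: "V holomorphic_on S R \<delta>" "inj_on V (S R \<delta>)"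
      "\<And>z. z \<in> S R \<delta> \<Longrightarrow> f analytic_on {w. norm w \<ge> norm z} \<Longrightarrow> f z \<in> S R \<delta> \<Longrightarrow> V (f z) = V z + 1"
  shows "\<exists>c R'. \<forall>z\<in>S R' \<delta>. V z = v z + c"
proof -
  obtain R1 where R1: "0 < R1" "(\<lambda>z. v z - z) holomorphic_on S R1 \<delta>"
    using displacement_holomorphic[OF \<delta>] by blast
  obtain R2 where R2: "inj_on v (S R2 \<delta>)"
      "\<And>z. z \<in> S R2 \<delta> \<Longrightarrow> f z \<in> S R2 \<delta> \<Longrightarrow> v (f z) = v z + 1"
    using fatou_coordinate_exists[OF \<delta>] by blast
  obtain K R3 where K: "0 < K" "0 < R3" "\<And>z. R3 \<le> norm z \<Longrightarrow> norm (b z) \<le> K" "b analytic_on {z. R3 < norm z}"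
    using b_bounded_analytic by metis
  define R' where "R' = Max {R, R1, R2, R3 + 1}"
  have R': "R \<le> R'" "R1 \<le> R'" "R2 \<le> R'" "R3 + 1 \<le> R'" by (auto simp: R'_def le_max_iff_disj)
  note sub = sector_mono[OF R'(1), of \<sigma> \<delta>] sector_mono[OF R'(2), of \<sigma> \<delta>] sector_mono[OF R'(3), of \<sigma> \<delta>]
  have far: "R3 < norm (w + 1)" if "R' < norm w" for w :: complex
    using norm_triangle_ineq4[of "w + 1" 1] that R'(4) by simp
  have f_an: "f analytic_on {w. norm w \<ge> norm z}" if "z \<in> S R' \<delta>" for z
  proof -
    have "w + 1 \<in> {z. R3 < norm z}" if "w \<in> {w. norm w \<ge> norm z}" for w :: complex
      using that \<open>z \<in> S R' \<delta>\<close> far[of w] by (simp add: sector_def)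
    then have "(b \<circ> (\<lambda>w. w + 1)) analytic_on {w. norm w \<ge> norm z}"
      by (intro analytic_on_compose_gen[OF _ K(4)] analytic_on_add analytic_on_ident analytic_on_const)
    then have "(\<lambda>w. b (w + 1)) analytic_on {w. norm w \<ge> norm z}" by (simp only: o_def)
    then have "(\<lambda>w. w + 1 + b (w + 1)) analytic_on {w. norm w \<ge> norm z}"
      by (intro analytic_on_add analytic_on_ident analytic_on_const)
    then show ?thesis unfolding f[abs_def] .
  qed
  have R'0: "0 \<le> R'" using R R'(1) by linarith
  have "\<exists>c. \<forall>z\<in>S R' \<delta>. V z = z + (v z - z) + c"
  proof (rule fatou_coordinate_unique[where f = f and K = K, OF sigma \<delta> R'0])
    show "norm (f z - (z + 1)) \<le> K" if "z \<in> S R' \<delta>" for z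
      using K(3)[of "z + 1"] far[of z] that by (simp add: f sector_def)
    show "(\<lambda>z. v z - z) holomorphic_on S R' \<delta>" by (rule holomorphic_on_subset[OF R1(2) sub(2)])
    show "sublinear_on_sector \<sigma> \<delta> (\<lambda>z. v z - z)" by (rule displacement_sublinear[OF \<delta>])
    show "inj_on (\<lambda>z. z + (v z - z)) (S R' \<delta>)" using inj_on_subset[OF R2(1) sub(3)] by simp
    show "f z + (v (f z) - f z) = z + (v z - z) + 1" if "z \<in> S R' \<delta>" "f z \<in> S R' \<delta>" for z
      using R2(2)[of z] that sub(3) by auto
    show "V holomorphic_on S R' \<delta>" by (rule holomorphic_on_subset[OF V(1) sub(1)])
    show "inj_on V (S R' \<delta>)" by (rule inj_on_subset[OF V(2) sub(1)])
    show "V (f z) = V z + 1" if "z \<in> S R' \<delta>" "f z \<in> S R' \<delta>" for z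
      using V(3)[of z] f_an[of z] that sub(1) by blast
  qed
  then obtain c where "\<And>z. z \<in> S R' \<delta> \<Longrightarrow> V z = z + (v z - z) + c" by blast
  then have "\<forall>z\<in>S R' \<delta>. V z = v z + c" by simp
  then show ?thesis by blast
qed

end

section \<open>Existence, asymptotics and uniqueness of the Fatou coordinates\<close>

theorem theorem2:
  fixes F :: "complex \<Rightarrow> complex" and c \<rho> :: complex
    and \<phi> :: "complex fps" and \<phi>hat :: "complex \<Rightarrow> complex" and R0 :: "real \<Rightarrow> real"
  assumes F_analytic: "F analytic_on {0}" and F_0: "F 0 = 0"
    and F_expansion: "(\<lambda>w. F w - (w + c * w ^ 2)) \<in> O[at 0](\<lambda>w. w ^ 3)"
    and c: "c \<noteq> 0"
    and rho: "(\<lambda>z. germ_a F c z - (- \<rho> / z)) \<in> O[at_infinity](\<lambda>z. 1 / z ^ 2)"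
    and phi: "formal_solution (germ_b F c) (germ_b1 F c \<rho>) \<phi>"
    and phihat_0: "\<phi>hat has_fps_expansion borel_transform \<phi>"
    and phihat_rays: "\<And>\<delta>0 \<theta>. 0 < \<delta>0 \<Longrightarrow> \<delta>0 < pi/2 \<Longrightarrow> \<theta> \<in> I_plus \<delta>0 \<union> I_minus \<delta>0 \<Longrightarrow>
      \<phi>hat analytic_on ray \<theta>"
    and R0: "\<And>\<delta>0. 0 < \<delta>0 \<Longrightarrow> \<delta>0 < pi/2 \<Longrightarrow> R0 \<delta>0 > 0 \<and>
      (\<exists>C0>0. \<forall>\<theta>\<in>I_plus \<delta>0 \<union> I_minus \<delta>0. \<forall>t\<ge>0.
         norm (\<phi>hat (of_real t * cis \<theta>)) \<le> C0 * exp (R0 \<delta>0 * t))"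
  shows
    "(\<forall>\<delta>. 0 < \<delta> \<longrightarrow> \<delta> < pi/2 \<longrightarrow> (\<forall>\<^sub>F R in at_top.
        P_plus R \<delta> \<subseteq> U_plus R0 \<and> P_minus R \<delta> \<subseteq> U_minus R0 \<and>
        fatou_pair (germ_at_infinity F c) R \<delta> (v_plus \<rho> R0 \<phi>hat) (v_minus \<rho> R0 \<phi>hat)))
     \<and>
     (\<forall>\<delta>' \<delta>. 0 < \<delta>' \<longrightarrow> \<delta>' < \<delta> \<longrightarrow> \<delta> < pi/2 \<longrightarrow> (\<forall>\<^sub>F R in at_top.
        gevrey_asymptotic (L_plus R0 \<phi>hat) \<phi> (P_plus R \<delta>) \<and>
        gevrey_asymptotic (L_minus R0 \<phi>hat) \<phi> (P_minus R \<delta>) \<and>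
        v_plus \<rho> R0 \<phi>hat holomorphic_on P_plus R \<delta> \<and> inj_on (v_plus \<rho> R0 \<phi>hat) (P_plus R \<delta>) \<and>
        v_minus \<rho> R0 \<phi>hat holomorphic_on P_minus R \<delta> \<and> inj_on (v_minus \<rho> R0 \<phi>hat) (P_minus R \<delta>) \<and>
        (\<exists>R'>0. P_plus R' \<delta>' \<subseteq> v_plus \<rho> R0 \<phi>hat ` P_plus R \<delta>) \<and>
        (\<exists>R'>0. P_minus R' \<delta>' \<subseteq> v_minus \<rho> R0 \<phi>hat ` P_minus R \<delta>)))
     \<and>
     (\<forall>R \<delta> vp vm. fatou_pair (germ_at_infinity F c) R \<delta> vp vm \<longrightarrow>
        (\<exists>cp cm. \<forall>\<^sub>F R' in at_top.
           (\<forall>z\<in>P_plus R' \<delta>. vp z = v_plus \<rho> R0 \<phi>hat z + cp) \<and>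
           (\<forall>z\<in>P_minus R' \<delta>. vm z = v_minus \<rho> R0 \<phi>hat z + cm)))
     \<and>
     (\<forall>cp cm \<delta>. 0 < \<delta> \<longrightarrow> \<delta> < pi/2 \<longrightarrow> (\<forall>\<^sub>F R in at_top.
        fatou_pair (germ_at_infinity F c) R \<delta>
          (\<lambda>z. v_plus \<rho> R0 \<phi>hat z + cp) (\<lambda>z. v_minus \<rho> R0 \<phi>hat z + cm)))"
proof -
  define f where "f = germ_at_infinity F c"
  define vp where "vp = v_plus \<rho> R0 \<phi>hat"
  define vm where "vm = v_minus \<rho> R0 \<phi>hat"
  \<comment> \<open>The rays of directions in \<open>(-\<pi>/2, \<pi>/2)\<close> cover the open right half-plane and the origin; those of the opposite
    directions cover the reflected set.\<close>
  have analytic: "\<phi>hat analytic_on {w. 0 < Re w} \<union> {0}" "(\<lambda>w. \<phi>hat (- w)) analytic_on {w. 0 < Re w} \<union> {0}"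
  proof -
    have on_ray: "\<phi>hat analytic_on {of_real (norm w) * cis (Arg w)}" "\<phi>hat analytic_on {of_real (norm w) * cis (pi + Arg w)}"
      if "w \<in> {w. 0 < Re w} \<union> {0}" for w
    proof -
      have "\<bar>Arg w\<bar> < pi/2"
      proof (cases "w = 0")
        case False
        then show ?thesis using that Re_Ln_pos_lt[of w] by (simp add: Arg_eq_Im_Ln)
      qed (simp add: Arg_zero)
      define \<delta>0 where "\<delta>0 = (\<bar>Arg w\<bar> + pi/2) / 2"
      have \<delta>0: "0 < \<delta>0" "\<delta>0 < pi/2" "\<bar>Arg w\<bar> \<le> \<delta>0"
        using \<open>\<bar>Arg w\<bar> < pi/2\<close> abs_ge_zero[of "Arg w"] pi_gt_zero
        by (simp_all add: \<delta>0_def add_nonneg_pos del: abs_ge_zero)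
      then have "Arg w \<in> I_plus \<delta>0 \<union> I_minus \<delta>0" "pi + Arg w \<in> I_plus \<delta>0 \<union> I_minus \<delta>0"
        by (auto simp: I_plus_def I_minus_def abs_le_iff)
      then have "\<phi>hat analytic_on ray (Arg w)" "\<phi>hat analytic_on ray (pi + Arg w)"
        using phihat_rays[OF \<delta>0(1,2)] by blast+
      then show "\<phi>hat analytic_on {of_real (norm w) * cis (Arg w)}" "\<phi>hat analytic_on {of_real (norm w) * cis (pi + Arg w)}"
        by (auto simp: ray_def intro: analytic_on_subset)
    qed
    have polar: "of_real (norm w) * cis (Arg w) = w" "of_real (norm w) * cis (pi + Arg w) = - w" for w
      using rcis_cmod_Arg[of w] by (simp_all add: rcis_def flip: cis_mult)
    show "\<phi>hat analytic_on {w. 0 < Re w} \<union> {0}"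
      by (subst analytic_on_analytic_at) (use on_ray(1)[unfolded polar] in blast)
    have "(\<phi>hat \<circ> uminus) analytic_on {w}" if "w \<in> {w. 0 < Re w} \<union> {0}" for w
      by (rule analytic_on_compose) (use on_ray(2)[OF that, unfolded polar] in \<open>auto intro: analytic_intros\<close>)
    then show "(\<lambda>w. \<phi>hat (- w)) analytic_on {w. 0 < Re w} \<union> {0}"
      by (subst analytic_on_analytic_at) (simp add: o_def)
  qed
  interpret right: borel_summable \<phi>hat R0
  proof
    show "\<phi>hat analytic_on {w. 0 < Re w} \<union> {0}" by (rule analytic)
    show "R0 \<delta>0 > 0 \<and> (\<exists>C>0. \<forall>\<theta>\<in>I_plus \<delta>0. \<forall>t\<ge>0. norm (\<phi>hat (of_real t * cis \<theta>)) \<le> C * exp (R0 \<delta>0 * t))"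
      if "0 < \<delta>0" "\<delta>0 < pi/2" for \<delta>0
      using R0[OF that] by blast
  qed
  have left: "borel_summable (\<lambda>w. \<phi>hat (- w)) R0"
  proof
    show "(\<lambda>w. \<phi>hat (- w)) analytic_on {w. 0 < Re w} \<union> {0}" by (rule analytic)
    fix \<delta>0 :: real assume \<delta>0: "0 < \<delta>0" "\<delta>0 < pi/2"
    obtain C where C: "0 < C" "\<And>\<theta> t. \<theta> \<in> I_minus \<delta>0 \<Longrightarrow> 0 \<le> t \<Longrightarrow> norm (\<phi>hat (of_real t * cis \<theta>)) \<le> C * exp (R0 \<delta>0 * t)"
      using R0[OF \<delta>0] by blast
    have "norm (\<phi>hat (- (of_real t * cis \<theta>))) \<le> C * exp (R0 \<delta>0 * t)" if "\<theta> \<in> I_plus \<delta>0" "0 \<le> t" for \<theta> t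
    proof -
      have "- (of_real t * cis \<theta>) = of_real t * cis (pi + \<theta>)" by (simp flip: cis_mult)
      then show ?thesis using C(2)[of "pi + \<theta>" t] that by (simp add: I_minus_eq)
    qed
    then show "R0 \<delta>0 > 0 \<and> (\<exists>C>0. \<forall>\<theta>\<in>I_plus \<delta>0. \<forall>t\<ge>0. norm (\<phi>hat (- (of_real t * cis \<theta>))) \<le> C * exp (R0 \<delta>0 * t))"
      using R0[OF \<delta>0] C(1) by blast
  qed
  note gevrey_plus = right.L_plus_gevrey[OF phihat_0]
  note gevrey_minus = L_minus_gevrey[OF left phihat_0]
  have f_eq: "f z = z + 1 + germ_b F c (z + 1)" for z
    by (simp add: f_def germ_b_def germ_a_def)
  interpret plus: gevrey_solution 1 \<rho> 0 "germ_b F c" "germ_b1 F c \<rho>" f "L_plus R0 \<phi>hat" vp \<phi>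
  proof
    show "vp z = z + \<rho> * (0 + Ln (1 * z)) + L_plus R0 \<phi>hat z" if "1 * z \<notin> \<real>\<^sub>\<le>\<^sub>0" for z
      using that by (simp add: vp_def v_plus_def Log_plus_eq_Ln)
    show "\<exists>R>0. gevrey_asymptotic (L_plus R0 \<phi>hat) \<phi> (sector 1 R \<delta>)" if "0 < \<delta>" "\<delta> < pi/2" for \<delta>
      using gevrey_plus[OF that] by blast
  qed (use phi f_eq in \<open>auto simp: germ_b1_def\<close>)
  interpret minus: gevrey_solution "-1" \<rho> "\<i> * pi" "germ_b F c" "germ_b1 F c \<rho>" f "L_minus R0 \<phi>hat" vm \<phi>
  proof
    show "vm z = z + \<rho> * (\<i> * pi + Ln (- 1 * z)) + L_minus R0 \<phi>hat z" if "- 1 * z \<notin> \<real>\<^sub>\<le>\<^sub>0" for z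
      using that by (simp add: vm_def v_minus_def Log_minus_eq_Ln)
    show "\<exists>R>0. gevrey_asymptotic (L_minus R0 \<phi>hat) \<phi> (sector (-1) R \<delta>)" if "0 < \<delta>" "\<delta> < pi/2" for \<delta>
      using gevrey_minus[OF that] by blast
  qed (use phi f_eq in \<open>auto simp: germ_b1_def\<close>)
  have eventually_fatou: "\<forall>\<^sub>F R in at_top. P_plus R \<delta> = sector 1 R \<delta> \<and> P_minus R \<delta> = sector (-1) R \<delta> \<and>
      sector 1 R \<delta> \<subseteq> U_plus R0 \<and> sector (-1) R \<delta> \<subseteq> U_minus R0 \<and>
      gevrey_asymptotic (L_plus R0 \<phi>hat) \<phi> (sector 1 R \<delta>) \<and> gevrey_asymptotic (L_minus R0 \<phi>hat) \<phi> (sector (-1) R \<delta>) \<and>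
      fatou_pair f R \<delta> vp vm"
    if \<delta>: "0 < \<delta>" "\<delta> < pi/2" for \<delta>
  proof -
    obtain R1 where R1: "0 < R1" "sector 1 R1 \<delta> \<subseteq> U_plus R0" "gevrey_asymptotic (L_plus R0 \<phi>hat) \<phi> (sector 1 R1 \<delta>)"
      using gevrey_plus[OF \<delta>] by blast
    obtain R2 where R2: "0 < R2" "sector (-1) R2 \<delta> \<subseteq> U_minus R0" "gevrey_asymptotic (L_minus R0 \<phi>hat) \<phi> (sector (-1) R2 \<delta>)"
      using gevrey_minus[OF \<delta>] by blast
    obtain R3 where R3: "vp holomorphic_on sector 1 R3 \<delta>" "inj_on vp (sector 1 R3 \<delta>)"
      "\<And>z. z \<in> sector 1 R3 \<delta> \<Longrightarrow> f z \<in> sector 1 R3 \<delta> \<Longrightarrow> vp (f z) = vp z + 1"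
      using plus.fatou_coordinate_exists[OF \<delta>] by blast
    obtain R4 where R4: "vm holomorphic_on sector (-1) R4 \<delta>" "inj_on vm (sector (-1) R4 \<delta>)"
      "\<And>z. z \<in> sector (-1) R4 \<delta> \<Longrightarrow> f z \<in> sector (-1) R4 \<delta> \<Longrightarrow> vm (f z) = vm z + 1"
      using minus.fatou_coordinate_exists[OF \<delta>] by blast
    show ?thesis using eventually_ge_at_top[of "Max {R1, R2, R3, R4}"]
    proof eventually_elim
      case (elim R)
      then have R: "R1 \<le> R" "R2 \<le> R" "R3 \<le> R" "R4 \<le> R" by auto
      have "0 < R" using R(1) R1(1) by linarith
      note sub = sector_mono[OF R(1), of 1 \<delta>] sector_mono[OF R(2), of "-1" \<delta>]
        sector_mono[OF R(3), of 1 \<delta>] sector_mono[OF R(4), of "-1" \<delta>]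
      have P: "P_plus R \<delta> = sector 1 R \<delta>" "P_minus R \<delta> = sector (-1) R \<delta>"
        using \<open>0 < R\<close> \<delta> by (simp_all add: P_plus_eq_sector P_minus_eq_sector)
      have "fatou_coordinate_on f (sector 1 R \<delta>) vp"
        unfolding fatou_coordinate_on_def using R3 sub(3)
        by (meson holomorphic_on_subset inj_on_subset subsetD)
      moreover have "fatou_coordinate_on f (sector (-1) R \<delta>) vm"
        unfolding fatou_coordinate_on_def using R4 sub(4)
        by (meson holomorphic_on_subset inj_on_subset subsetD)
      ultimately have "fatou_pair f R \<delta> vp vm"
        unfolding fatou_pair_def P using \<open>0 < R\<close> \<delta> by blast
      then show ?case
        using P sub(1,2) R1 R2 gevrey_asymptotic_subset by (meson order_trans)
    qed
  qed
  show ?thesis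
    unfolding f_def[symmetric] vp_def[symmetric] vm_def[symmetric]
  proof (intro conjI allI impI, goal_cases)
    case (1 \<delta>)
    show ?case using eventually_fatou[OF 1] by eventually_elim simp
  next
    case (2 \<delta>' \<delta>)
    have \<delta>0: "0 < \<delta>" "\<delta>' < pi/2" using 2 by linarith+
    obtain R1 where R1: "\<And>R. R1 \<le> R \<Longrightarrow> \<exists>R'>0. sector 1 R' \<delta>' \<subseteq> vp ` sector 1 R \<delta>"
      using plus.sector_subset_image[OF 2] by blast
    obtain R2 where R2: "\<And>R. R2 \<le> R \<Longrightarrow> \<exists>R'>0. sector (-1) R' \<delta>' \<subseteq> vm ` sector (-1) R \<delta>"
      using minus.sector_subset_image[OF 2] by blast
    show ?case
      using eventually_fatou[OF \<delta>0(1) 2(3)] eventually_ge_at_top[of R1] eventually_ge_at_top[of R2]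
    proof eventually_elim
      case (elim R)
      have "\<exists>R'>0. P_plus R' \<delta>' \<subseteq> vp ` sector 1 R \<delta>" "\<exists>R'>0. P_minus R' \<delta>' \<subseteq> vm ` sector (-1) R \<delta>"
        using R1[OF elim(2)] R2[OF elim(3)] P_plus_eq_sector[OF less_imp_le 2(1) \<delta>0(2)]
          P_minus_eq_sector[OF less_imp_le 2(1) \<delta>0(2)] by metis+
      then show ?case using elim(1) by (auto simp: fatou_pair_def fatou_coordinate_on_def)
    qed
  next
    case (3 R \<delta> Vp Vm)
    then have R: "0 < R" and \<delta>: "0 < \<delta>" "\<delta> < pi/2"
      and Vp: "fatou_coordinate_on f (sector 1 R \<delta>) Vp" and Vm: "fatou_coordinate_on f (sector (-1) R \<delta>) Vm"
      using P_plus_eq_sector P_minus_eq_sector by (auto simp: fatou_pair_def)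
    obtain cp R1 where R1: "\<And>z. z \<in> sector 1 R1 \<delta> \<Longrightarrow> Vp z = vp z + cp"
      using plus.fatou_coordinate_unique_up_to_constant[OF \<delta> R, of Vp] Vp
      unfolding fatou_coordinate_on_def by blast
    obtain cm R2 where R2: "\<And>z. z \<in> sector (-1) R2 \<delta> \<Longrightarrow> Vm z = vm z + cm"
      using minus.fatou_coordinate_unique_up_to_constant[OF \<delta> R, of Vm] Vm
      unfolding fatou_coordinate_on_def by blast
    show ?case
    proof (intro exI)
      show "\<forall>\<^sub>F R' in at_top. (\<forall>z\<in>P_plus R' \<delta>. Vp z = vp z + cp) \<and> (\<forall>z\<in>P_minus R' \<delta>. Vm z = vm z + cm)"
        using eventually_fatou[OF \<delta>] eventually_ge_at_top[of R1] eventually_ge_at_top[of R2]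
      proof eventually_elim
        case (elim R')
        then have "P_plus R' \<delta> \<subseteq> sector 1 R1 \<delta>" "P_minus R' \<delta> \<subseteq> sector (-1) R2 \<delta>"
          using sector_mono by auto
        then show ?case using R1 R2 by blast
      qed
    qed
  next
    case (4 cp cm \<delta>)
    have shift: "fatou_coordinate_on f D (\<lambda>z. u z + k)" if "fatou_coordinate_on f D u" for D u k
      using that unfolding fatou_coordinate_on_def by (auto simp: inj_on_def intro: holomorphic_intros)
    show ?case
      using eventually_fatou[OF 4] by eventually_elim (auto simp: fatou_pair_def intro: shift)
  qed
qed

end
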